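(* Let $q$ be a positive integer that is not a power of $2$, let $\pi$ be a permutation of $\{0,\dots,q-1\}$, and let $F_\pi:I\to I$ be the associated rotated odometer on $I=[0,1)$. Assume that $F_\pi$ is stationary, with substitution $\chi$ on the alphabet $\mathcal A$ (with doubled middle symbol if $q$ is odd) and associated matrix $M$, and that Lebesgue measure $\mathrm{Leb}$ is ergodic for $F_\pi$. Let $T_\pi:I\times\mathbb Z\to I\times\mathbb Z$, $T_\pi(x,n)=(F_\pi(x),n+\psi(x))$, be its $\mathbb Z$-extension with skew-function $\psi=1$ on $[0,\tfrac12)$ and $\psi=-1$ on $[\tfrac12,1)$. Let $\lambda_j$ be the eigenvalues of $M$ (with multiplicity) and $\ell_j$ the corresponding left eigenvectors. Assume that for all eigenvalues $\lambda_j$ of $M$ with $|\lambda_j|\ge1$ the left eigenvectors have weight $\psi(\ell_j)=0$, with the exception of one eigenvalue, $\lambda_c>1$ (for which not all the weights of the corresponding left eigenvectors vanish), and that $\lambda_c$ is a Pisot number. Suppose moreover that the algebraic and geometric multiplicities of $\lambda_c$ are equal. Then the measure $\mathrm{Leb}\otimes\nu$ of the $\mathbb Z$-extension $T_\pi$, where $\nu$ is counting measure on $\mathbb Z$, has infinitely many ergodic components.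
   Context: Rotated odometer. The von Neumann-Kakutani map $\mathfrak a:I\to I$, $I=[0,1)$, is $\mathfrak a(x)=x-(1-3\cdot 2^{-n})$ if $x\in[1-2^{1-n},1-2^{-n})$, $n\ge1$. For a permutation $\pi$ of $\{0,\dots,q-1\}$ put $R_\pi(x)=x+\frac{\pi(j)-j}{q}$ if $x\in[\frac jq,\frac{j+1}q)$. The rotated odometer is $F_\pi=\mathfrak a\circ R_\pi$; it preserves Lebesgue measure and is invertible except that $0$ has no preimage. Substitutions. Let $N=\min\{n\ge1:2^n\ge q\}$, $L_k=[0,2^{-kN})$ for $k\ge0$, and $L_{k,i}=[\frac{i}{q2^{kN}},\frac{i+1}{q2^{kN}})$ for $0\le i\le q-1$, so that the $L_{k,i}$ partition $L_k$. Let $F_{\pi,k}:L_k\to L_k$ be the first return map of $F_\pi$ to $L_k$ ($F_{\pi,0}=F_\pi$). It is known that for $k\ge1$ all points of $L_{k,i}$ have the same first return time $t_{k,i}$ to $L_k$ under $F_{\pi,k-1}$ and that, for $0\le j<t_{k,i}$, the set $F_{\pi,k-1}^j(L_{k,i})$ is an interval contained in a single $L_{k-1,w_j}$; define the word $\chi_k(i)=w_0w_1\cdots w_{t_{k,i}-1}$ over the alphabet $\{0,\dots,q-1\}$. This gives substitutions $\chi_k$, extended to words by concatenation. $F_\pi$ is called stationary if $\chi_k=\chi_1=:\chi$ for all $k\ge1$. Doubling the middle symbol. If $q$ is even, $\mathcal A=\{0,\dots,q-1\}$ and $\chi$ is unchanged. If $q$ is odd, let $m=(q-1)/2$; the letter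 $m$ is replaced by two letters $m^+$ (for the interval $[\frac mq,\frac12)$) and $m^-$ (for $[\frac12,\frac{m+1}q)$), giving the alphabet $\mathcal A=\{0,\dots,m-1,m^+,m^-,m+1,\dots,q-1\}$ with $q+1$ letters. The substitution, still called $\chi$, assigns to $a\in\mathcal A\setminus\{m^\pm\}$ the itinerary of $L_{1,a}$ under $F_\pi$ up to its first return to $L_1$ with respect to this refined partition of $I$, and to both $m^+$ and $m^-$ the itinerary of $L_{1,m}$ (these itineraries are well defined). The associated matrix $M$ is the $\mathcal A\times\mathcal A$ matrix whose $(a,b)$ entry is the number of letters $b$ in $\chi(a)$. Weights. For a letter $a\in\mathcal A$, $\psi(a)=+1$ if the interval of $I$ corresponding to $a$ lies in $[0,\frac12)$ and $\psi(a)=-1$ if it lies in $[\frac12,1)$. For a row vector $\ell=(\ell(a))_{a\in\mathcal A}$, $\psi(\ell)=\sum_{a\in\mathcal A}\ell(a)\psi(a)$. Left eigenvectors. The vectors $\ell_j$ are, for some fixed Jordan decomposition $M=UJU^{-1}$, the rows of $U^{-1}$ (so they include generalized left eigenvectors where $J$ has non-trivial blocks); $\lambda_j$ is the corresponding diagonal entry of $J$. A Pisot number is an algebraic integer $>1$ all of whose other Galois conjugates lie strictly inside the unit circle. "Ergodic components" refers to the ergodic decomposition of the $\sigma$-finite $T_\pi$-invariant measure $\mathrm{Leb}\otimes\nu$. *)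

theory Defs
  imports
    "HOL-Probability.Probability_Measure"
    "HOL-Combinatorics.Permutations"
    "Jordan_Normal_Form.Jordan_Normal_Form"
    "Jordan_Normal_Form.Matrix_Kernel"
begin

text \<open>All maps of \<open>I = [0,1)\<close> are total functions on the reals; only their values on \<open>I\<close>
  are meaningful.\<close>

definition vn_kakutani :: "real \<Rightarrow> real" where
  "vn_kakutani x =
    (let n = (THE n::nat. 1 \<le> n \<and> 1 - 2 / 2 ^ n \<le> x \<and> x < 1 - 1 / 2 ^ n)
     in x - (1 - 3 / 2 ^ n))"

definition rotation :: "nat \<Rightarrow> (nat \<Rightarrow> nat) \<Rightarrow> real \<Rightarrow> real" where
  "rotation q \<pi> x =
    (let j = nat \<lfloor>real q * x\<rfloor> in x + (real (\<pi> j) - real j) / real q)"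

definition rot_odometer :: "nat \<Rightarrow> (nat \<Rightarrow> nat) \<Rightarrow> real \<Rightarrow> real" where
  "rot_odometer q \<pi> = vn_kakutani \<circ> rotation q \<pi>"

definition return_time :: "('a \<Rightarrow> 'a) \<Rightarrow> 'a set \<Rightarrow> 'a \<Rightarrow> nat" where
  "return_time f A x = (LEAST n. 1 \<le> n \<and> (f ^^ n) x \<in> A)"

definition return_map :: "('a \<Rightarrow> 'a) \<Rightarrow> 'a set \<Rightarrow> 'a \<Rightarrow> 'a" where
  "return_map f A x = (f ^^ return_time f A x) x"

definition expo :: "nat \<Rightarrow> nat" where
  "expo q = (LEAST n. 1 \<le> n \<and> q \<le> 2 ^ n)"

definition base_interval :: "nat \<Rightarrow> nat \<Rightarrow> real set" where
  "base_interval q k = {0 ..< 1 / 2 ^ (k * expo q)}"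

definition sub_interval :: "nat \<Rightarrow> nat \<Rightarrow> nat \<Rightarrow> real set" where
  "sub_interval q k i =
    {real i / (real q * 2 ^ (k * expo q)) ..< real (i + 1) / (real q * 2 ^ (k * expo q))}"

definition induced_map :: "nat \<Rightarrow> (nat \<Rightarrow> nat) \<Rightarrow> nat \<Rightarrow> real \<Rightarrow> real" where
  "induced_map q \<pi> k = return_map (rot_odometer q \<pi>) (base_interval q k)"

text \<open>The next two definitions are used only for \<open>k \<ge> 1\<close>. There the return time is constant on
  \<open>sub_interval q k i\<close>, and the images of that interval before the return lie in single
  intervals of the partition, so that both definite descriptions denote.\<close>

definition common_return_time :: "nat \<Rightarrow> (nat \<Rightarrow> nat) \<Rightarrow> nat \<Rightarrow> nat \<Rightarrow> nat" where
  "common_return_time q \<pi> k i =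
    (THE t. \<forall>x\<in>sub_interval q k i.
       return_time (induced_map q \<pi> (k - 1)) (base_interval q k) x = t)"

definition subst_word :: "nat \<Rightarrow> (nat \<Rightarrow> nat) \<Rightarrow> nat \<Rightarrow> nat \<Rightarrow> nat list" where
  "subst_word q \<pi> k i =
    map (\<lambda>j. THE w. w < q \<and>
           (induced_map q \<pi> (k - 1) ^^ j) ` sub_interval q k i \<subseteq> sub_interval q (k - 1) w)
      [0 ..< common_return_time q \<pi> k i]"

definition stationary :: "nat \<Rightarrow> (nat \<Rightarrow> nat) \<Rightarrow> bool" where
  "stationary q \<pi> \<longleftrightarrow> (\<forall>k\<ge>1. \<forall>i<q. subst_word q \<pi> k i = subst_word q \<pi> 1 i)"

text \<open>The alphabet with doubled middle symbol is encoded as \<open>{..<alphabet_size q}\<close>, enumerating the letters from left to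
  right. For odd \<open>q\<close> and \<open>m = (q - 1) / 2\<close>, the number \<open>m\<close> encodes \<open>m\<^sup>+\<close>, the number \<open>m + 1\<close>
  encodes \<open>m\<^sup>-\<close>, and \<open>a + 1\<close> encodes every original letter \<open>a > m\<close>.\<close>

definition alphabet_size :: "nat \<Rightarrow> nat" where
  "alphabet_size q = (if even q then q else q + 1)"

text \<open>The original letter in \<open>{..<q}\<close>, with \<open>m\<^sup>+\<close> and \<open>m\<^sup>-\<close> both sent to \<open>m\<close>.\<close>

definition orig_letter :: "nat \<Rightarrow> nat \<Rightarrow> nat" where
  "orig_letter q a = (if odd q \<and> a > (q - 1) div 2 then a - 1 else a)"

definition letter_interval :: "nat \<Rightarrow> nat \<Rightarrow> real set" where
  "letter_interval q a =
    (let m = (q - 1) div 2 in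
     if odd q \<and> a = m then {real m / real q ..< 1 / 2}
     else if odd q \<and> a = m + 1 then {1 / 2 ..< real (m + 1) / real q}
     else {real (orig_letter q a) / real q ..< real (orig_letter q a + 1) / real q})"

definition doubled_subst :: "nat \<Rightarrow> (nat \<Rightarrow> nat) \<Rightarrow> nat \<Rightarrow> nat list" where
  "doubled_subst q \<pi> a =
    map (\<lambda>j. THE b. b < alphabet_size q \<and>
           (rot_odometer q \<pi> ^^ j) ` sub_interval q 1 (orig_letter q a) \<subseteq> letter_interval q b)
      [0 ..< common_return_time q \<pi> 1 (orig_letter q a)]"

definition subst_matrix :: "nat \<Rightarrow> (nat \<Rightarrow> nat) \<Rightarrow> complex mat" where
  "subst_matrix q \<pi> =
    Matrix.mat (alphabet_size q) (alphabet_size q)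
      (\<lambda>(a, b). of_nat (count_list (doubled_subst q \<pi> a) b))"

definition skew :: "real \<Rightarrow> int" where
  "skew x = (if x < 1 / 2 then 1 else - 1)"

definition skew_letter :: "nat \<Rightarrow> nat \<Rightarrow> int" where
  "skew_letter q a = (if letter_interval q a \<subseteq> {0 ..< 1 / 2} then 1 else - 1)"

definition weight :: "nat \<Rightarrow> complex Matrix.vec \<Rightarrow> complex" where
  "weight q l = (\<Sum>a<alphabet_size q. vec_index l a * of_int (skew_letter q a))"

definition Z_extension :: "nat \<Rightarrow> (nat \<Rightarrow> nat) \<Rightarrow> real \<times> int \<Rightarrow> real \<times> int" where
  "Z_extension q \<pi> = (\<lambda>(x, n). (rot_odometer q \<pi> x, n + skew x))"

definition leb_I :: "real measure" where
  "leb_I = restrict_space lborel {0 ..< 1}"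

definition galois_conjugate :: "complex \<Rightarrow> complex \<Rightarrow> bool" where
  "galois_conjugate x z \<longleftrightarrow>
    (\<exists>p :: rat poly. irreducible p \<and>
       poly (map_poly of_rat p) x = 0 \<and> poly (map_poly of_rat p) z = 0)"

definition pisot :: "real \<Rightarrow> bool" where
  "pisot x \<longleftrightarrow> algebraic_int x \<and> x > 1 \<and>
    (\<forall>z. galois_conjugate (complex_of_real x) z \<and> z \<noteq> complex_of_real x \<longrightarrow> norm z < 1)"

definition invariant_measure :: "'a measure \<Rightarrow> ('a \<Rightarrow> 'a) \<Rightarrow> bool" where
  "invariant_measure M T \<longleftrightarrow> T \<in> measurable M M \<and> distr M M T = M"

definition ergodic_measure :: "'a measure \<Rightarrow> ('a \<Rightarrow> 'a) \<Rightarrow> bool" where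
  "ergodic_measure M T \<longleftrightarrow>
    (\<forall>A\<in>sets M. T -` A \<inter> space M = A \<longrightarrow>
       emeasure M A = 0 \<or> emeasure M (space M - A) = 0)"

definition ergodic_decomposition ::
    "'a measure \<Rightarrow> ('a \<Rightarrow> 'a) \<Rightarrow> 'y measure \<Rightarrow> ('y \<Rightarrow> 'a measure) \<Rightarrow> bool" where
  "ergodic_decomposition M T P \<kappa> \<longleftrightarrow>
    prob_space P \<and>
    (\<forall>y\<in>space P. sets (\<kappa> y) = sets M) \<and>
    (AE y in P. sigma_finite_measure (\<kappa> y) \<and> emeasure (\<kappa> y) (space M) \<noteq> 0 \<and>
       invariant_measure (\<kappa> y) T \<and> ergodic_measure (\<kappa> y) T) \<and>
    (\<forall>A\<in>sets M. (\<lambda>y. emeasure (\<kappa> y) A) \<in> borel_measurable P \<and>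
       emeasure M A = (\<integral>\<^sup>+ y. emeasure (\<kappa> y) A \<partial>P))"

text \<open>Every \<open>\<sigma>\<close>-finite invariant measure on a standard Borel space has an ergodic decomposition,
  and it is essentially unique, so a statement about the ergodic decomposition can be made about
  an arbitrary pair \<open>P\<close>, \<open>\<kappa>\<close>. Its components are determined only up to positive scalar
  factors (which \<open>P\<close> can absorb) and up to a \<open>P\<close>-null set of indices, so they are counted
  modulo both.\<close>

definition infinitely_many_components :: "'y measure \<Rightarrow> ('y \<Rightarrow> 'a measure) \<Rightarrow> bool" where
  "infinitely_many_components P \<kappa> \<longleftrightarrow>
    \<not> (\<exists>C. finite C \<and>
         (AE y in P. \<exists>\<nu>\<in>C. \<exists>c. 0 < c \<and> c < \<infinity> \<and> \<kappa> y = scale_measure c \<nu>))"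

end

theory Submission
  imports
    Defs
    "HOL-Combinatorics.Combinatorics"
    "HOL-Probability.Characteristic_Functions"
    "Jordan_Normal_Form.Jordan_Normal_Form_Uniqueness"
begin

text \<open>Let \<open>V\<^sub>k(a)\<close> be the sum of the skew-function along the first return to \<open>L\<^sub>k\<close> of the points of
  \<open>L\<^sub>k\<^sub>,\<^sub>a\<close>; by stationarity \<open>V\<^sub>k = M\<^sup>k \<psi>\<close>. The hypotheses on the weights and on the
  multiplicity of \<open>\<lambda> = \<lambda>\<^sub>c\<close> make \<open>V\<^sub>k\<^sub>+\<^sub>1 - \<lambda> V\<^sub>k\<close> summable. Put \<open>\<theta> = \<lambda>\<^sup>-\<^sup>j\<close>. Then
  \<open>\<theta> V\<^sub>k\<close> is summably close to the integer vector \<open>V\<^sub>k\<^sub>-\<^sub>j\<close>. Let \<open>u\<^sub>k(x)\<close> be the sum of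
  the skew-function up to the first entry of \<open>x\<close> to \<open>L\<^sub>k\<close>. Since entering \<open>L\<^sub>k\<^sub>+\<^sub>1\<close> from
  \<open>L\<^sub>k\<close> takes a bounded number of returns, the phases \<open>exp (2 \<pi> i \<theta> u\<^sub>k(x))\<close> converge to a function
  \<open>E\<close>, and \<open>E(x) exp (2 \<pi> i \<theta> n)\<close> is invariant under the extension. Its values on the fibre over \<open>n\<close> are
  those on the fibre over \<open>0\<close> rotated by \<open>\<theta> n\<close>, so for \<open>\<theta> N < 1\<close> there are \<open>N\<close> disjoint
  invariant sets of positive measure, each of which needs an ergodic component of its own.\<close>

unbundle no vec_syntax

section \<open>Iterates in Jordan coordinates\<close>

text \<open>The Jordan coordinates of \<open>V\<^sub>0 = \<psi>\<close> are the weights of the left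
  eigenvectors. Vanishing weights remove every non-decaying coordinate except those of
  \<open>\<lambda>\<close>, and equal multiplicities rule out nontrivial blocks of
  \<open>\<lambda>\<close>, whose polynomial factors would survive in
  \<open>V\<^sub>k\<^sub>+\<^sub>1 - \<lambda> V\<^sub>k\<close>. Negative powers of
  \<open>\<lambda>\<close> serve as \<open>\<theta>\<close> because \<open>V\<^sub>k\<close> is
  close to \<open>\<lambda>\<^sup>j V\<^sub>k\<^sub>-\<^sub>j\<close>, whose second factor is
  integral as a vector of sums of signs; a large \<open>j\<close> makes \<open>\<theta>\<close>
  small. Two obstacles shape the rest. The return map to \<open>L\<^sub>k\<close> is a rescaled
  rotated odometer, but for a permutation of its own; the bound on the number of returns is
  therefore the number of cells, \<open>q * 2 ^ expo q\<close>, which is the same for all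
  permutations. And an orbit may miss \<open>L\<^sub>k\<close>; the points whose orbits meet it form
  an invariant set containing \<open>L\<^sub>k\<close>, so ergodicity makes the others
  negligible.\<close>

lemma jordan_matrix_offdiag:
  fixes bs :: "(nat \<times> 'a :: {zero,one}) list"
  assumes "i < sum_list (map fst bs)" "j < sum_list (map fst bs)"
    and "jordan_matrix bs $$ (i, j) \<noteq> 0" "i \<noteq> j"
  shows "j = Suc i \<and> jordan_matrix bs $$ (j, j) = jordan_matrix bs $$ (i, i) \<and>
    (\<exists>m\<ge>2. (m, jordan_matrix bs $$ (i, i)) \<in> set bs)"
  using assms
proof (induction bs arbitrary: i j)
  case Nil
  then show ?case by simp
next
  case (Cons b bs)
  obtain m a where b: "b = (m, a)" by (cases b)
  let ?s = "sum_list (map fst bs)"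
  have idx: "jordan_matrix (b # bs) $$ (i, j) =
      (if i < m then if j < m then jordan_block m a $$ (i, j) else 0
       else if j < m then 0 else jordan_matrix bs $$ (i - m, j - m))"
    if "i < m + ?s" "j < m + ?s" for i j
    using that unfolding b jordan_matrix_Cons by (subst index_mat_four_block) auto
  have ij: "i < m + ?s" "j < m + ?s" using Cons.prems(1,2) b by auto
  show ?case
  proof (cases "i < m")
    case True
    with Cons.prems(3) idx[OF ij] have jm: "j < m" and nz: "jordan_block m a $$ (i, j) \<noteq> 0"
      by (auto split: if_splits)
    have "j = Suc i"
      using nz True jm Cons.prems(4) by (auto split: if_splits)
    moreover have "m \<ge> 2" using \<open>j = Suc i\<close> jm by simp
    ultimately show ?thesis
      using idx[OF ij(1,1)] idx[OF ij(2,2)] True jm b by (auto intro: exI[of _ m])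
  next
    case False
    with Cons.prems(3) idx[OF ij] have jm: "\<not> j < m"
      and nz: "jordan_matrix bs $$ (i - m, j - m) \<noteq> 0"
      by (auto split: if_splits)
    have "j - m = Suc (i - m) \<and>
        jordan_matrix bs $$ (j - m, j - m) = jordan_matrix bs $$ (i - m, i - m) \<and>
        (\<exists>n\<ge>2. (n, jordan_matrix bs $$ (i - m, i - m)) \<in> set bs)"
      using Cons.IH[of "i - m" "j - m"] nz ij False jm Cons.prems(4) by auto
    then show ?thesis
      using idx[OF ij(1,1)] idx[OF ij(2,2)] False jm by auto
  qed
qed

text \<open>\<open>jordan_nf\<close> forbids blocks of size zero, while
  \<open>similar_mat_wit\<close> admits them. They contribute no rows, so they may be
  dropped.\<close>

lemma jordan_matrix_filter_empty_blocks:
  "jordan_matrix (filter (\<lambda>b. 0 < fst b) bs) = jordan_matrix bs"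
proof (induction bs)
  case (Cons b bs)
  obtain m a where b: "b = (m, a)" by (cases b)
  show ?case
  proof (cases "m = 0")
    case True
    have "jordan_matrix (b # bs) = jordan_matrix bs"
      unfolding b jordan_matrix_Cons True by (rule eq_matI) auto
    then show ?thesis using Cons.IH b True by simp
  next
    case False
    have s: "sum_list (map fst (filter (\<lambda>b. 0 < fst b) bs)) = sum_list (map fst bs)"
      by (induction bs) auto
    show ?thesis using False by (simp add: b jordan_matrix_Cons Cons.IH s)
  qed
qed simp

lemma sum_list_min_one:
  fixes ns :: "nat list"
  assumes "sum_list (map (min 1) ns) = sum_list ns" "n \<in> set ns"
  shows "n \<le> 1"
  using assms
proof (induction ns)
  case (Cons a ns)
  have "sum_list (map (min 1) ns) \<le> sum_list ns" by (induction ns) auto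
  moreover have "min 1 a + sum_list (map (min 1) ns) = a + sum_list ns"
    using Cons.prems(1) by simp
  ultimately have "min 1 a = a" "sum_list (map (min 1) ns) = sum_list ns"
    by linarith+
  with Cons.IH Cons.prems(2) show ?case by (metis min.cobounded1 set_ConsD)
qed simp

text \<open>The order of \<open>l\<close> in the characteristic polynomial is the sum of the sizes
  of its blocks, and the dimension of the kernel is the number of its nonempty blocks. Equality
  leaves no block larger than one.\<close>

lemma semisimple_eigenvalue_block_size:
  fixes A :: "'a :: field mat"
  assumes sim: "similar_mat A (jordan_matrix bs)"
    and mult: "Polynomial.order l (char_poly A) = kernel_dim (char_matrix A l)"
    and mem: "(m, l) \<in> set bs"
  shows "m \<le> 1"
proof (cases "m = 0")
  case False
  let ?bs = "filter (\<lambda>b. 0 < fst b) bs"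
  have nf: "jordan_nf A ?bs"
    unfolding jordan_nf_def using sim by (auto simp: jordan_matrix_filter_empty_blocks)
  obtain n where A: "A \<in> carrier_mat n n" using sim similar_matD by blast
  have c: "char_matrix A l \<in> carrier_mat n n" using A by simp
  have "dim_gen_eigenspace A l 1 = kernel_dim (char_matrix A l)"
    unfolding dim_gen_eigenspace_def using c by simp
  then have "sum_list (map (min 1) (map fst (filter (\<lambda>(n, e). e = l) ?bs)))
      = sum_list (map fst (filter (\<lambda>na. snd na = l) ?bs))"
    using dim_gen_eigenspace[OF nf, of l 1] jordan_nf_order[OF nf, of l] mult by simp
  moreover have "(\<lambda>(n, e). e = l) = (\<lambda>na :: nat \<times> 'a. snd na = l)" by auto
  ultimately show ?thesis
    using sum_list_min_one[of "map fst (filter (\<lambda>na. snd na = l) ?bs)" m] mem False by force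
qed simp

text \<open>Summing the recurrence bounds a partial sum \<open>S\<close> by
  \<open>norm (x 0) + norm \<mu> * S + Y\<close>, which can be solved for \<open>S\<close> since
  \<open>norm \<mu> < 1\<close>.\<close>

lemma summable_norm_linear_recurrence:
  fixes x y :: "nat \<Rightarrow> complex"
  assumes rec: "\<And>k. x (Suc k) = \<mu> * x k + y k"
    and \<mu>: "norm \<mu> < 1" and y: "summable (\<lambda>k. norm (y k))"
  shows "summable (\<lambda>k. norm (x k))"
proof (rule bounded_imp_summable)
  fix n
  let ?Y = "\<Sum>k. norm (y k)"
  let ?S = "\<Sum>k\<le>n. norm (x k)"
  have "?S \<le> (\<Sum>k\<le>Suc n. norm (x k))" by simp
  also have "\<dots> = norm (x 0) + (\<Sum>k\<le>n. norm (x (Suc k)))"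
    by (rule sum.atMost_Suc_shift)
  also have "(\<Sum>k\<le>n. norm (x (Suc k))) \<le> (\<Sum>k\<le>n. norm \<mu> * norm (x k) + norm (y k))"
    unfolding rec by (intro sum_mono) (metis norm_mult norm_triangle_ineq)
  also have "\<dots> = norm \<mu> * ?S + (\<Sum>k\<le>n. norm (y k))"
    by (simp add: sum.distrib sum_distrib_left)
  also have "(\<Sum>k\<le>n. norm (y k)) \<le> ?Y"
    by (rule sum_le_suminf[OF y]) auto
  finally have "?S * (1 - norm \<mu>) \<le> norm (x 0) + ?Y" by (simp add: algebra_simps)
  then show "?S \<le> (norm (x 0) + ?Y) / (1 - norm \<mu>)"
    using \<mu> by (simp add: pos_le_divide_eq)
qed simp

text \<open>In Jordan coordinates \<open>z\<^sub>k\<close>, the vector \<open>z\<^sub>k\<^sub>+\<^sub>1 - \<lambda> z\<^sub>k\<close> is supported on the blocks of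
  spectral radius below one.\<close>

lemma summable_iterate_minus_eigenvalue:
  fixes A :: "complex mat"
  assumes wit: "similar_mat_wit A (jordan_matrix bs) U Uinv"
    and A: "A \<in> carrier_mat n n"
    and x0: "x 0 \<in> carrier_vec n" and xS: "\<And>k. x (Suc k) = A *\<^sub>v x k"
    and supp: "\<And>j. j < n \<Longrightarrow> norm (jordan_matrix bs $$ (j, j)) \<ge> 1 \<Longrightarrow>
        jordan_matrix bs $$ (j, j) \<noteq> l \<Longrightarrow> (Uinv *\<^sub>v x 0) $ j = 0"
    and mult: "Polynomial.order l (char_poly A) = kernel_dim (char_matrix A l)"
    and i: "i < n"
  shows "summable (\<lambda>k. norm (x (Suc k) $ i - l * x k $ i))"
proof -
  define J where "J = jordan_matrix bs"
  have car: "J \<in> carrier_mat n n" "U \<in> carrier_mat n n" "Uinv \<in> carrier_mat n n"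
    and inv: "Uinv * U = 1\<^sub>m n" "U * Uinv = 1\<^sub>m n" and AJ: "A = U * J * Uinv"
    using wit A unfolding similar_mat_wit_def J_def by (auto simp: Let_def)
  have dim: "sum_list (map fst bs) = n" using car(1) unfolding J_def by auto
  have xk: "x k \<in> carrier_vec n" for k
    by (induction k) (use x0 xS A in auto)
  define z where "z k = Uinv *\<^sub>v x k" for k
  have zk: "z k \<in> carrier_vec n" for k unfolding z_def using car xk by auto
  have xz: "x k = U *\<^sub>v z k" for k
    unfolding z_def using car xk[of k] inv by (simp flip: assoc_mult_mat_vec)
  have zS: "z (Suc k) = J *\<^sub>v z k" for k
  proof -
    have "z (Suc k) = Uinv *\<^sub>v (U *\<^sub>v (J *\<^sub>v (Uinv *\<^sub>v x k)))"
      unfolding z_def xS AJ using car xk[of k]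
      by (simp add: assoc_mult_mat_vec[of _ n n _ n] del: assoc_mult_mat)
    also have "\<dots> = (Uinv * U) *\<^sub>v (J *\<^sub>v z k)"
      unfolding z_def using car xk[of k] by (simp add: assoc_mult_mat_vec[of _ n n _ n] del: assoc_mult_mat)
    finally show ?thesis using inv car zk[of k] by simp
  qed
  \<comment> \<open>A nonzero entry off the diagonal needs a block of size at least two, which
    \<open>l\<close> does not have.\<close>
  have off: "b = Suc a \<and> J $$ (b, b) = J $$ (a, a) \<and> J $$ (a, a) \<noteq> l"
    if "a < n" "b < n" "J $$ (a, b) \<noteq> 0" "a \<noteq> b" for a b
    using jordan_matrix_offdiag[of a bs b] that dim
      semisimple_eigenvalue_block_size[of A bs l, OF _ mult] wit
    unfolding J_def similar_mat_def by fastforce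
  \<comment> \<open>The superdiagonal entry. Its default 0 in the last row cancels the out-of-range
    coordinate \<open>z k $ Suc a\<close> in the recurrence below.\<close>
  define s where "s a = (if Suc a < n then J $$ (a, Suc a) else 0)" for a
  have zS': "z (Suc k) $ a = J $$ (a, a) * z k $ a + s a * z k $ Suc a" if a: "a < n" for k a
  proof -
    have "z (Suc k) $ a = (\<Sum>b = 0..<n. J $$ (a, b) * z k $ b)"
      unfolding zS using a car zk[of k] by (simp add: scalar_prod_def)
    also have "\<dots> = (\<Sum>b \<in> {a} \<union> ({Suc a} \<inter> {0..<n}). J $$ (a, b) * z k $ b)"
    proof (intro sum.mono_neutral_right ballI)
      fix b assume "b \<in> {0..<n} - ({a} \<union> {Suc a} \<inter> {0..<n})"
      then have "b < n" "b \<noteq> a" "b \<noteq> Suc a" by auto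
      then have "J $$ (a, b) = 0" using off[OF a, of b] by metis
      then show "J $$ (a, b) * z k $ b = 0" by simp
    qed (use a in auto)
    also have "\<dots> = J $$ (a, a) * z k $ a + s a * z k $ Suc a"
      by (auto simp: s_def)
    finally show ?thesis .
  qed
  define y where "y k a = z (Suc k) $ a - l * z k $ a" for k a
  have yS: "y (Suc k) a = J $$ (a, a) * y k a + s a * y k (Suc a)" if a: "a < n" for k a
    unfolding y_def using zS'[OF a] by (simp add: algebra_simps)
  have s_imp: "Suc a < n \<and> J $$ (Suc a, Suc a) = J $$ (a, a) \<and> J $$ (a, a) \<noteq> l"
    if "a < n" "s a \<noteq> 0" for a
    using off[of a "Suc a"] that unfolding s_def by (auto split: if_splits)
  \<comment> \<open>The superdiagonal couples only coordinates with the same eigenvalue, so the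
    coordinates that vanish at time 0 stay zero.\<close>
  have z0: "z k $ a = 0" if "a < n" "norm (J $$ (a, a)) \<ge> 1" "J $$ (a, a) \<noteq> l" for k a
    using that
  proof (induction k arbitrary: a)
    case 0
    then show ?case using supp[of a] unfolding z_def J_def by simp
  next
    case (Suc k)
    then show ?case using zS'[of a k] s_imp[of a] by (cases "s a = 0") auto
  qed
  have y0: "y k a = 0" if "a < n" "norm (J $$ (a, a)) \<ge> 1" for k a
  proof (cases "J $$ (a, a) = l")
    case True
    then have "s a = 0" using s_imp that by auto
    then show ?thesis unfolding y_def zS'[OF that(1)] using True by simp
  next
    case False
    then show ?thesis unfolding y_def using z0 that by simp
  qed
  \<comment> \<open>Within a block, row \<open>a\<close> is driven by row \<open>Suc a\<close>; the
    induction therefore runs from the last row upwards.\<close>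
  have sy: "summable (\<lambda>k. norm (y k a))" if "a < n" for a
    using that
  proof (induction "n - a" arbitrary: a rule: less_induct)
    case less
    show ?case
    proof (cases "norm (J $$ (a, a)) < 1")
      case True
      have "summable (\<lambda>k. norm (s a * y k (Suc a)))"
      proof (cases "s a = 0")
        case False
        then have "Suc a < n" using s_imp less.prems by blast
        then have "summable (\<lambda>k. norm (y k (Suc a)))" using less by auto
        then show ?thesis by (simp add: norm_mult summable_mult)
      qed simp
      then show ?thesis
        using summable_norm_linear_recurrence[of "\<lambda>k. y k a" _ "\<lambda>k. s a * y k (Suc a)", OF _ True] yS[OF less.prems]
        by blast
    next
      case False
      then show ?thesis using y0 less.prems by simp
    qed
  qed
  have Uz: "x k $ i = (\<Sum>a = 0..<n. U $$ (i, a) * z k $ a)" for k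
    unfolding xz using i car zk[of k] by (auto simp: scalar_prod_def)
  have "x (Suc k) $ i - l * x k $ i = (\<Sum>a = 0..<n. U $$ (i, a) * y k a)" for k
    unfolding Uz y_def by (simp add: sum_distrib_left algebra_simps flip: sum_subtractf)
  moreover have "summable (\<lambda>k. \<Sum>a = 0..<n. norm (U $$ (i, a)) * norm (y k a))"
    using sy by (intro summable_sum summable_mult) auto
  moreover have "norm (\<Sum>a = 0..<n. U $$ (i, a) * y k a)
      \<le> (\<Sum>a = 0..<n. norm (U $$ (i, a)) * norm (y k a))" for k
    by (rule order_trans[OF norm_sum]) (simp add: norm_mult)
  ultimately show ?thesis
    by (intro summable_comparison_test[of "\<lambda>k. norm (x (Suc k) $ i - l * x k $ i)"]) auto
qed

section \<open>First entry and first return\<close>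

definition entry_time :: "('a \<Rightarrow> 'a) \<Rightarrow> 'a set \<Rightarrow> 'a \<Rightarrow> nat" where
  "entry_time f A x = (LEAST n. (f ^^ n) x \<in> A)"

definition birkhoff_sum :: "('a \<Rightarrow> 'a) \<Rightarrow> ('a \<Rightarrow> int) \<Rightarrow> nat \<Rightarrow> 'a \<Rightarrow> int" where
  "birkhoff_sum f \<phi> n x = (\<Sum>j<n. \<phi> ((f ^^ j) x))"

lemma birkhoff_sum_add:
  "birkhoff_sum f \<phi> (m + n) x = birkhoff_sum f \<phi> m x + birkhoff_sum f \<phi> n ((f ^^ m) x)"
proof (induction n)
  case (Suc n)
  have "(f ^^ (m + n)) x = (f ^^ n) ((f ^^ m) x)"
    by (metis add.commute comp_apply funpow_add)
  then show ?case using Suc by (simp add: birkhoff_sum_def)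
qed (simp add: birkhoff_sum_def)

lemma entry_time_props:
  assumes "(f ^^ n) x \<in> A"
  shows "(f ^^ entry_time f A x) x \<in> A" "entry_time f A x \<le> n"
    "m < entry_time f A x \<Longrightarrow> (f ^^ m) x \<notin> A"
  using LeastI[of "\<lambda>n. (f ^^ n) x \<in> A", OF assms] Least_le[of "\<lambda>n. (f ^^ n) x \<in> A", OF assms]
    not_less_Least[of m "\<lambda>n. (f ^^ n) x \<in> A"]
  unfolding entry_time_def by blast+

lemma entry_time_eqI:
  assumes "(f ^^ n) x \<in> A" "\<And>m. m < n \<Longrightarrow> (f ^^ m) x \<notin> A"
  shows "entry_time f A x = n"
  unfolding entry_time_def using assms by (intro Least_equality) (auto simp: not_less[symmetric])

lemma entry_time_shift:
  assumes avoid: "\<And>m. m < n \<Longrightarrow> (f ^^ m) x \<notin> A" and hit: "(f ^^ k) ((f ^^ n) x) \<in> A"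
  shows "entry_time f A x = n + entry_time f A ((f ^^ n) x)"
proof (rule entry_time_eqI)
  let ?e = "entry_time f A ((f ^^ n) x)"
  have app: "(f ^^ (n + j)) x = (f ^^ j) ((f ^^ n) x)" for j
    by (metis add.commute comp_apply funpow_add)
  show "(f ^^ (n + ?e)) x \<in> A" unfolding app using entry_time_props(1)[of k f] hit by blast
  fix m assume m: "m < n + ?e"
  show "(f ^^ m) x \<notin> A"
  proof (cases "m < n")
    case False
    then have "m = n + (m - n)" by simp
    then show ?thesis
      using app[of "m - n"] entry_time_props(3)[of k f _ A "m - n"] hit m by auto
  qed (use avoid in auto)
qed

lemma return_time_props:
  assumes "1 \<le> n" "(f ^^ n) x \<in> A"
  shows "1 \<le> return_time f A x" "(f ^^ return_time f A x) x \<in> A" "return_time f A x \<le> n"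
    "\<And>m. 1 \<le> m \<Longrightarrow> m < return_time f A x \<Longrightarrow> (f ^^ m) x \<notin> A"
proof -
  let ?P = "\<lambda>n. 1 \<le> n \<and> (f ^^ n) x \<in> A"
  have P: "?P n" using assms by simp
  show "1 \<le> return_time f A x" "(f ^^ return_time f A x) x \<in> A" "return_time f A x \<le> n"
    using LeastI[of ?P, OF P] Least_le[of ?P, OF P] unfolding return_time_def by blast+
  show "(f ^^ m) x \<notin> A" if "1 \<le> m" "m < return_time f A x" for m
    using not_less_Least[of m ?P] that unfolding return_time_def by blast
qed

lemma return_time_eqI:
  assumes "1 \<le> n" "(f ^^ n) x \<in> A" "\<And>m. 1 \<le> m \<Longrightarrow> m < n \<Longrightarrow> (f ^^ m) x \<notin> A"
  shows "return_time f A x = n"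
  unfolding return_time_def using assms by (intro Least_equality) (auto simp: not_less[symmetric])

lemma return_time_entry_time:
  assumes "(f ^^ n) (f x) \<in> A"
  shows "return_time f A x = Suc (entry_time f A (f x))"
proof (rule return_time_eqI)
  show "(f ^^ Suc (entry_time f A (f x))) x \<in> A"
    using entry_time_props(1)[of n f "f x", OF assms] by (simp add: funpow_swap1)
  fix m assume "1 \<le> m" "m < Suc (entry_time f A (f x))"
  then show "(f ^^ m) x \<notin> A"
    using entry_time_props(3)[of n f "f x" A "m - 1", OF assms]
    by (cases m) (auto simp: funpow_swap1)
qed simp

text \<open>Between consecutive points of the \<open>g\<close>-orbit, \<open>f\<close> stays outside
  \<open>A\<close> and hence outside \<open>B\<close>. So \<open>f\<close> enters \<open>B\<close>
  first at the \<open>r\<close>-th point of the \<open>g\<close>-orbit, and the sum splits into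
  blocks, one for each return to \<open>A\<close>.\<close>

lemma entry_time_first_return:
  fixes f :: "'a \<Rightarrow> 'a" and \<phi> :: "'a \<Rightarrow> int" and A :: "'a set"
  defines "g \<equiv> return_map f A"
  assumes ret: "\<And>x. x \<in> A \<Longrightarrow> \<exists>n\<ge>1. (f ^^ n) x \<in> A" and BA: "B \<subseteq> A" and x: "x \<in> A"
    and hit: "(g ^^ r) x \<in> B" and avoid: "\<And>j. j < r \<Longrightarrow> (g ^^ j) x \<notin> B"
  shows "(f ^^ entry_time f B x) x = (g ^^ r) x"
    and "birkhoff_sum f \<phi> (entry_time f B x) x =
      (\<Sum>j<r. birkhoff_sum f \<phi> (return_time f A ((g ^^ j) x)) ((g ^^ j) x))"
proof -
  have "(f ^^ entry_time f B x) x = (g ^^ r) x \<and> birkhoff_sum f \<phi> (entry_time f B x) x =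
      (\<Sum>j<r. birkhoff_sum f \<phi> (return_time f A ((g ^^ j) x)) ((g ^^ j) x))"
    using x hit avoid
  proof (induction r arbitrary: x)
    case 0
    then have "entry_time f B x = 0" by (intro entry_time_eqI) auto
    then show ?case by (simp add: birkhoff_sum_def)
  next
    case (Suc r)
    let ?t = "return_time f A x"
    obtain n where n: "1 \<le> n" "(f ^^ n) x \<in> A" using ret Suc.prems(1) by blast
    have gx: "g x = (f ^^ ?t) x" unfolding g_def return_map_def ..
    have gA: "g x \<in> A" unfolding gx using return_time_props(2)[of n f x, OF n] .
    have xB: "x \<notin> B" using Suc.prems(3)[of 0] by simp
    have av: "(f ^^ m) x \<notin> B" if "m < ?t" for m
      using return_time_props(4)[of n f x, OF n, of m] that xB BA by (cases m) auto
    have "(g ^^ r) (g x) \<in> B" using Suc.prems(2) by (simp add: funpow_swap1)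
    moreover have "(g ^^ j) (g x) \<notin> B" if "j < r" for j
      using Suc.prems(3)[of "Suc j"] that by (simp add: funpow_swap1)
    ultimately have IH: "(f ^^ entry_time f B (g x)) (g x) = (g ^^ r) (g x)"
      "birkhoff_sum f \<phi> (entry_time f B (g x)) (g x) =
        (\<Sum>j<r. birkhoff_sum f \<phi> (return_time f A ((g ^^ j) (g x))) ((g ^^ j) (g x)))"
      using Suc.IH[OF gA] by blast+
    have "(f ^^ entry_time f B (g x)) ((f ^^ ?t) x) \<in> B"
      using IH(1) Suc.prems(2) by (simp add: gx[symmetric] funpow_swap1)
    from entry_time_shift[OF av this]
    have e: "entry_time f B x = ?t + entry_time f B (g x)" by (simp add: gx)
    have "(f ^^ entry_time f B x) x = (f ^^ entry_time f B (g x)) (g x)"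
      unfolding e gx by (metis add.commute comp_apply funpow_add)
    then have "(f ^^ entry_time f B x) x = (g ^^ Suc r) x"
      using IH(1) by (simp add: funpow_swap1)
    moreover have "birkhoff_sum f \<phi> (entry_time f B x) x =
        birkhoff_sum f \<phi> ?t x + birkhoff_sum f \<phi> (entry_time f B (g x)) (g x)"
      unfolding e birkhoff_sum_add gx ..
    ultimately show ?case
      unfolding IH(2) by (simp add: sum.lessThan_Suc_shift funpow_swap1 del: sum.lessThan_Suc)
  qed
  then show "(f ^^ entry_time f B x) x = (g ^^ r) x"
    and "birkhoff_sum f \<phi> (entry_time f B x) x =
      (\<Sum>j<r. birkhoff_sum f \<phi> (return_time f A ((g ^^ j) x)) ((g ^^ j) x))"
    by auto
qed

text \<open>The first return to \<open>A\<close> uses up some of the \<open>n\<close> steps; cutting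
  it off leaves a shorter orbit segment that still ends in \<open>B\<close>.\<close>

lemma hit_first_return:
  assumes BA: "B \<subseteq> A" and x: "x \<in> A" and hit: "(f ^^ n) x \<in> B"
  shows "\<exists>r. (return_map f A ^^ r) x \<in> B"
  using x hit
proof (induction n arbitrary: x rule: less_induct)
  case (less n)
  show ?case
  proof (cases "x \<in> B")
    case True
    then have "(return_map f A ^^ 0) x \<in> B" by simp
    then show ?thesis by blast
  next
    case False
    let ?t = "return_time f A x"
    have n: "1 \<le> n" using False less.prems(2) by (cases n) auto
    have nA: "(f ^^ n) x \<in> A" using less.prems BA by blast
    note t = return_time_props[of n f x A, OF n nA]
    have "n = (n - ?t) + ?t" using t(3) by simp
    then have "(f ^^ n) x = (f ^^ (n - ?t)) (return_map f A x)"
      unfolding return_map_def by (metis comp_apply funpow_add)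
    moreover have "return_map f A x \<in> A" using t(2) by (simp add: return_map_def)
    moreover have "n - ?t < n" using t(1) n by simp
    ultimately have "\<exists>r. (return_map f A ^^ r) (return_map f A x) \<in> B"
      using less.IH[of "n - ?t" "return_map f A x"] less.prems(2) by simp
    then obtain r where "(return_map f A ^^ Suc r) x \<in> B" by (auto simp: funpow_swap1)
    then show ?thesis by blast
  qed
qed

text \<open>Inducing in two stages agrees with inducing at once. After one step of \<open>g\<close>
  the remaining return to \<open>B\<close> is a first entry from a point of \<open>A\<close>, to
  which \<open>entry_time_first_return\<close> applies.\<close>

lemma return_time_first_return:
  fixes f :: "'a \<Rightarrow> 'a" and \<phi> :: "'a \<Rightarrow> int" and A :: "'a set"
  defines "g \<equiv> return_map f A"
  assumes ret: "\<And>x. x \<in> A \<Longrightarrow> \<exists>n\<ge>1. (f ^^ n) x \<in> A" and BA: "B \<subseteq> A" and x: "x \<in> B"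
    and hit: "1 \<le> r" "(g ^^ r) x \<in> B"
  shows "\<exists>n\<ge>1. (f ^^ n) x \<in> B"
    and "return_map f B x = return_map g B x"
    and "birkhoff_sum f \<phi> (return_time f B x) x =
      (\<Sum>j<return_time g B x. birkhoff_sum f \<phi> (return_time f A ((g ^^ j) x)) ((g ^^ j) x))"
proof -
  let ?t = "return_time f A x"
  \<comment> \<open>The step from \<open>x\<close> to \<open>g x\<close> is split off because a
    return time starts at 1 and an entry time at 0.\<close>
  obtain r' where r': "return_time g B x = Suc r'"
    using return_time_props(1)[of r g x, OF hit] by (cases "return_time g B x") auto
  have xA: "x \<in> A" using x BA by blast
  obtain n where n: "1 \<le> n" "(f ^^ n) x \<in> A" using ret xA by blast
  note t = return_time_props[of n f x A, OF n]
  have gx: "g x = (f ^^ ?t) x" unfolding g_def return_map_def ..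
  have gA: "g x \<in> A" unfolding gx using t(2) .
  have ghit: "(g ^^ r') (g x) \<in> B"
    using return_time_props(2)[of r g x, OF hit] r' by (simp add: funpow_swap1)
  have gav: "(g ^^ j) (g x) \<notin> B" if "j < r'" for j
    using return_time_props(4)[of r g x, OF hit, of "Suc j"] r' that by (simp add: funpow_swap1)
  note E = entry_time_first_return[where f = f and A = A and B = B, folded g_def,
      OF ret BA gA ghit gav]
  let ?e = "entry_time f B (g x)"
  have app: "(f ^^ (?t + m)) x = (f ^^ m) (g x)" for m
    unfolding gx by (metis add.commute comp_apply funpow_add)
  have eB: "(f ^^ ?e) (g x) \<in> B" using E(1) ghit by simp
  have ret_eq: "return_time f B x = ?t + ?e"
  proof (rule return_time_eqI)
    show "1 \<le> ?t + ?e" using t(1) by simp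
    show "(f ^^ (?t + ?e)) x \<in> B" unfolding app by (rule eB)
    fix m assume m: "1 \<le> m" "m < ?t + ?e"
    show "(f ^^ m) x \<notin> B"
    proof (cases "m < ?t")
      case True
      then show ?thesis using t(4) m BA by blast
    next
      case False
      then have "m = ?t + (m - ?t)" by simp
      then show ?thesis
        using app[of "m - ?t"] entry_time_props(3)[of ?e f "g x" B "m - ?t", OF eB] m by auto
    qed
  qed
  show "\<exists>n\<ge>1. (f ^^ n) x \<in> B"
    using app[of ?e] eB t(1) by (intro exI[of _ "?t + ?e"]) auto
  show "return_map f B x = return_map g B x"
    using app[of ?e] E(1) by (simp add: return_map_def ret_eq r' funpow_swap1)
  show "birkhoff_sum f \<phi> (return_time f B x) x =
      (\<Sum>j<return_time g B x. birkhoff_sum f \<phi> (return_time f A ((g ^^ j) x)) ((g ^^ j) x))"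
    unfolding ret_eq birkhoff_sum_add gx[symmetric] r' sum.lessThan_Suc_shift
    by (simp add: E(2) funpow_swap1)
qed

section \<open>The odometer on cells\<close>

lemma two_div_power_le:
  assumes "m < n"
  shows "2 / 2 ^ n \<le> (1 :: real) / 2 ^ m"
proof -
  have "(2 :: real) ^ Suc m \<le> 2 ^ n" using assms by (intro power_increasing) auto
  then show ?thesis by (simp add: field_simps)
qed

lemma vn_kakutani_block_unique:
  fixes x :: real
  assumes "1 - 2 / 2 ^ n \<le> x" "x < 1 - 1 / 2 ^ n" "1 - 2 / 2 ^ m \<le> x" "x < 1 - 1 / 2 ^ m"
  shows "m = n"
proof (rule ccontr)
  assume "m \<noteq> n"
  then consider "m < n" | "n < m" by linarith
  then show False using two_div_power_le[of m n] two_div_power_le[of n m] assms by cases auto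
qed

lemma vn_kakutani_eq:
  assumes "1 \<le> n" "1 - 2 / 2 ^ n \<le> x" "x < 1 - 1 / 2 ^ n"
  shows "vn_kakutani x = x - (1 - 3 / 2 ^ n)"
proof -
  have "(THE n::nat. 1 \<le> n \<and> 1 - 2 / 2 ^ n \<le> x \<and> x < 1 - 1 / 2 ^ n) = n"
    using assms vn_kakutani_block_unique[of n x] by (intro the_equality) blast+
  then show ?thesis unfolding vn_kakutani_def by (simp add: Let_def)
qed

lemma vn_kakutani_block:
  fixes x :: real
  assumes "0 \<le> x" "x < 1"
  obtains n where "1 \<le> n" "1 - 2 / 2 ^ n \<le> x" "x < 1 - 1 / 2 ^ n"
proof -
  obtain m where "(1 / 2) ^ m < 1 - x"
    using real_arch_pow_inv[of "1 - x" "1 / 2"] assms by auto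
  then have ex: "x < 1 - 1 / 2 ^ m" by (simp add: power_one_over)
  define n where "n = (LEAST m. x < 1 - 1 / 2 ^ m)"
  have n: "x < 1 - 1 / 2 ^ n" unfolding n_def using ex by (rule LeastI)
  then obtain k where k: "n = Suc k" using assms by (cases n) auto
  have "\<not> x < 1 - 1 / 2 ^ k" using not_less_Least[of k "\<lambda>m. x < 1 - 1 / 2 ^ m"] k n_def by simp
  then show ?thesis using that[of n] n k by simp
qed

lemma vn_kakutani_image_block:
  assumes "1 \<le> n" "1 - 2 / 2 ^ n \<le> x" "x < 1 - 1 / 2 ^ n"
  shows "1 / 2 ^ n \<le> vn_kakutani x" "vn_kakutani x < 2 / 2 ^ n"
  using vn_kakutani_eq[OF assms] assms(2,3) by (simp_all add: field_simps)

lemma vn_kakutani_range: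
  assumes "0 \<le> x" "x < 1"
  shows "0 < vn_kakutani x" "vn_kakutani x < 1"
proof -
  obtain n where n: "1 \<le> n" "1 - 2 / 2 ^ n \<le> x" "x < 1 - 1 / 2 ^ n"
    using vn_kakutani_block assms by blast
  have "(0 :: real) < 1 / 2 ^ n" by simp
  then show "0 < vn_kakutani x" using vn_kakutani_image_block(1)[OF n] by linarith
  show "vn_kakutani x < 1"
  proof -
    have "2 / 2 ^ n \<le> (1 :: real)" using two_div_power_le[of 0 n] n(1) by simp
    then show ?thesis using vn_kakutani_image_block(2)[OF n] by linarith
  qed
qed

text \<open>The \<open>n\<close>-th block is translated into \<open>[1 / 2 ^ n, 2 / 2 ^ n)\<close>.
  These images are disjoint, so the value determines the block, and on a block the map is a
  translation.\<close>

lemma inj_on_vn_kakutani: "inj_on vn_kakutani {0..<1}"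
proof (rule inj_onI)
  fix x y :: real
  assume x: "x \<in> {0..<1}" and y: "y \<in> {0..<1}" and eq: "vn_kakutani x = vn_kakutani y"
  obtain n where n: "1 \<le> n" "1 - 2 / 2 ^ n \<le> x" "x < 1 - 1 / 2 ^ n"
    using vn_kakutani_block x by auto
  obtain m where m: "1 \<le> m" "1 - 2 / 2 ^ m \<le> y" "y < 1 - 1 / 2 ^ m"
    using vn_kakutani_block y by auto
  have "m = n"
    using vn_kakutani_image_block[OF n] vn_kakutani_image_block[OF m] eq
      two_div_power_le[of m n] two_div_power_le[of n m]
    by (cases m n rule: linorder_cases) auto
  then have "x - (1 - 3 / 2 ^ n) = y - (1 - 3 / 2 ^ n)"
    using vn_kakutani_eq[OF n] vn_kakutani_eq[OF m] eq by metis
  then show "x = y" by simp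
qed

text \<open>A point of the last dyadic interval carries into its remaining binary digits.\<close>

lemma vn_kakutani_scale:
  assumes "0 \<le> y" "y < 1"
  shows "vn_kakutani (1 - 1 / 2 ^ N + y / 2 ^ N) = vn_kakutani y / 2 ^ N"
proof -
  obtain n where n: "1 \<le> n" "1 - 2 / 2 ^ n \<le> y" "y < 1 - 1 / 2 ^ n"
    using vn_kakutani_block assms by blast
  have "(1 - 2 / 2 ^ n) / 2 ^ N \<le> y / 2 ^ N" "y / 2 ^ N < (1 - 1 / 2 ^ n) / 2 ^ N"
    using n by (auto intro: divide_right_mono divide_strict_right_mono)
  then have "1 - 2 / 2 ^ (N + n) \<le> 1 - 1 / 2 ^ N + y / 2 ^ N"
    "1 - 1 / 2 ^ N + y / 2 ^ N < 1 - 1 / 2 ^ (N + n)"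
    unfolding power_add diff_divide_distrib by (simp_all add: mult.commute)
  then have "vn_kakutani (1 - 1 / 2 ^ N + y / 2 ^ N)
      = (1 - 1 / 2 ^ N + y / 2 ^ N) - (1 - 3 / 2 ^ (N + n))"
    using n(1) by (intro vn_kakutani_eq) auto
  also have "\<dots> = (y - (1 - 3 / 2 ^ n)) / 2 ^ N" by (simp add: power_add field_simps)
  finally show ?thesis unfolding vn_kakutani_eq[OF n] .
qed

text \<open>On the last dyadic interval \<open>[1 - 1 / 2\<^sup>N, 1)\<close>, where \<open>vn_kakutani\<close> is not a translation, the
  index is chosen to be that of the interval containing the image.\<close>

definition odometer_index :: "nat \<Rightarrow> nat \<Rightarrow> nat" where
  "odometer_index N d =
    (if Suc d < 2 ^ N then nat \<lfloor>2 ^ N * vn_kakutani (real d / 2 ^ N)\<rfloor> else 0)"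

text \<open>Every dyadic interval of level \<open>N\<close> except the last lies in a single block
  with \<open>n \<le> N\<close>, and the translation on that block is by a multiple of
  \<open>1 / 2 ^ N\<close>.\<close>

lemma vn_kakutani_dyadic:
  assumes d: "Suc d < 2 ^ N"
  shows "1 \<le> odometer_index N d" "odometer_index N d < 2 ^ N"
    "real d / 2 ^ N \<le> x \<Longrightarrow> x < (real d + 1) / 2 ^ N \<Longrightarrow>
      vn_kakutani x = x + (real (odometer_index N d) - real d) / 2 ^ N"
proof -
  have d': "real d + 1 < 2 ^ N" using of_nat_less_iff[of "Suc d" "2 ^ N", where 'a = real] d by simp
  then have "0 \<le> real d / 2 ^ N" "real d / 2 ^ N < 1" using d by auto
  then obtain n where n: "1 \<le> n" "1 - 2 / 2 ^ n \<le> real d / 2 ^ N" "real d / 2 ^ N < 1 - 1 / 2 ^ n"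
    using vn_kakutani_block by blast
  have "n \<le> N"
  proof (rule ccontr)
    assume "\<not> n \<le> N"
    then have "1 - 1 / 2 ^ N \<le> real d / 2 ^ N" using two_div_power_le[of N n] n(2) by simp
    moreover have "(real d + 1) / 2 ^ N < 1" using d' by simp
    ultimately show False by (simp add: add_divide_distrib)
  qed
  \<comment> \<open>The number of dyadic intervals of level \<open>N\<close> in an interval of
    length \<open>1 / 2 ^ n\<close>.\<close>
  define s :: nat where "s = 2 ^ (N - n)"
  have s: "(2 :: real) ^ N = real s * 2 ^ n"
    using \<open>n \<le> N\<close> by (simp add: s_def flip: power_add)
  have s1: "s \<ge> 1" unfolding s_def by simp
  have sn: "2 ^ N = s * 2 ^ n"
    using \<open>n \<le> N\<close> by (simp add: s_def flip: power_add)
  have lo: "2 ^ N \<le> d + 2 * s"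
  proof -
    have "2 ^ N * (1 - 2 / 2 ^ n) \<le> 2 ^ N * (real d / 2 ^ N)"
      using n(2) by (intro mult_left_mono) auto
    moreover have "2 ^ N * (2 / 2 ^ n) = 2 * real s" unfolding s by simp
    ultimately have "2 ^ N - 2 * real s \<le> real d" by (simp add: right_diff_distrib)
    then have "real (2 ^ N) \<le> real (d + 2 * s)" by simp
    then show ?thesis unfolding of_nat_le_iff .
  qed
  have hi: "d + s < 2 ^ N"
  proof -
    have "2 ^ N * (real d / 2 ^ N) < 2 ^ N * (1 - 1 / 2 ^ n)"
      using n(3) by (intro mult_strict_left_mono) auto
    moreover have "2 ^ N * (1 / 2 ^ n) = real s" unfolding s by simp
    ultimately have "real d < 2 ^ N - real s" by (simp add: right_diff_distrib)
    then have "real (d + s) < real (2 ^ N)" by simp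
    then show ?thesis unfolding of_nat_less_iff .
  qed
  \<comment> \<open>The translation by \<open>- (1 - 3 / 2 ^ n)\<close> in units of
    \<open>1 / 2 ^ N\<close>. The bound \<open>lo\<close> keeps the subtraction of naturals
    exact.\<close>
  define e where "e = d + 3 * s - 2 ^ N"
  have e: "real e = real d + 3 * real s - 2 ^ N" unfolding e_def using lo by (simp add: of_nat_diff)
  have trans: "vn_kakutani x = x + (real e - real d) / 2 ^ N"
    if x: "real d / 2 ^ N \<le> x" "x < (real d + 1) / 2 ^ N" for x
  proof -
    have "d + 1 + s \<le> 2 ^ N" using hi by simp
    then have "real (d + 1 + s) \<le> real (2 ^ N)" unfolding of_nat_le_iff .
    then have "(real d + 1 + real s) / 2 ^ N \<le> 1" by simp
    then have "(real d + 1) / 2 ^ N \<le> 1 - real s / 2 ^ N" by (simp add: add_divide_distrib)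
    also have "real s / 2 ^ N = 1 / 2 ^ n" unfolding s using s1 by simp
    finally have "vn_kakutani x = x - (1 - 3 / 2 ^ n)"
      using n x by (intro vn_kakutani_eq) auto
    also have "3 / 2 ^ n = 3 * real s / 2 ^ N" unfolding s using s1 by simp
    finally show ?thesis unfolding e by (simp add: field_simps)
  qed
  have "2 ^ N * vn_kakutani (real d / 2 ^ N) = real e"
    using trans[of "real d / 2 ^ N"] by (simp add: field_simps)
  then have eq: "odometer_index N d = e" unfolding odometer_index_def using d by simp
  have "2 * s \<le> 2 ^ N" using sn n(1) by (cases n) auto
  then show "1 \<le> odometer_index N d" "odometer_index N d < 2 ^ N"
    unfolding eq e_def using lo hi s1 by linarith+
  show "real d / 2 ^ N \<le> x \<Longrightarrow> x < (real d + 1) / 2 ^ N \<Longrightarrow>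
      vn_kakutani x = x + (real (odometer_index N d) - real d) / 2 ^ N"
    unfolding eq by (rule trans)
qed

lemma odometer_index_less: "odometer_index N d < 2 ^ N"
  using vn_kakutani_dyadic(2)[of d N] by (cases "Suc d < 2 ^ N") (auto simp: odometer_index_def)

text \<open>Only the last index is sent to 0. The other indices are told apart by the injectivity of
  \<open>vn_kakutani\<close> at the left endpoints.\<close>

lemma inj_on_odometer_index: "inj_on (odometer_index N) {..<2 ^ N}"
proof (rule inj_onI)
  fix a b assume a: "a \<in> {..<2 ^ N}" and b: "b \<in> {..<2 ^ N}"
    and eq: "odometer_index N a = odometer_index N b"
  have zero: "odometer_index N d = 0 \<longleftrightarrow> \<not> Suc d < 2 ^ N" for d
    using vn_kakutani_dyadic(1)[of d N] by (auto simp: odometer_index_def)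
  show "a = b"
  proof (cases "Suc a < 2 ^ N")
    case True
    then have b': "Suc b < 2 ^ N" using zero eq by metis
    have v: "vn_kakutani (real d / 2 ^ N) = real (odometer_index N d) / 2 ^ N" if "Suc d < 2 ^ N" for d
      using vn_kakutani_dyadic(3)[OF that, of "real d / 2 ^ N"] by (simp add: field_simps)
    have I: "real d / 2 ^ N \<in> {0..<1}" if "Suc d < 2 ^ N" for d
      using of_nat_less_iff[of "Suc d" "2 ^ N", where 'a = real] that by simp
    have "real a / 2 ^ N = real b / 2 ^ N"
      using inj_onD[OF inj_on_vn_kakutani _ I[OF True] I[OF b']] v[OF True] v[OF b'] eq by simp
    then show ?thesis by simp
  next
    case False
    then have "\<not> Suc b < 2 ^ N" using zero eq by metis
    then show ?thesis using False a b by simp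
  qed
qed

section \<open>The permutation of the cells\<close>

text \<open>The cells are the \<open>q * D\<close> intervals of length \<open>1 / (q * D)\<close>.
  They refine both partitions: \<open>c div D\<close> is the interval of length \<open>1 / q\<close>
  moved by the rotation, and \<open>c' div q\<close> is the dyadic interval of length
  \<open>1 / D\<close> moved by the odometer. The last dyadic interval goes in order to the
  \<open>q\<close> cells of \<open>L\<^sub>1\<close>; the true map also ends in
  \<open>L\<^sub>1\<close>, but not as a translation.\<close>

definition cell_perm :: "nat \<Rightarrow> (nat \<Rightarrow> nat) \<Rightarrow> nat \<Rightarrow> nat" where
  "cell_perm q \<sigma> c =
    (let D = 2 ^ expo q; c' = \<sigma> (c div D) * D + c mod D
     in if c < q * D then odometer_index (expo q) (c' div q) * q + c' mod q else c)"

lemma div_less_mult: "c < q * D \<Longrightarrow> c div D < (q :: nat)"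
  by (metis less_mult_imp_div_less)

lemma mult_add_less: "a < q \<Longrightarrow> b < D \<Longrightarrow> a * D + b < q * (D :: nat)"
proof -
  assume "a < q" "b < D"
  then have "a * D + b < Suc a * D" by simp
  also have "\<dots> \<le> q * D" using \<open>a < q\<close> by (intro mult_right_mono) auto
  finally show ?thesis .
qed

lemma cell_perm_permutes:
  assumes \<sigma>: "\<sigma> permutes {..<q}"
  shows "cell_perm q \<sigma> permutes {..<q * 2 ^ expo q}"
proof -
  define D :: nat where "D = 2 ^ expo q"
  have D: "D > 0" unfolding D_def by simp
  define \<rho> where "\<rho> c = \<sigma> (c div D) * D + c mod D" for c
  have cp: "cell_perm q \<sigma> c = odometer_index (expo q) (\<rho> c div q) * q + \<rho> c mod q" if "c < q * D" for c
    using that unfolding cell_perm_def \<rho>_def D_def by (simp add: Let_def)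
  have \<sigma>q: "\<sigma> a < q" if "a < q" for a using permutes_in_image[OF \<sigma>, of a] that by simp
  have \<rho>q: "\<rho> c < q * D" if "c < q * D" for c
    unfolding \<rho>_def using that D by (intro mult_add_less \<sigma>q div_less_mult) auto
  have q: "q > 0" if "c < q * D" for c using that by (cases q) auto
  have "inj_on (cell_perm q \<sigma>) {..<q * D}"
  proof (rule inj_onI)
    fix a b assume "a \<in> {..<q * D}" "b \<in> {..<q * D}" and eq: "cell_perm q \<sigma> a = cell_perm q \<sigma> b"
    then have a: "a < q * D" and b: "b < q * D" by auto
    have "\<rho> a mod q = \<rho> b mod q"
      using arg_cong[OF eq, of "\<lambda>x. x mod q"] unfolding cp[OF a] cp[OF b] by simp
    moreover have "odometer_index (expo q) (\<rho> a div q) = odometer_index (expo q) (\<rho> b div q)"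
      using arg_cong[OF eq, of "\<lambda>x. x div q"] q[OF a] unfolding cp[OF a] cp[OF b] by simp
    then have "\<rho> a div q = \<rho> b div q"
      using inj_onD[OF inj_on_odometer_index, of "expo q" "\<rho> a div q" "\<rho> b div q"]
        div_less_mult[of "\<rho> a" D q] div_less_mult[of "\<rho> b" D q] \<rho>q[OF a] \<rho>q[OF b]
      by (simp add: D_def mult.commute)
    ultimately have "\<rho> a = \<rho> b" by (metis div_mult_mod_eq)
    then have "\<rho> a mod D = \<rho> b mod D" "\<rho> a div D = \<rho> b div D" by auto
    then have "a mod D = b mod D" "\<sigma> (a div D) = \<sigma> (b div D)"
      using D unfolding \<rho>_def by auto
    then have "a mod D = b mod D" "a div D = b div D"
      using permutes_inj[OF \<sigma>] by (auto dest: injD)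
    then show "a = b" by (metis div_mult_mod_eq)
  qed
  moreover have "cell_perm q \<sigma> ` {..<q * D} \<subseteq> {..<q * D}"
  proof safe
    fix c assume "c < q * D"
    then show "cell_perm q \<sigma> c < q * D"
      using mult_add_less[OF odometer_index_less[of "expo q"], of "\<rho> c mod q" q] q cp
      by (simp add: D_def mult.commute)
  qed
  ultimately have "bij_betw (cell_perm q \<sigma>) {..<q * D} {..<q * D}"
    by (simp add: inj_on_imp_bij_betw endo_inj_surj bij_betw_def)
  moreover have "cell_perm q \<sigma> c = c" if "c \<notin> {..<q * D}" for c
    using that unfolding cell_perm_def D_def by (simp add: Let_def)
  ultimately show ?thesis unfolding D_def by (intro bij_imp_permutes) auto
qed

lemma sub_interval_iff:
  "x \<in> sub_interval q k i \<longleftrightarrow>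
    real i / (real q * 2 ^ (k * expo q)) \<le> x \<and> x < (real i + 1) / (real q * 2 ^ (k * expo q))"
  unfolding sub_interval_def by (auto simp: add.commute)

lemma sub_interval_mult_iff:
  assumes "q > 0"
  shows "x \<in> sub_interval q k i \<longleftrightarrow>
    real i \<le> real q * 2 ^ (k * expo q) * x \<and> real q * 2 ^ (k * expo q) * x < real i + 1"
proof -
  define m where "m = real q * 2 ^ (k * expo q)"
  have "m > 0" unfolding m_def using assms by simp
  then show ?thesis
    unfolding sub_interval_iff m_def[symmetric]
    by (simp add: pos_divide_le_eq pos_less_divide_eq mult.commute)
qed

text \<open>\<open>y\<close> is where the translation prescribed by \<open>cell_perm\<close> takes
  \<open>x\<close>. The odometer follows this translation unless the rotation leads into the last
  dyadic interval; there \<open>vn_kakutani_scale\<close> turns it into the translation to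
  \<open>L\<^sub>1\<close> followed by a copy of \<open>vn_kakutani\<close> scaled to
  \<open>L\<^sub>1\<close>.\<close>

lemma rot_odometer_cell:
  assumes \<sigma>: "\<sigma> permutes {..<q}" and c: "c < q * 2 ^ expo q" and x: "x \<in> sub_interval q 1 c"
  defines "y \<equiv> x + (real (cell_perm q \<sigma> c) - real c) / (real q * 2 ^ expo q)"
  shows "q \<le> cell_perm q \<sigma> c \<Longrightarrow> rot_odometer q \<sigma> x = y"
    and "cell_perm q \<sigma> c < q \<Longrightarrow> rot_odometer q \<sigma> x = vn_kakutani (2 ^ expo q * y) / 2 ^ expo q"
    and "y \<in> sub_interval q 1 (cell_perm q \<sigma> c)"
proof -
  define N where "N = expo q"
  define D :: nat where "D = 2 ^ N"
  have D: "D > 0" and rD: "real D = 2 ^ N" unfolding D_def by simp_all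
  have cD: "c < q * D" using c by (simp add: D_def N_def)
  then have q: "q > 0" by (cases q) auto
  \<comment> \<open>\<open>c'\<close> is the cell after the rotation, \<open>d\<close> its dyadic
    interval and \<open>s\<close> its position therein.\<close>
  define c' where "c' = \<sigma> (c div D) * D + c mod D"
  define d where "d = c' div q"
  define s where "s = c' mod q"
  have sq: "s < q" unfolding s_def using q by simp
  have c'ds: "real c' = real d * real q + real s"
    unfolding d_def s_def by (metis div_mult_mod_eq of_nat_add of_nat_mult)
  have "\<sigma> (c div D) < q" using permutes_in_image[OF \<sigma>, of "c div D"] div_less_mult[OF cD] by simp
  then have "c' < q * D" unfolding c'_def using D by (intro mult_add_less) auto
  then have dD: "d < D" unfolding d_def by (metis div_less_mult mult.commute)
  have cp: "cell_perm q \<sigma> c = odometer_index N d * q + s"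
    using c unfolding cell_perm_def c'_def d_def s_def D_def N_def by (simp add: Let_def)
  have xi: "real c \<le> real q * real D * x" "real q * real D * x < real c + 1"
    using x unfolding sub_interval_mult_iff[OF q] by (simp_all add: N_def rD)
  have "real D * (real (c div D)) \<le> real c" "real c + 1 \<le> real D * (real (c div D) + 1)"
  proof -
    have "D * (c div D) \<le> c" "c + 1 \<le> D * (c div D + 1)"
      using D dividend_less_times_div[of D c] by (auto simp: algebra_simps)
    then have "real (D * (c div D)) \<le> real c" "real (c + 1) \<le> real (D * (c div D + 1))"
      unfolding of_nat_le_iff by auto
    then show "real D * (real (c div D)) \<le> real c" "real c + 1 \<le> real D * (real (c div D) + 1)"
      by (simp_all add: algebra_simps)
  qed
  moreover have "real D * (real q * x) = real q * real D * x" by simp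
  ultimately have "real D * real (c div D) \<le> real D * (real q * x)"
    "real D * (real q * x) < real D * (real (c div D) + 1)"
    using xi by linarith+
  then have "real (c div D) \<le> real q * x" "real q * x < real (c div D) + 1"
    using D by (simp_all only: mult_le_cancel_left_pos mult_less_cancel_left_pos of_nat_0_less_iff)
  then have "\<lfloor>real q * x\<rfloor> = int (c div D)"
    by (intro floor_unique) simp_all
  then have "rotation q \<sigma> x = x + (real (\<sigma> (c div D)) - real (c div D)) / real q"
    unfolding rotation_def by (simp add: Let_def)
  also have "\<dots> = x + (real c' - real c) / (real q * real D)"
  proof -
    have "real c = real (c div D) * real D + real (c mod D)"
      by (metis div_mult_mod_eq of_nat_add of_nat_mult)
    then have "real c' - real c = (real (\<sigma> (c div D)) - real (c div D)) * real D"
      unfolding c'_def by (simp add: algebra_simps)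
    then show ?thesis using D q by simp
  qed
  finally have R: "rotation q \<sigma> x = x + (real c' - real c) / (real q * real D)" .
  have F: "rot_odometer q \<sigma> x = vn_kakutani (rotation q \<sigma> x)" unfolding rot_odometer_def by simp
  define r where "r = rotation q \<sigma> x"
  have r: "real q * real D * r = real q * real D * x + real c' - real c"
    unfolding r_def R using q D by (simp add: field_simps)
  have rq: "real d * real q + real s \<le> real q * real D * r"
    "real q * real D * r < real d * real q + real s + 1"
    using xi unfolding r c'ds by linarith+
  have sq': "real s + 1 \<le> real q" using sq by linarith
  have "real q * (real D * r) = real q * real D * r"
    "real q * (real d + 1) = real d * real q + real q" "real q * real d = real d * real q"
    by (simp_all add: algebra_simps)
  then have "real q * real d \<le> real q * (real D * r)" "real q * (real D * r) < real q * (real d + 1)"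
    using rq sq' by linarith+
  then have rd: "real d \<le> real D * r" "real D * r < real d + 1"
    using q by (simp_all only: mult_le_cancel_left_pos mult_less_cancel_left_pos of_nat_0_less_iff)
  have y: "y = r + (real (cell_perm q \<sigma> c) - real c') / (real q * real D)"
    unfolding y_def r_def R rD N_def by (simp add: diff_divide_distrib)
  \<comment> \<open>A cell is sent outside \<open>L\<^sub>1\<close> exactly when the rotation leaves
    it off the last dyadic interval.\<close>
  have idx: "q \<le> cell_perm q \<sigma> c \<longleftrightarrow> Suc d < D"
  proof
    assume "Suc d < D"
    then have "1 \<le> odometer_index N d" using vn_kakutani_dyadic(1) unfolding D_def by blast
    then have "1 * q \<le> odometer_index N d * q" by (rule mult_right_mono) simp
    then show "q \<le> cell_perm q \<sigma> c" unfolding cp by (simp only: mult_1 trans_le_add1)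
  next
    assume "q \<le> cell_perm q \<sigma> c"
    then have "odometer_index N d \<noteq> 0" unfolding cp using sq by (cases "odometer_index N d = 0") auto
    then show "Suc d < D" unfolding odometer_index_def D_def by (auto split: if_splits)
  qed
  show "y \<in> sub_interval q 1 (cell_perm q \<sigma> c)"
  proof -
    have "real q * real D * y = real q * real D * x + (real (cell_perm q \<sigma> c) - real c)"
      unfolding y_def using q by (simp add: rD N_def distrib_left)
    then show ?thesis using xi unfolding sub_interval_mult_iff[OF q] by (simp add: rD N_def)
  qed
  show "rot_odometer q \<sigma> x = y" if "q \<le> cell_perm q \<sigma> c"
  proof -
    have d: "Suc d < 2 ^ N" using idx that unfolding D_def by blast
    have "vn_kakutani r = r + (real (odometer_index N d) - real d) / 2 ^ N"
      using rd by (intro vn_kakutani_dyadic(3)[OF d])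
        (simp_all add: rD pos_divide_le_eq pos_less_divide_eq mult.commute)
    moreover have "(real (cell_perm q \<sigma> c) - real c') / (real q * real D)
        = (real (odometer_index N d) - real d) / 2 ^ N"
      unfolding cp c'ds rD using q by (simp add: field_simps)
    ultimately show ?thesis unfolding F y by (simp add: r_def)
  qed
  show "rot_odometer q \<sigma> x = vn_kakutani (2 ^ expo q * y) / 2 ^ expo q" if "cell_perm q \<sigma> c < q"
  proof -
    have d: "Suc d = D" using idx that dD by linarith
    then have o: "odometer_index N d = 0" unfolding odometer_index_def D_def by simp
    have rd1: "real d = real D - 1" unfolding d[symmetric] by simp
    have "real (cell_perm q \<sigma> c) = real s" unfolding cp o by simp
    then have "real (cell_perm q \<sigma> c) - real c' = - ((real D - 1) * real q)"
      unfolding c'ds rd1 by linarith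
    then have "y = r - ((real D - 1) * real q) / (real q * real D)"
      by (simp only: y minus_divide_left[symmetric] diff_conv_add_uminus)
    also have "\<dots> = r - (real D - 1) / real D" using q by simp
    also have "\<dots> = r - (1 - 1 / real D)" using D by (simp add: diff_divide_distrib)
    finally have yr: "y = r - (1 - 1 / 2 ^ N)" by (simp add: rD)
    then have "2 ^ N * y = real D * r - real d"
      unfolding rd1 rD by (simp add: right_diff_distrib)
    then have "0 \<le> 2 ^ N * y" "2 ^ N * y < 1" using rd by auto
    from vn_kakutani_scale[OF this, of N] show ?thesis
      unfolding F r_def[symmetric] N_def[symmetric] using yr by simp
  qed
qed

lemma permutes_funpow_lessThan:
  assumes "p permutes {..<n :: nat}" "i < n"
  shows "(p ^^ j) i < n"
  by (induction j) (use assms permutes_in_image[OF assms(1)] in auto)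

lemma permutes_returns:
  assumes "p permutes {..<n :: nat}"
  shows "\<exists>j\<ge>1. (p ^^ j) i = i"
proof -
  have "permutation p" using assms by (auto simp: permutation_permutes)
  then obtain m where "p ^^ m = id" "m > 0" by (rule permutation_is_nilpotent)
  then show ?thesis by (intro exI[of _ m]) auto
qed

section \<open>The intervals of the partitions\<close>

lemma sub_interval_ex:
  assumes "q > 0" "0 \<le> x"
  shows "x \<in> sub_interval q k (nat \<lfloor>real q * 2 ^ (k * expo q) * x\<rfloor>)"
proof -
  have "0 \<le> real q * 2 ^ (k * expo q) * x" using assms by simp
  then show ?thesis unfolding sub_interval_mult_iff[OF assms(1)] by (simp add: of_nat_nat)
qed

lemma sub_interval_unique:
  assumes "x \<in> sub_interval q k i" "x \<in> sub_interval q k j" "q > 0"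
  shows "i = j"
  using assms(1,2) unfolding sub_interval_mult_iff[OF assms(3)] by linarith

lemma base_interval_iff: "x \<in> base_interval q k \<longleftrightarrow> 0 \<le> x \<and> 2 ^ (k * expo q) * x < 1"
  unfolding base_interval_def by (auto simp: pos_less_divide_eq mult.commute)

lemma base_interval_sub_interval:
  assumes "x \<in> sub_interval q k i" "q > 0"
  shows "x \<in> base_interval q k \<longleftrightarrow> i < q"
proof -
  let ?s = "2 ^ (k * expo q) :: real"
  have x: "real i \<le> real q * (?s * x)" "real q * (?s * x) < real i + 1"
    using assms(1) unfolding sub_interval_mult_iff[OF assms(2)] by (simp_all add: mult.assoc)
  have x0: "0 \<le> x" using assms unfolding sub_interval_iff
    by (meson divide_nonneg_nonneg mult_nonneg_nonneg of_nat_0_le_iff order_trans zero_le_power zero_le_numeral)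
  have "i < q" if "?s * x < 1"
  proof -
    have "real q * (?s * x) < real q * 1"
      using assms(2) that by (intro mult_strict_left_mono) auto
    then show ?thesis using x by simp
  qed
  moreover have "?s * x < 1" if "i < q"
  proof -
    have "real i + 1 \<le> real q" using that by simp
    then have "real q * (?s * x) < real q * 1" using x by linarith
    then show ?thesis using assms(2) by (simp only: mult_less_cancel_left_pos of_nat_0_less_iff)
  qed
  ultimately show ?thesis unfolding base_interval_iff using x0 by blast
qed

lemma base_interval_eq_Union:
  assumes "q > 0"
  shows "x \<in> base_interval q k \<longleftrightarrow> (\<exists>i<q. x \<in> sub_interval q k i)"
  using sub_interval_ex[OF assms, of x k] base_interval_sub_interval[OF _ assms] base_interval_iff
  by metis

lemma unit_interval_cells:
  assumes "q > 0" "x \<in> {0..<1}"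
  shows "\<exists>c<q * 2 ^ expo q. x \<in> sub_interval q 1 c"
proof -
  obtain c where c: "x \<in> sub_interval q 1 c" using sub_interval_ex[of q x 1] assms by auto
  then have "real c \<le> real q * 2 ^ expo q * x" using assms by (simp add: sub_interval_mult_iff)
  also have "\<dots> < real q * 2 ^ expo q * 1"
    using assms by (intro mult_strict_left_mono) auto
  finally have "real c < real (q * 2 ^ expo q)" by simp
  then show ?thesis using c unfolding of_nat_less_iff by blast
qed

section \<open>Orbits of cells up to the first return\<close>

text \<open>As long as the cell orbit stays outside \<open>L\<^sub>1\<close>, every step is a
  translation, and the displacements telescope.\<close>

lemma cell_orbit:
  assumes \<sigma>: "\<sigma> permutes {..<q}" and c: "c < q * 2 ^ expo q" and x: "x \<in> sub_interval q 1 c"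
    and out: "\<And>m. 1 \<le> m \<Longrightarrow> m \<le> n \<Longrightarrow> q \<le> (cell_perm q \<sigma> ^^ m) c"
  shows "(rot_odometer q \<sigma> ^^ n) x
      = x + (real ((cell_perm q \<sigma> ^^ n) c) - real c) / (real q * 2 ^ expo q)"
    and "(rot_odometer q \<sigma> ^^ n) x \<in> sub_interval q 1 ((cell_perm q \<sigma> ^^ n) c)"
proof -
  have "(rot_odometer q \<sigma> ^^ n) x
      = x + (real ((cell_perm q \<sigma> ^^ n) c) - real c) / (real q * 2 ^ expo q) \<and>
    (rot_odometer q \<sigma> ^^ n) x \<in> sub_interval q 1 ((cell_perm q \<sigma> ^^ n) c)"
    using out
  proof (induction n)
    case 0
    then show ?case using x by simp
  next
    case (Suc n)
    then have IH: "(rot_odometer q \<sigma> ^^ n) x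
        = x + (real ((cell_perm q \<sigma> ^^ n) c) - real c) / (real q * 2 ^ expo q)"
      "(rot_odometer q \<sigma> ^^ n) x \<in> sub_interval q 1 ((cell_perm q \<sigma> ^^ n) c)"
      by auto
    let ?c = "(cell_perm q \<sigma> ^^ n) c"
    have lt: "?c < q * 2 ^ expo q"
      using permutes_funpow_lessThan[OF cell_perm_permutes[OF \<sigma>] c] .
    have "q \<le> cell_perm q \<sigma> ?c" using Suc.prems[of "Suc n"] by simp
    then show ?case
      using rot_odometer_cell(1)[OF \<sigma> lt IH(2)] rot_odometer_cell(3)[OF \<sigma> lt IH(2)] IH(1)
      by (simp add: diff_divide_distrib)
  qed
  then show "(rot_odometer q \<sigma> ^^ n) x
      = x + (real ((cell_perm q \<sigma> ^^ n) c) - real c) / (real q * 2 ^ expo q)"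
    and "(rot_odometer q \<sigma> ^^ n) x \<in> sub_interval q 1 ((cell_perm q \<sigma> ^^ n) c)"
    by auto
qed

text \<open>Only the last step deviates from a translation. \<open>y\<close> is the point that
  translations alone would reach, and the scaled \<open>vn_kakutani\<close> acts on it once; this is
  why the return map has again the form of an odometer after a rotation.\<close>

lemma cell_orbit_hit:
  assumes \<sigma>: "\<sigma> permutes {..<q}" and c: "c < q * 2 ^ expo q" and x: "x \<in> sub_interval q 1 c"
    and out: "\<And>m. 1 \<le> m \<Longrightarrow> m < n \<Longrightarrow> q \<le> (cell_perm q \<sigma> ^^ m) c"
    and n: "1 \<le> n" and hit: "(cell_perm q \<sigma> ^^ n) c < q"
  defines "y \<equiv> x + (real ((cell_perm q \<sigma> ^^ n) c) - real c) / (real q * 2 ^ expo q)"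
  shows "(rot_odometer q \<sigma> ^^ n) x = vn_kakutani (2 ^ expo q * y) / 2 ^ expo q"
    and "y \<in> sub_interval q 1 ((cell_perm q \<sigma> ^^ n) c)"
    and "(rot_odometer q \<sigma> ^^ n) x \<in> base_interval q 1"
proof -
  obtain m where m: "n = Suc m" using n by (cases n) auto
  have out': "q \<le> (cell_perm q \<sigma> ^^ j) c" if "1 \<le> j" "j \<le> m" for j using out[of j] that m by simp
  have lt: "(cell_perm q \<sigma> ^^ m) c < q * 2 ^ expo q"
    using permutes_funpow_lessThan[OF cell_perm_permutes[OF \<sigma>] c] .
  note orb = cell_orbit[OF \<sigma> c x out']
  have y: "y = (rot_odometer q \<sigma> ^^ m) x +
      (real (cell_perm q \<sigma> ((cell_perm q \<sigma> ^^ m) c)) - real ((cell_perm q \<sigma> ^^ m) c)) / (real q * 2 ^ expo q)"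
    using orb(1) by (simp add: y_def m diff_divide_distrib)
  show F: "(rot_odometer q \<sigma> ^^ n) x = vn_kakutani (2 ^ expo q * y) / 2 ^ expo q"
    using rot_odometer_cell(2)[OF \<sigma> lt orb(2)] hit unfolding y m by simp
  show ys: "y \<in> sub_interval q 1 ((cell_perm q \<sigma> ^^ n) c)"
    using rot_odometer_cell(3)[OF \<sigma> lt orb(2)] unfolding y m by simp
  have "q > 0" using hit by simp
  then have "y \<in> base_interval q 1" using base_interval_sub_interval[OF ys] hit by simp
  then have "0 \<le> 2 ^ expo q * y" "2 ^ expo q * y < 1" unfolding base_interval_iff by auto
  then show "(rot_odometer q \<sigma> ^^ n) x \<in> base_interval q 1"
    unfolding F base_interval_iff using vn_kakutani_range[of "2 ^ expo q * y"] by simp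
qed

lemma rot_odometer_unit:
  assumes \<sigma>: "\<sigma> permutes {..<q}" and q: "q > 0" and x: "x \<in> {0..<1}"
  shows "rot_odometer q \<sigma> x \<in> {0..<1}"
proof -
  obtain c where c: "c < q * 2 ^ expo q" "x \<in> sub_interval q 1 c"
    using unit_interval_cells[OF q x] by blast
  let ?c = "cell_perm q \<sigma> c"
  have lt: "?c < q * 2 ^ expo q"
    using permutes_in_image[OF cell_perm_permutes[OF \<sigma>], of c] c(1) by simp
  show ?thesis
  proof (cases "?c < q")
    case True
    have "rot_odometer q \<sigma> x \<in> base_interval q 1"
      using cell_orbit_hit(3)[OF \<sigma> c, of 1] True by simp
    then have "0 \<le> rot_odometer q \<sigma> x" "2 ^ expo q * rot_odometer q \<sigma> x < 1"
      unfolding base_interval_iff by auto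
    moreover have "1 * rot_odometer q \<sigma> x \<le> 2 ^ expo q * rot_odometer q \<sigma> x"
      using calculation(1) by (intro mult_right_mono) auto
    ultimately show ?thesis by simp
  next
    case False
    then have "rot_odometer q \<sigma> x \<in> sub_interval q 1 ?c"
      using cell_orbit(2)[OF \<sigma> c, of 1] by (simp add: le_Suc_eq)
    then have *: "real ?c \<le> real q * 2 ^ expo q * rot_odometer q \<sigma> x"
      "real q * 2 ^ expo q * rot_odometer q \<sigma> x < real ?c + 1"
      unfolding sub_interval_mult_iff[OF q] by simp_all
    have "real (?c + 1) \<le> real (q * 2 ^ expo q)" using lt unfolding of_nat_le_iff by simp
    then have "real q * 2 ^ expo q * rot_odometer q \<sigma> x < real q * 2 ^ expo q * 1"
      using *(2) by simp
    then have "rot_odometer q \<sigma> x < 1" using q by simp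
    have "0 \<le> real q * 2 ^ expo q * rot_odometer q \<sigma> x"
      using *(1) by (rule order_trans[rotated]) simp
    moreover have "0 < real q * 2 ^ expo q" using q by simp
    ultimately have "0 \<le> rot_odometer q \<sigma> x" by (meson not_le zero_le_mult_iff)
    with \<open>rot_odometer q \<sigma> x < 1\<close> show ?thesis by simp
  qed
qed

text \<open>The permutation that \<open>cell_perm\<close> induces on the \<open>q\<close> cells of
  \<open>L\<^sub>1\<close>. Its rotated odometer is the first return map to
  \<open>L\<^sub>1\<close>, rescaled to the unit interval.\<close>

definition renorm_perm :: "nat \<Rightarrow> (nat \<Rightarrow> nat) \<Rightarrow> nat \<Rightarrow> nat" where
  "renorm_perm q \<sigma> i = (if i < q then return_map (cell_perm q \<sigma>) {..<q} i else i)"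

text \<open>If two returns coincide, injectivity cancels the shorter return time. The other orbit
  then visits \<open>A\<close> already at the starting point of the first one, which is too early
  unless the times agree.\<close>

lemma return_map_inj_on:
  assumes inj: "inj f" and ret: "\<And>x. x \<in> A \<Longrightarrow> \<exists>n\<ge>1. (f ^^ n) x \<in> A"
  shows "inj_on (return_map f A) A"
proof (rule inj_onI)
  have le: "x = y" if "x \<in> A" "y \<in> A" "return_map f A x = return_map f A y"
    "return_time f A x \<le> return_time f A y" for x y
  proof -
    let ?s = "return_time f A x" and ?t = "return_time f A y"
    obtain n where n: "1 \<le> n" "(f ^^ n) y \<in> A" using ret \<open>y \<in> A\<close> by blast
    obtain k where k: "1 \<le> k" "(f ^^ k) x \<in> A" using ret \<open>x \<in> A\<close> by blast
    have "?t = ?s + (?t - ?s)" using that(4) by simp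
    then have "(f ^^ ?s) x = (f ^^ ?s) ((f ^^ (?t - ?s)) y)"
      using that(3) unfolding return_map_def by (metis comp_apply funpow_add)
    then have *: "x = (f ^^ (?t - ?s)) y" using inj_fn[OF inj, of ?s] by (auto dest: injD)
    have "1 \<le> ?s" using return_time_props(1)[of k f x, OF k] .
    then have "?t - ?s = 0"
      using return_time_props(4)[of n f y, OF n, of "?t - ?s"] * that(1,4) by fastforce
    then show ?thesis using * by simp
  qed
  fix x y assume "x \<in> A" "y \<in> A" "return_map f A x = return_map f A y"
  then show "x = y" using le[of x y] le[of y x] by (metis nat_le_linear)
qed

lemma cell_perm_returns:
  assumes "\<sigma> permutes {..<q}" "i < q"
  shows "\<exists>n\<ge>1. (cell_perm q \<sigma> ^^ n) i \<in> {..<q}"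
  using permutes_returns[OF cell_perm_permutes[OF assms(1)], of i] assms(2) by auto

lemma renorm_perm_permutes:
  assumes \<sigma>: "\<sigma> permutes {..<q}"
  shows "renorm_perm q \<sigma> permutes {..<q}"
proof -
  have "inj_on (return_map (cell_perm q \<sigma>) {..<q}) {..<q}"
    using cell_perm_returns[OF \<sigma>] permutes_inj[OF cell_perm_permutes[OF \<sigma>]]
    by (intro return_map_inj_on) auto
  then have inj: "inj_on (renorm_perm q \<sigma>) {..<q}"
    by (subst inj_on_cong[where g = "return_map (cell_perm q \<sigma>) {..<q}"]) (auto simp: renorm_perm_def)
  moreover have "renorm_perm q \<sigma> ` {..<q} \<subseteq> {..<q}"
  proof
    fix y assume "y \<in> renorm_perm q \<sigma> ` {..<q}"
    then obtain i where i: "i < q" "y = return_map (cell_perm q \<sigma>) {..<q} i"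
      by (auto simp: renorm_perm_def)
    obtain n where "1 \<le> n" "(cell_perm q \<sigma> ^^ n) i \<in> {..<q}" using cell_perm_returns[OF \<sigma> i(1)] by blast
    then show "y \<in> {..<q}" unfolding i(2) return_map_def by (rule return_time_props(2))
  qed
  ultimately have "bij_betw (renorm_perm q \<sigma>) {..<q} {..<q}"
    by (simp add: endo_inj_surj bij_betw_def)
  then show ?thesis by (intro bij_imp_permutes) (auto simp: renorm_perm_def)
qed

text \<open>All points of cell \<open>i\<close> follow the cell orbit until it comes back to
  \<open>{..<q}\<close>. After rescaling, the net translation is the rotation by
  \<open>renorm_perm\<close>, and the last step supplies the odometer.\<close>

lemma rot_odometer_first_return:
  assumes \<sigma>: "\<sigma> permutes {..<q}" and i: "i < q" and x: "x \<in> sub_interval q 1 i"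
  defines "t \<equiv> return_time (cell_perm q \<sigma>) {..<q} i"
  shows "1 \<le> t" and "return_time (rot_odometer q \<sigma>) (base_interval q 1) x = t"
    and "j < t \<Longrightarrow> (rot_odometer q \<sigma> ^^ j) x \<in> sub_interval q 1 ((cell_perm q \<sigma> ^^ j) i)"
    and "(rot_odometer q \<sigma> ^^ t) x \<in> base_interval q 1"
    and "(rot_odometer q \<sigma> ^^ t) x = rot_odometer q (renorm_perm q \<sigma>) (2 ^ expo q * x) / 2 ^ expo q"
proof -
  have q: "q > 0" using i by simp
  have iD: "i < q * 2 ^ expo q" using i by (rule less_le_trans) simp
  obtain n where n: "1 \<le> n" "(cell_perm q \<sigma> ^^ n) i \<in> {..<q}"
    using cell_perm_returns[OF \<sigma> i] by blast
  note t = return_time_props[of n "cell_perm q \<sigma>" i "{..<q}", OF n, folded t_def]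
  have out: "q \<le> (cell_perm q \<sigma> ^^ m) i" if "1 \<le> m" "m < t" for m using t(4)[OF that] by simp
  have hit: "(cell_perm q \<sigma> ^^ t) i < q" using t(2) by simp
  note h = cell_orbit_hit[OF \<sigma> iD x out t(1) hit]
  show "1 \<le> t" by (rule t(1))
  show orb: "(rot_odometer q \<sigma> ^^ j) x \<in> sub_interval q 1 ((cell_perm q \<sigma> ^^ j) i)" if "j < t" for j
    using that by (intro cell_orbit(2)[OF \<sigma> iD x]) (auto intro: out)
  show "(rot_odometer q \<sigma> ^^ t) x \<in> base_interval q 1" by (rule h(3))
  show "return_time (rot_odometer q \<sigma>) (base_interval q 1) x = t"
  proof (rule return_time_eqI[OF t(1) h(3)])
    fix m assume m: "1 \<le> m" "m < t"
    then show "(rot_odometer q \<sigma> ^^ m) x \<notin> base_interval q 1"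
      using base_interval_sub_interval[OF orb[OF m(2)] q] out[OF m] by simp
  qed
  have r: "renorm_perm q \<sigma> i = (cell_perm q \<sigma> ^^ t) i"
    using i by (simp add: renorm_perm_def return_map_def t_def)
  have "\<lfloor>real q * (2 ^ expo q * x)\<rfloor> = int i"
    using x unfolding sub_interval_mult_iff[OF q] by (intro floor_unique) (simp_all add: mult.assoc)
  then have "rotation q (renorm_perm q \<sigma>) (2 ^ expo q * x)
      = 2 ^ expo q * x + (real ((cell_perm q \<sigma> ^^ t) i) - real i) / real q"
    unfolding rotation_def by (simp add: r)
  also have "\<dots> = 2 ^ expo q * (x + (real ((cell_perm q \<sigma> ^^ t) i) - real i) / (real q * 2 ^ expo q))"
    by (simp add: distrib_left)
  finally have "rot_odometer q (renorm_perm q \<sigma>) (2 ^ expo q * x) = vn_kakutani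
      (2 ^ expo q * (x + (real ((cell_perm q \<sigma> ^^ t) i) - real i) / (real q * 2 ^ expo q)))"
    unfolding rot_odometer_def by simp
  then show "(rot_odometer q \<sigma> ^^ t) x
      = rot_odometer q (renorm_perm q \<sigma>) (2 ^ expo q * x) / 2 ^ expo q"
    using h(1) by simp
qed

text \<open>The cells visited before the first hit are distinct.\<close>

lemma rot_odometer_entry_bound:
  assumes \<sigma>: "\<sigma> permutes {..<q}" and q: "q > 0" and x: "x \<in> {0..<1}"
    and hit: "(rot_odometer q \<sigma> ^^ n) x \<in> base_interval q 1"
  shows "\<exists>m<q * 2 ^ expo q. (rot_odometer q \<sigma> ^^ m) x \<in> base_interval q 1"
proof -
  let ?P = "cell_perm q \<sigma>"
  obtain c where c: "c < q * 2 ^ expo q" "x \<in> sub_interval q 1 c"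
    using unit_interval_cells[OF q x] by blast
  \<comment> \<open>Otherwise the point would follow its cell forever and never meet
    \<open>L\<^sub>1\<close>.\<close>
  have "\<exists>m. (?P ^^ m) c < q"
  proof (rule ccontr)
    assume "\<nexists>m. (?P ^^ m) c < q"
    then have "q \<le> (?P ^^ m) c" for m by (simp add: not_less)
    then have "(rot_odometer q \<sigma> ^^ n) x \<in> sub_interval q 1 ((?P ^^ n) c)" "q \<le> (?P ^^ n) c"
      by (rule cell_orbit(2)[OF \<sigma> c]) fact+
    then show False using hit base_interval_sub_interval q by auto
  qed
  then have ex: "\<exists>m. (?P ^^ m) c \<in> {..<q}" by simp
  define m where "m = entry_time ?P {..<q} c"
  obtain m0 where "(?P ^^ m0) c \<in> {..<q}" using ex by blast
  note m = entry_time_props[of m0 ?P c "{..<q}", OF this, folded m_def]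
  \<comment> \<open>If a cell were repeated, cutting out the loop would reach \<open>{..<q}\<close>
    before time \<open>m\<close>.\<close>
  have "inj_on (\<lambda>j. (?P ^^ j) c) {..m}"
  proof -
    have "a = b" if ab: "a \<le> b" "b \<le> m" and eq: "(?P ^^ a) c = (?P ^^ b) c" for a b
    proof (rule ccontr)
      assume "a \<noteq> b"
      then have lt: "a + (m - b) < m" using ab by simp
      have "(?P ^^ ((m - b) + a)) c = (?P ^^ ((m - b) + b)) c"
        unfolding funpow_add comp_apply eq ..
      then have "(?P ^^ (a + (m - b))) c = (?P ^^ m) c" using ab by (simp add: add.commute)
      then show False using m(1) m(3)[OF lt] by simp
    qed
    then show ?thesis unfolding inj_on_def by (metis atMost_iff nat_le_linear)
  qed
  moreover have "(\<lambda>j. (?P ^^ j) c) ` {..m} \<subseteq> {..<q * 2 ^ expo q}"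
    using permutes_funpow_lessThan[OF cell_perm_permutes[OF \<sigma>] c(1)] by auto
  ultimately have "card {..m} \<le> card {..<q * 2 ^ expo q}" by (intro card_inj_on_le) auto
  then have "m < q * 2 ^ expo q" by simp
  moreover have "(rot_odometer q \<sigma> ^^ m) x \<in> base_interval q 1"
  proof (cases "m = 0")
    case True
    then show ?thesis using m(1) base_interval_sub_interval[OF c(2) q] by simp
  next
    case False
    then show ?thesis
      using m(1,3) by (intro cell_orbit_hit(3)[OF \<sigma> c]) (auto simp: not_less[symmetric])
  qed
  ultimately show ?thesis by blast
qed

section \<open>Renormalization and substitution words\<close>

lemma sub_interval_scale:
  assumes "q > 0"
  shows "x \<in> sub_interval q (k + l) i \<longleftrightarrow> 2 ^ (k * expo q) * x \<in> sub_interval q l i"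
  unfolding sub_interval_mult_iff[OF assms] add_mult_distrib power_add by (simp add: ac_simps)

lemma base_interval_scale:
  "x \<in> base_interval q (k + l) \<longleftrightarrow> 2 ^ (k * expo q) * x \<in> base_interval q l"
proof -
  have "0 \<le> 2 ^ (k * expo q) * x \<longleftrightarrow> 0 \<le> x"
    using mult_le_cancel_left_pos[of "2 ^ (k * expo q)" 0 x] by simp
  then show ?thesis
    unfolding base_interval_iff add_mult_distrib power_add by (simp add: ac_simps)
qed

lemma base_interval_0: "base_interval q 0 = {0..<1}"
  unfolding base_interval_def by simp

lemma base_interval_Suc_subset: "base_interval q (Suc k) \<subseteq> base_interval q k"
  unfolding base_interval_def
  by (auto elim!: less_le_trans intro!: divide_left_mono power_increasing)

lemma sub_interval_left_endpoint:
  assumes "q > 0"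
  shows "real i / (real q * 2 ^ (k * expo q)) \<in> sub_interval q k i"
  unfolding sub_interval_iff using assms by (simp add: divide_strict_right_mono)

section \<open>The return maps at all levels\<close>

text \<open>The permutation whose rotated odometer is the return map to \<open>L\<^sub>k\<close>,
  rescaled to the unit interval.\<close>

definition level_perm :: "nat \<Rightarrow> (nat \<Rightarrow> nat) \<Rightarrow> nat \<Rightarrow> nat \<Rightarrow> nat" where
  "level_perm q \<pi> k = (renorm_perm q ^^ k) \<pi>"

lemma level_perm_permutes: "\<pi> permutes {..<q} \<Longrightarrow> level_perm q \<pi> k permutes {..<q}"
  unfolding level_perm_def by (induction k) (auto intro: renorm_perm_permutes)

text \<open>The map \<open>g\<close> is kept abstract because, in the induction over the levels, the
  formula for \<open>induced_map\<close> is available only as an induction hypothesis. The bound in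
  the second claim allows the formula to be applied again at every step.\<close>

lemma scaled_iterate:
  assumes \<sigma>: "\<sigma> permutes {..<q}" and q: "q > 0"
    and g: "\<And>x. x \<in> base_interval q k \<Longrightarrow>
      g x = rot_odometer q \<sigma> (2 ^ (k * expo q) * x) / 2 ^ (k * expo q)"
    and x: "x \<in> base_interval q k"
  shows "(g ^^ j) x = (rot_odometer q \<sigma> ^^ j) (2 ^ (k * expo q) * x) / 2 ^ (k * expo q)"
    and "(rot_odometer q \<sigma> ^^ j) (2 ^ (k * expo q) * x) \<in> {0..<1}"
proof -
  let ?s = "2 ^ (k * expo q) :: real"
  have "(g ^^ j) x = (rot_odometer q \<sigma> ^^ j) (?s * x) / ?s \<and>
    (rot_odometer q \<sigma> ^^ j) (?s * x) \<in> {0..<1}"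
  proof (induction j)
    case 0
    then show ?case using x unfolding base_interval_iff by simp
  next
    case (Suc j)
    let ?y = "(rot_odometer q \<sigma> ^^ j) (?s * x)"
    have "?y / ?s \<in> base_interval q k" using Suc unfolding base_interval_iff by simp
    then have "g (?y / ?s) = rot_odometer q \<sigma> ?y / ?s" using g by simp
    then show ?case using Suc rot_odometer_unit[OF \<sigma> q, of ?y] by simp
  qed
  then show "(g ^^ j) x = (rot_odometer q \<sigma> ^^ j) (?s * x) / ?s"
    and "(rot_odometer q \<sigma> ^^ j) (?s * x) \<in> {0..<1}" by auto
qed

lemma sub_interval_1_0:
  assumes "q > 0" "x \<in> sub_interval q 1 c"
  shows "x \<in> sub_interval q 0 (c div 2 ^ expo q)"
proof -
  define D :: nat where "D = 2 ^ expo q"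
  have D: "D > 0" and rD: "2 ^ expo q = real D" unfolding D_def by simp_all
  have "D * (c div D) \<le> c" "c + 1 \<le> D * (c div D + 1)"
    using D dividend_less_times_div[of D c] by (auto simp: algebra_simps)
  then have "real (D * (c div D)) \<le> real c" "real (c + 1) \<le> real (D * (c div D + 1))"
    unfolding of_nat_le_iff by auto
  moreover have "real c \<le> real q * real D * x" "real q * real D * x < real c + 1"
    using assms(2) unfolding sub_interval_mult_iff[OF assms(1)] by (simp_all add: rD)
  moreover have "real D * (real q * x) = real q * real D * x" by simp
  moreover have "real (D * (c div D)) = real D * real (c div D)"
    "real (D * (c div D + 1)) = real D * (real (c div D) + 1)" "real (c + 1) = real c + 1"
    by (simp_all only: of_nat_mult of_nat_add of_nat_1)
  ultimately have "real D * real (c div D) \<le> real D * (real q * x)"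
    "real D * (real q * x) < real D * (real (c div D) + 1)"
    by linarith+
  then have "real (c div D) \<le> real q * x" "real q * x < real (c div D) + 1"
    using D by (simp_all only: mult_le_cancel_left_pos mult_less_cancel_left_pos of_nat_0_less_iff)
  then show ?thesis
    unfolding sub_interval_mult_iff[OF assms(1)] D_def[symmetric] by simp
qed

text \<open>Multiplication by \<open>2 ^ (k * expo q)\<close> conjugates \<open>g\<close> to a
  rotated odometer and carries \<open>L\<^sub>k\<^sub>+\<^sub>1\<close> to \<open>L\<^sub>1\<close>,
  so the result for level one applies. The letter at time \<open>j\<close> is the group of
  \<open>2 ^ expo q\<close> cells that contains the current cell.\<close>

lemma scaled_first_return:
  assumes \<sigma>: "\<sigma> permutes {..<q}" and q: "q > 0"
    and g: "\<And>x. x \<in> base_interval q k \<Longrightarrow>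
      g x = rot_odometer q \<sigma> (2 ^ (k * expo q) * x) / 2 ^ (k * expo q)"
    and i: "i < q" and x: "x \<in> sub_interval q (Suc k) i"
  defines "t \<equiv> return_time (cell_perm q \<sigma>) {..<q} i"
  shows "1 \<le> t" and "return_time g (base_interval q (Suc k)) x = t"
    and "(g ^^ t) x \<in> base_interval q (Suc k)"
    and "(g ^^ t) x = rot_odometer q (renorm_perm q \<sigma>) (2 ^ (Suc k * expo q) * x) / 2 ^ (Suc k * expo q)"
    and "j < t \<Longrightarrow> (g ^^ j) x \<in> sub_interval q k ((cell_perm q \<sigma> ^^ j) i div 2 ^ expo q)"
proof -
  let ?s = "2 ^ (k * expo q) :: real" and ?F = "rot_odometer q \<sigma>"
  have sx: "?s * x \<in> sub_interval q 1 i" using x sub_interval_scale[OF q, of x k 1 i] by simp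
  have "x \<in> base_interval q (Suc k)" using base_interval_sub_interval[OF x q] i by simp
  then have xk: "x \<in> base_interval q k" using base_interval_Suc_subset by blast
  note it = scaled_iterate[OF \<sigma> q g xk, simplified]
  have giff: "(g ^^ n) x \<in> base_interval q (Suc k) \<longleftrightarrow> (?F ^^ n) (?s * x) \<in> base_interval q 1" for n
    using base_interval_scale[of "(g ^^ n) x" q k 1] it(1) by simp
  note r = rot_odometer_first_return[OF \<sigma> i sx, folded t_def]
  show t1: "1 \<le> t" by (rule r(1))
  show tB: "(g ^^ t) x \<in> base_interval q (Suc k)" unfolding giff by (rule r(4))
  have "return_time g (base_interval q (Suc k)) x = return_time ?F (base_interval q 1) (?s * x)"
    unfolding return_time_def giff ..
  then show "return_time g (base_interval q (Suc k)) x = t" using r(2) by simp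
  show "(g ^^ t) x = rot_odometer q (renorm_perm q \<sigma>) (2 ^ (Suc k * expo q) * x) / 2 ^ (Suc k * expo q)"
    unfolding it(1) r(5) by (simp add: power_add mult.assoc)
  show "(g ^^ j) x \<in> sub_interval q k ((cell_perm q \<sigma> ^^ j) i div 2 ^ expo q)" if "j < t"
    using sub_interval_1_0[OF q r(3)[OF that]] sub_interval_scale[OF q, of "(g ^^ j) x" k 0] it(1)
    by simp
qed

text \<open>The return to \<open>L\<^sub>k\<^sub>+\<^sub>1\<close> is induced from the return map to
  \<open>L\<^sub>k\<close>, a scaled rotated odometer that renormalizes once more. Inducing in two
  stages requires recurrence to \<open>L\<^sub>k\<close>, so the second claim is carried through the
  same induction.\<close>

lemma induced_map_scaled:
  assumes \<pi>: "\<pi> permutes {..<q}" and q: "q > 0" and x: "x \<in> base_interval q k"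
  shows "induced_map q \<pi> k x = rot_odometer q (level_perm q \<pi> k) (2 ^ (k * expo q) * x) / 2 ^ (k * expo q)"
    and "\<exists>n\<ge>1. (rot_odometer q \<pi> ^^ n) x \<in> base_interval q k"
proof -
  have "induced_map q \<pi> k x = rot_odometer q (level_perm q \<pi> k) (2 ^ (k * expo q) * x) / 2 ^ (k * expo q)
    \<and> (\<exists>n\<ge>1. (rot_odometer q \<pi> ^^ n) x \<in> base_interval q k)"
    using x
  proof (induction k arbitrary: x)
    case 0
    then have "rot_odometer q \<pi> x \<in> base_interval q 0"
      using rot_odometer_unit[OF \<pi> q] by (simp add: base_interval_0)
    moreover from this have "return_time (rot_odometer q \<pi>) (base_interval q 0) x = 1"
      by (intro return_time_eqI) auto
    ultimately show ?case
      by (auto simp: induced_map_def return_map_def level_perm_def intro!: exI[of _ 1])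
  next
    case (Suc k)
    obtain i where i: "i < q" "x \<in> sub_interval q (Suc k) i"
      using base_interval_eq_Union[OF q] Suc.prems by blast
    have g: "induced_map q \<pi> k = return_map (rot_odometer q \<pi>) (base_interval q k)"
      unfolding induced_map_def by (rule ext) simp
    have IH1: "\<And>x. x \<in> base_interval q k \<Longrightarrow> induced_map q \<pi> k x =
        rot_odometer q (level_perm q \<pi> k) (2 ^ (k * expo q) * x) / 2 ^ (k * expo q)"
      and IH2: "\<And>x. x \<in> base_interval q k \<Longrightarrow> \<exists>n\<ge>1. (rot_odometer q \<pi> ^^ n) x \<in> base_interval q k"
      using Suc.IH by blast+
    note s = scaled_first_return[OF level_perm_permutes[OF \<pi>] q IH1 i, simplified]
    have lp: "renorm_perm q (level_perm q \<pi> k) = level_perm q \<pi> (Suc k)"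
      unfolding level_perm_def by simp
    note R = return_time_first_return[where f = "rot_odometer q \<pi>" and A = "base_interval q k",
        folded g, OF IH2 base_interval_Suc_subset Suc.prems s(1)[folded One_nat_def] s(3)]
    have "induced_map q \<pi> (Suc k) x = return_map (induced_map q \<pi> k) (base_interval q (Suc k)) x"
      using R(2) unfolding induced_map_def[of q \<pi> "Suc k"] by simp
    also have "\<dots> = rot_odometer q (level_perm q \<pi> (Suc k)) (2 ^ (Suc k * expo q) * x) / 2 ^ (Suc k * expo q)"
      unfolding return_map_def s(2) using s(4) lp by simp
    finally show ?case using R(1) by simp
  qed
  then show "induced_map q \<pi> k x = rot_odometer q (level_perm q \<pi> k) (2 ^ (k * expo q) * x) / 2 ^ (k * expo q)"
    and "\<exists>n\<ge>1. (rot_odometer q \<pi> ^^ n) x \<in> base_interval q k" by auto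
qed

text \<open>The definite descriptions are resolved by the cell permutation: it gives the common
  return time, and the \<open>j\<close>-th letter is the \<open>j\<close>-th cell divided by
  \<open>2 ^ expo q\<close>. The last claim keeps the cell itself at level one, which is fine enough
  to separate the two middle letters.\<close>

lemma subst_word_itinerary:
  assumes \<pi>: "\<pi> permutes {..<q}" and q: "q > 0" and i: "i < q"
  shows "common_return_time q \<pi> (Suc k) i = length (subst_word q \<pi> (Suc k) i)"
    and "x \<in> sub_interval q (Suc k) i \<Longrightarrow>
      return_time (induced_map q \<pi> k) (base_interval q (Suc k)) x = length (subst_word q \<pi> (Suc k) i)"
    and "x \<in> sub_interval q (Suc k) i \<Longrightarrow>
      (induced_map q \<pi> k ^^ length (subst_word q \<pi> (Suc k) i)) x \<in> base_interval q (Suc k)"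
    and "1 \<le> length (subst_word q \<pi> (Suc k) i)"
    and "j < length (subst_word q \<pi> (Suc k) i) \<Longrightarrow> subst_word q \<pi> (Suc k) i ! j < q"
    and "j < length (subst_word q \<pi> (Suc k) i) \<Longrightarrow> x \<in> sub_interval q (Suc k) i \<Longrightarrow>
      (induced_map q \<pi> k ^^ j) x \<in> sub_interval q k (subst_word q \<pi> (Suc k) i ! j)"
    and "j < length (subst_word q \<pi> (Suc k) i) \<Longrightarrow> x \<in> sub_interval q 1 i \<Longrightarrow> k = 0 \<Longrightarrow>
      (rot_odometer q \<pi> ^^ j) x \<in> sub_interval q 1 ((cell_perm q \<pi> ^^ j) i)"
proof -
  let ?P = "cell_perm q (level_perm q \<pi> k)" and ?g = "induced_map q \<pi> k"
  define t where "t = return_time ?P {..<q} i"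
  note s = scaled_first_return[OF level_perm_permutes[OF \<pi>] q induced_map_scaled(1)[OF \<pi> q] i,
      of k, simplified, folded t_def]
  \<comment> \<open>A point of the interval; it makes the uniqueness claims below
    non-vacuous.\<close>
  have e: "real i / (real q * 2 ^ (Suc k * expo q)) \<in> sub_interval q (Suc k) i"
    by (rule sub_interval_left_endpoint[OF q])
  have crt: "common_return_time q \<pi> (Suc k) i = t"
    unfolding common_return_time_def
    by (rule the_equality) (use s(2) e in auto)
  have len: "length (subst_word q \<pi> (Suc k) i) = t"
    unfolding subst_word_def by (simp add: crt)
  have w: "subst_word q \<pi> (Suc k) i ! j = (?P ^^ j) i div 2 ^ expo q"
    and wq: "(?P ^^ j) i div 2 ^ expo q < q" if j: "j < t" for j
  proof -
    have "i < q * 2 ^ expo q" using i by (rule less_le_trans) simp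
    then show wq: "(?P ^^ j) i div 2 ^ expo q < q"
      using permutes_funpow_lessThan[OF cell_perm_permutes[OF level_perm_permutes[OF \<pi>]]] 
      by (intro div_less_mult) blast
    have "(THE w. w < q \<and> (?g ^^ j) ` sub_interval q (Suc k) i \<subseteq> sub_interval q k w)
        = (?P ^^ j) i div 2 ^ expo q"
    proof (rule the_equality)
      show "(?P ^^ j) i div 2 ^ expo q < q \<and>
          (?g ^^ j) ` sub_interval q (Suc k) i \<subseteq> sub_interval q k ((?P ^^ j) i div 2 ^ expo q)"
        using wq s(5) j by auto
    next
      fix w assume "w < q \<and> (?g ^^ j) ` sub_interval q (Suc k) i \<subseteq> sub_interval q k w"
      then show "w = (?P ^^ j) i div 2 ^ expo q"
        using sub_interval_unique[OF _ s(5)[OF e j] q] e by blast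
    qed
    then show "subst_word q \<pi> (Suc k) i ! j = (?P ^^ j) i div 2 ^ expo q"
      unfolding subst_word_def using j crt by simp
  qed
  show "common_return_time q \<pi> (Suc k) i = length (subst_word q \<pi> (Suc k) i)"
    unfolding crt len ..
  show "return_time ?g (base_interval q (Suc k)) x = length (subst_word q \<pi> (Suc k) i)"
    "(?g ^^ length (subst_word q \<pi> (Suc k) i)) x \<in> base_interval q (Suc k)"
    if "x \<in> sub_interval q (Suc k) i"
    unfolding len using s(2,3) that by auto
  show "1 \<le> length (subst_word q \<pi> (Suc k) i)" unfolding len using s(1) e by simp
  show "subst_word q \<pi> (Suc k) i ! j < q" if "j < length (subst_word q \<pi> (Suc k) i)"
    using w wq that len by simp
  show "(?g ^^ j) x \<in> sub_interval q k (subst_word q \<pi> (Suc k) i ! j)"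
    if "j < length (subst_word q \<pi> (Suc k) i)" "x \<in> sub_interval q (Suc k) i"
    using w s(5) that len by simp
  show "(rot_odometer q \<pi> ^^ j) x \<in> sub_interval q 1 ((cell_perm q \<pi> ^^ j) i)"
    if "j < length (subst_word q \<pi> (Suc k) i)" "x \<in> sub_interval q 1 i" "k = 0"
    using rot_odometer_first_return(3)[OF \<pi> i that(2), of j] that len
    by (simp add: t_def level_perm_def)
qed

lemma expo_pos: "1 \<le> expo q"
proof -
  have "q \<le> 2 ^ Suc q" by (metis less_exp less_imp_le Suc_lessD)
  then show ?thesis
    using LeastI[of "\<lambda>n. 1 \<le> n \<and> q \<le> 2 ^ n" "Suc q"] unfolding expo_def by simp
qed

section \<open>The alphabet with doubled middle letter\<close>

lemma letter_interval_even:
  assumes "even q" "q > 0"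
  shows "x \<in> letter_interval q a \<longleftrightarrow> real a \<le> real q * x \<and> real q * x < real a + 1"
  using assms unfolding letter_interval_def orig_letter_def
  by (auto simp: pos_divide_le_eq pos_less_divide_eq mult.commute add.commute)

text \<open>Multiplying by \<open>q\<close> makes all endpoints integers except the cut at
  \<open>real m + 1 / 2\<close>, which is half of \<open>q\<close>; membership becomes linear
  arithmetic.\<close>

lemma letter_interval_odd:
  assumes q: "q = 2 * m + 1"
  shows "x \<in> letter_interval q a \<longleftrightarrow>
    (if a \<le> m then real a \<le> real q * x else if a = m + 1 then real m + 1 / 2 \<le> real q * x
     else real a \<le> real q * x + 1) \<and>
    (if a < m then real q * x < real a + 1 else if a = m then real q * x < real m + 1 / 2
     else real q * x < real a)"
proof -
  have q0: "real q > 0" and m: "(q - 1) div 2 = m" and odd: "odd q" using q by simp_all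
  have half: "x < 1 / 2 \<longleftrightarrow> real q * x < real m + 1 / 2" "1 / 2 \<le> x \<longleftrightarrow> real m + 1 / 2 \<le> real q * x"
  proof -
    have "x < 1 / 2 \<longleftrightarrow> real q * x < real q * (1 / 2)" "1 / 2 \<le> x \<longleftrightarrow> real q * (1 / 2) \<le> real q * x"
      using q0 by (simp_all only: mult_less_cancel_left_pos mult_le_cancel_left_pos)
    moreover have "real q * (1 / 2) = real m + 1 / 2" using q by simp
    ultimately show "x < 1 / 2 \<longleftrightarrow> real q * x < real m + 1 / 2" "1 / 2 \<le> x \<longleftrightarrow> real m + 1 / 2 \<le> real q * x"
      by (simp_all only:)
  qed
  have lo: "real b / real q \<le> x \<longleftrightarrow> real b \<le> real q * x" and hi: "x < real b / real q \<longleftrightarrow> real q * x < real b" for b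
    using q0 by (simp_all add: pos_divide_le_eq pos_less_divide_eq mult.commute)
  consider "a < m" | "a = m" | "a = m + 1" | "a > m + 1" by linarith
  then show ?thesis
  proof cases
    case 1
    then have "letter_interval q a = {real a / real q ..< real (a + 1) / real q}"
      unfolding letter_interval_def orig_letter_def m by (simp add: Let_def)
    then show ?thesis using 1 lo[of a] hi[of "a + 1"] by (simp only: atLeastLessThan_iff) auto
  next
    case 2
    then have "letter_interval q a = {real m / real q ..< 1 / 2}"
      unfolding letter_interval_def m using odd by (simp add: Let_def)
    then show ?thesis using 2 lo[of m] half by (simp only: atLeastLessThan_iff) auto
  next
    case 3
    then have "letter_interval q a = {1 / 2 ..< real (m + 1) / real q}"
      unfolding letter_interval_def m using odd by (simp add: Let_def)
    then show ?thesis using 3 hi[of "m + 1"] half by (simp only: atLeastLessThan_iff) auto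
  next
    case 4
    then have "letter_interval q a = {real (a - 1) / real q ..< real a / real q}"
      unfolding letter_interval_def orig_letter_def m using odd by (simp add: Let_def)
    moreover have "real (a - 1) = real a - 1" using 4 by (simp add: of_nat_diff)
    ultimately show ?thesis using 4 lo[of "a - 1"] hi[of a] by (simp only: atLeastLessThan_iff) auto
  qed
qed

lemma orig_letter_odd:
  assumes "q = 2 * m + 1"
  shows "orig_letter q a = (if a \<le> m then a else a - 1)"
  using assms unfolding orig_letter_def by auto

lemma orig_letter_less: "q > 0 \<Longrightarrow> a < alphabet_size q \<Longrightarrow> orig_letter q a < q"
  unfolding orig_letter_def alphabet_size_def by (auto split: if_splits elim!: oddE)

lemma orig_letter_surj:
  assumes "i < q"
  obtains a where "a < alphabet_size q" "orig_letter q a = i"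
proof (cases "even q")
  case True
  then show ?thesis using that[of i] assms by (simp add: orig_letter_def alphabet_size_def)
next
  case False
  then show ?thesis
    using that[of i] that[of "Suc i"] assms
    by (cases "i \<le> (q - 1) div 2") (auto simp: orig_letter_def alphabet_size_def)
qed

lemma letter_interval_subset:
  assumes q: "q > 0" and x: "x \<in> letter_interval q a"
  shows "x \<in> sub_interval q 0 (orig_letter q a)"
proof (cases "even q")
  case True
  then show ?thesis using x
    by (simp add: letter_interval_even[OF _ q] sub_interval_mult_iff[OF q] orig_letter_def)
next
  case False
  then obtain m where m: "q = 2 * m + 1" by (elim oddE)
  have xi: "(if a \<le> m then real a \<le> real q * x else if a = m + 1 then real m + 1 / 2 \<le> real q * x
     else real a \<le> real q * x + 1) \<and>
    (if a < m then real q * x < real a + 1 else if a = m then real q * x < real m + 1 / 2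
     else real q * x < real a)"
    using x unfolding letter_interval_odd[OF m] .
  show ?thesis
  proof (cases "a \<le> m")
    case True
    then show ?thesis using xi
      by (auto simp: sub_interval_mult_iff[OF q] orig_letter_odd[OF m] split: if_splits)
  next
    case False
    then have "real (a - 1) = real a - 1" by (simp add: of_nat_diff)
    then show ?thesis using xi False
      by (auto simp: sub_interval_mult_iff[OF q] orig_letter_odd[OF m] split: if_splits)
  qed
qed

text \<open>The original letters agree, which leaves only the two middle letters to be told apart;
  these are separated by \<open>1 / 2\<close>.\<close>

lemma letter_interval_unique:
  assumes q: "q > 0" and x: "x \<in> letter_interval q a" "x \<in> letter_interval q b"
  shows "a = b"
proof -
  have eq: "orig_letter q a = orig_letter q b"
    using letter_interval_subset[OF q] x sub_interval_unique[OF _ _ q] by blast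
  show ?thesis
  proof (cases "even q")
    case True
    then show ?thesis using eq by (simp add: orig_letter_def)
  next
    case False
    then obtain m where m: "q = 2 * m + 1" by (elim oddE)
    have "a = b \<or> {a, b} = {m, m + 1}"
      using eq unfolding orig_letter_odd[OF m] by (auto split: if_splits)
    then show ?thesis
      using x unfolding letter_interval_odd[OF m] by (auto simp: doubleton_eq_iff)
  qed
qed

text \<open>Cutting the middle interval at \<open>1 / 2\<close> keeps every letter interval within
  one half. As \<open>skew_letter\<close> is decided by inclusion, a single point in the left half
  has to force the whole interval there.\<close>

lemma skew_letter_interval:
  assumes q: "q > 0" and x: "x \<in> letter_interval q a"
  shows "skew x = skew_letter q a"
proof -
  have "letter_interval q a \<subseteq> {0..<1/2}" if h: "x < 1 / 2"
  proof
    fix y assume y: "y \<in> letter_interval q a"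
    have lt: "real q * x < real q * (1 / 2)" using q h by (intro mult_strict_left_mono) auto
    have "real q * y < real q * (1 / 2) \<and> 0 \<le> real q * y"
    proof (cases "even q")
      case True
      then obtain h where h: "q = 2 * h" by (elim evenE)
      have "real a < real h"
        using x lt h unfolding letter_interval_even[OF True q] by simp
      then have "real a + 1 \<le> real h" by simp
      moreover have "real q * (1 / 2) = real h" using h by simp
      moreover have "real a \<le> real q * y" "real q * y < real a + 1" "0 \<le> real a"
        using y unfolding letter_interval_even[OF True q] by simp_all
      ultimately show ?thesis by linarith
    next
      case False
      then obtain m where m: "q = 2 * m + 1" by (elim oddE)
      have half: "real q * (1 / 2) = real m + 1 / 2" using m by simp
      have x': "real q * x < real m + 1 / 2" using lt unfolding half .
      have "a \<le> m"
      proof (rule ccontr)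
        assume "\<not> a \<le> m"
        moreover from this have "real m + 1 \<le> real a" by simp
        moreover have "real m + 2 \<le> real a" if "m + 1 < a"
        proof -
          have "real (m + 2) \<le> real a" using that unfolding of_nat_le_iff by simp
          then show ?thesis by simp
        qed
        ultimately show False using x x' unfolding letter_interval_odd[OF m]
          by (cases "a = m + 1") auto
      qed
      then have "real q * y < real m + 1 / 2 \<and> 0 \<le> real q * y"
        using y unfolding letter_interval_odd[OF m] by (cases "a = m") auto
      then show ?thesis unfolding half .
    qed
    then have "real q * y < real q * (1 / 2)" "real q * 0 \<le> real q * y" by simp_all
    then have "y < 1 / 2" "0 \<le> y"
      using q by (simp_all only: mult_less_cancel_left_pos mult_le_cancel_left_pos of_nat_0_less_iff)
    then show "y \<in> {0..<1/2}" by simp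
  qed
  moreover have "\<not> letter_interval q a \<subseteq> {0..<1/2}" if "\<not> x < 1 / 2"
    using x that by auto
  ultimately show ?thesis unfolding skew_def skew_letter_def by auto
qed

text \<open>The cells also refine the doubled partition: \<open>1 / 2\<close> is an endpoint of
  cells because \<open>2 ^ expo q\<close> is even.\<close>

lemma cell_letter:
  assumes q: "q > 0" and c: "c < q * 2 ^ expo q"
  obtains b where "b < alphabet_size q" "sub_interval q 1 c \<subseteq> letter_interval q b"
proof -
  define w where "w = c div 2 ^ expo q"
  have w: "w < q" unfolding w_def by (rule div_less_mult[OF c])
  have sub: "real w \<le> real q * x \<and> real q * x < real w + 1" if "x \<in> sub_interval q 1 c" for x
    using sub_interval_1_0[OF q that] unfolding sub_interval_mult_iff[OF q] w_def by simp
  show ?thesis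
  proof (cases "even q")
    case True
    show ?thesis
    proof (rule that[of w])
      show "w < alphabet_size q" using True w by (simp add: alphabet_size_def)
      show "sub_interval q 1 c \<subseteq> letter_interval q w"
        using sub by (auto simp: letter_interval_even[OF True q])
    qed
  next
    case False
    then obtain m where m: "q = 2 * m + 1" by (elim oddE)
    have A: "alphabet_size q = q + 1" using False by (simp add: alphabet_size_def)
    consider "w < m" | "w > m" | "w = m" by linarith
    then show ?thesis
    proof cases
      case 1
      have "sub_interval q 1 c \<subseteq> letter_interval q w"
        using sub 1 by (auto simp: letter_interval_odd[OF m])
      then show ?thesis using that[of w] w A by simp
    next
      case 2
      have "sub_interval q 1 c \<subseteq> letter_interval q (w + 1)"
        using sub 2 by (auto simp: letter_interval_odd[OF m] add.commute)
      then show ?thesis using that[of "w + 1"] w A by simp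
    next
      case 3
      \<comment> \<open>Half the number of cells in an interval of length \<open>1 / q\<close>; cell
        \<open>q * D'\<close> has left endpoint \<open>1 / 2\<close>.\<close>
      obtain D' where D': "2 ^ expo q = 2 * (D' :: nat)"
        using expo_pos[of q] by (cases "expo q") auto
      have rD: "2 ^ expo q = 2 * real D'"
        using arg_cong[OF D', of real] by simp
      have xs: "real c \<le> 2 * real D' * (real q * x)" "2 * real D' * (real q * x) < real c + 1"
        if "x \<in> sub_interval q 1 c" for x
        using that unfolding sub_interval_mult_iff[OF q] by (simp_all add: rD ac_simps)
      have D0: "2 * real D' > 0" using rD by (metis zero_less_numeral zero_less_power)
      have h: "2 * real D' * (real m + 1 / 2) = real (q * D')" using m by (simp add: algebra_simps)
      show ?thesis
      proof (cases "c < q * D'")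
        case True
        then have "real c + 1 \<le> real (q * D')" by (simp flip: of_nat_mult)
        then have "2 * real D' * (real q * x) < 2 * real D' * (real m + 1 / 2)"
          if "x \<in> sub_interval q 1 c" for x
          using xs(2)[OF that] unfolding h by linarith
        then have "real q * x < real m + 1 / 2" if "x \<in> sub_interval q 1 c" for x
          using that D0 by (simp only: mult_less_cancel_left_pos)
        then have "sub_interval q 1 c \<subseteq> letter_interval q m"
          using sub 3 by (auto simp: letter_interval_odd[OF m])
        then show ?thesis using that[of m] A m by simp
      next
        case False
        then have "real (q * D') \<le> real c" unfolding of_nat_le_iff by simp
        then have "2 * real D' * (real m + 1 / 2) \<le> 2 * real D' * (real q * x)"
          if "x \<in> sub_interval q 1 c" for x
          using xs(1)[OF that] unfolding h by linarith
        then have "real m + 1 / 2 \<le> real q * x" if "x \<in> sub_interval q 1 c" for x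
          using that D0 by (simp only: mult_le_cancel_left_pos)
        then have "sub_interval q 1 c \<subseteq> letter_interval q (m + 1)"
          using sub 3 by (auto simp: letter_interval_odd[OF m] add.commute)
        then show ?thesis using that[of "m + 1"] A m by simp
      qed
    qed
  qed
qed

text \<open>Each image of the interval stays in one cell, hence in one letter interval. Merging the
  two middle letters gives back the original word, since the left endpoint follows both
  itineraries.\<close>

lemma doubled_subst_itinerary:
  assumes \<pi>: "\<pi> permutes {..<q}" and q: "q > 0" and a: "a < alphabet_size q"
  shows "length (doubled_subst q \<pi> a) = length (subst_word q \<pi> 1 (orig_letter q a))"
    and "j < length (doubled_subst q \<pi> a) \<Longrightarrow> doubled_subst q \<pi> a ! j < alphabet_size q"
    and "j < length (doubled_subst q \<pi> a) \<Longrightarrow> x \<in> sub_interval q 1 (orig_letter q a) \<Longrightarrow>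
      (rot_odometer q \<pi> ^^ j) x \<in> letter_interval q (doubled_subst q \<pi> a ! j)"
    and "j < length (doubled_subst q \<pi> a) \<Longrightarrow>
      orig_letter q (doubled_subst q \<pi> a ! j) = subst_word q \<pi> 1 (orig_letter q a) ! j"
proof -
  let ?i = "orig_letter q a" and ?F = "rot_odometer q \<pi>"
  let ?w = "subst_word q \<pi> 1 ?i" and ?d = "doubled_subst q \<pi> a"
  have i: "?i < q" by (rule orig_letter_less[OF q a])
  note I = subst_word_itinerary[OF \<pi> q i, where k = 0, folded One_nat_def]
  show len: "length ?d = length ?w"
    unfolding doubled_subst_def using I(1) by simp
  have e: "real ?i / (real q * 2 ^ (1 * expo q)) \<in> sub_interval q 1 ?i" (is "?e \<in> _")
    by (rule sub_interval_left_endpoint[OF q])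
  have main: "?d ! j < alphabet_size q \<and> (?F ^^ j) ` sub_interval q 1 ?i \<subseteq> letter_interval q (?d ! j)"
    if j: "j < length ?d" for j
  proof -
    have "?i < q * 2 ^ expo q" using i by (rule less_le_trans) simp
    then have "(cell_perm q \<pi> ^^ j) ?i < q * 2 ^ expo q"
      by (rule permutes_funpow_lessThan[OF cell_perm_permutes[OF \<pi>]])
    then obtain b where b: "b < alphabet_size q"
      "sub_interval q 1 ((cell_perm q \<pi> ^^ j) ?i) \<subseteq> letter_interval q b"
      using cell_letter[OF q] by blast
    have img: "(?F ^^ j) ` sub_interval q 1 ?i \<subseteq> letter_interval q b"
    proof safe
      fix x assume "x \<in> sub_interval q 1 ?i"
      then show "(?F ^^ j) x \<in> letter_interval q b"
        using I(7)[of j x] b(2) j len by (metis subsetD)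
    qed
    have "(THE b. b < alphabet_size q \<and> (?F ^^ j) ` sub_interval q 1 ?i \<subseteq> letter_interval q b) = b"
    proof (rule the_equality)
      fix b' assume "b' < alphabet_size q \<and> (?F ^^ j) ` sub_interval q 1 ?i \<subseteq> letter_interval q b'"
      then show "b' = b" using letter_interval_unique[OF q, of "(?F ^^ j) ?e" b' b] img e by blast
    qed (use b img in auto)
    moreover have "?d ! j = (THE b. b < alphabet_size q \<and>
        (?F ^^ j) ` sub_interval q 1 ?i \<subseteq> letter_interval q b)"
      using j unfolding doubled_subst_def by simp
    ultimately show ?thesis using b img by simp
  qed
  show "?d ! j < alphabet_size q" if "j < length ?d" using main that by blast
  show x: "(?F ^^ j) x \<in> letter_interval q (?d ! j)" if "j < length ?d" "x \<in> sub_interval q 1 ?i" for x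
    using main that by blast
  show "orig_letter q (?d ! j) = ?w ! j" if j: "j < length ?d"
  proof -
    have eB: "?e \<in> base_interval q 0"
      using base_interval_sub_interval[OF e q] i base_interval_Suc_subset[of q 0] by auto
    have "(induced_map q \<pi> 0 ^^ j) ?e = (?F ^^ j) ?e"
      using scaled_iterate(1)[OF \<pi> q, of 0 "induced_map q \<pi> 0", OF _ eB] induced_map_scaled(1)[OF \<pi> q, of _ 0]
      by (simp add: level_perm_def)
    then have "(?F ^^ j) ?e \<in> sub_interval q 0 (?w ! j)"
      using I(6)[of j ?e] j len e by simp
    then show ?thesis
      using letter_interval_subset[OF q x[OF j e]] sub_interval_unique[OF _ _ q] by blast
  qed
qed

section \<open>Sums of the skew-function over first returns\<close>

text \<open>The vector \<open>V\<^sub>k\<close> of the overview, obtained from the substitution. It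
  is kept integer-valued because its integrality is what brings phases close to 1.\<close>

primrec letter_sum :: "nat \<Rightarrow> (nat \<Rightarrow> nat) \<Rightarrow> nat \<Rightarrow> nat \<Rightarrow> int" where
  "letter_sum q \<pi> 0 a = skew_letter q a"
| "letter_sum q \<pi> (Suc k) a = (\<Sum>b\<leftarrow>doubled_subst q \<pi> a. letter_sum q \<pi> k b)"

lemma induced_map_eq_return_map:
  "induced_map q \<pi> k = return_map (rot_odometer q \<pi>) (base_interval q k)"
  unfolding induced_map_def by (rule ext) simp

text \<open>The return to \<open>L\<^sub>k\<^sub>+\<^sub>1\<close> splits into returns to
  \<open>L\<^sub>k\<close> along a word that stationarity identifies with
  \<open>doubled_subst\<close>. Level 0 requires the letter interval, because the two middle letters
  have opposite signs there; at later levels both stand for the same interval and have the same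
  sum.\<close>

lemma birkhoff_sum_first_return:
  assumes \<pi>: "\<pi> permutes {..<q}" and q: "q > 0" and st: "stationary q \<pi>"
    and a: "a < alphabet_size q"
    and x: "x \<in> (if k = 0 then letter_interval q a else sub_interval q k (orig_letter q a))"
  shows "birkhoff_sum (rot_odometer q \<pi>) skew (return_time (rot_odometer q \<pi>) (base_interval q k) x) x
    = letter_sum q \<pi> k a"
  using a x
proof (induction k arbitrary: a x)
  case 0
  have "x \<in> base_interval q 0"
    using letter_interval_subset[OF q, of x a] 0 orig_letter_less[OF q, of a] base_interval_sub_interval[OF _ q]
    by auto
  then have "rot_odometer q \<pi> x \<in> base_interval q 0"
    using rot_odometer_unit[OF \<pi> q] by (simp add: base_interval_0)
  then have "return_time (rot_odometer q \<pi>) (base_interval q 0) x = 1"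
    by (intro return_time_eqI) auto
  then show ?case using skew_letter_interval[OF q, of x a] 0 by (simp add: birkhoff_sum_def)
next
  case (Suc k)
  let ?i = "orig_letter q a" and ?g = "induced_map q \<pi> k" and ?F = "rot_odometer q \<pi>"
  let ?d = "doubled_subst q \<pi> a"
  have i: "?i < q" using orig_letter_less[OF q] Suc.prems by simp
  have x: "x \<in> sub_interval q (Suc k) ?i" using Suc.prems by simp
  have xB: "x \<in> base_interval q (Suc k)" using base_interval_sub_interval[OF x q] i by simp
  note I = subst_word_itinerary[OF \<pi> q i, where k = k]
  have st': "subst_word q \<pi> (Suc k) ?i = subst_word q \<pi> 1 ?i"
    using st i unfolding stationary_def by (metis le_add1 plus_1_eq_Suc)
  note D = doubled_subst_itinerary[OF \<pi> q Suc.prems(1)]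
  have len: "length (subst_word q \<pi> (Suc k) ?i) = length ?d" using D(1) st' by simp
  have IH: "birkhoff_sum ?F skew (return_time ?F (base_interval q k) ((?g ^^ j) x)) ((?g ^^ j) x)
      = letter_sum q \<pi> k (?d ! j)" if j: "j < length ?d" for j
  proof (rule Suc.IH[OF D(2)[OF j]])
    show "(?g ^^ j) x \<in> (if k = 0 then letter_interval q (?d ! j)
        else sub_interval q k (orig_letter q (?d ! j)))"
    proof (cases "k = 0")
      case True
      have "x \<in> base_interval q 0" using xB base_interval_Suc_subset True by blast
      then have "(?g ^^ j) x = (?F ^^ j) x"
        using scaled_iterate(1)[OF \<pi> q, of 0 ?g x j] induced_map_scaled(1)[OF \<pi> q, of _ 0] True
        by (simp add: level_perm_def)
      then show ?thesis using D(3)[OF j, of x] x True by simp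
    next
      case False
      then show ?thesis using I(6)[of j x] D(4)[OF j] j x len st' by simp
    qed
  qed
  have "birkhoff_sum ?F skew (return_time ?F (base_interval q (Suc k)) x) x =
      (\<Sum>j<return_time ?g (base_interval q (Suc k)) x.
        birkhoff_sum ?F skew (return_time ?F (base_interval q k) ((?g ^^ j) x)) ((?g ^^ j) x))"
    unfolding induced_map_eq_return_map
    by (rule return_time_first_return(3)[OF _ base_interval_Suc_subset xB I(4)])
      (use induced_map_scaled(2)[OF \<pi> q] I(3)[OF x] in \<open>auto simp: induced_map_eq_return_map\<close>)
  also have "\<dots> = (\<Sum>j<length ?d. letter_sum q \<pi> k (?d ! j))"
    unfolding I(2)[OF x] len by (intro sum.cong) (auto simp: IH)
  also have "\<dots> = letter_sum q \<pi> (Suc k) a"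
    by (simp add: sum_list_sum_nth atLeast0LessThan)
  finally show ?case .
qed

section \<open>Phases of the cocycle\<close>

lemma sum_list_count_list:
  fixes f :: "'b \<Rightarrow> 'a :: comm_semiring_1"
  assumes "finite X" "set xs \<subseteq> X"
  shows "(\<Sum>x\<leftarrow>xs. f x) = (\<Sum>x\<in>X. of_nat (count_list xs x) * f x)"
  using assms(2)
proof (induction xs)
  case (Cons y xs)
  have "(\<Sum>x\<in>X. of_nat (count_list (y # xs) x) * f x)
      = (\<Sum>x\<in>X. (if x = y then f x else 0) + of_nat (count_list xs x) * f x)"
    by (intro sum.cong) (auto simp: algebra_simps)
  also have "\<dots> = f y + (\<Sum>x\<in>X. of_nat (count_list xs x) * f x)"
    using assms(1) Cons.prems by (simp add: sum.distrib)
  finally show ?case using Cons by simp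
qed simp

text \<open>Counting letters turns the recursion of \<open>letter_sum\<close> into multiplication by
  the matrix, so the estimate in Jordan coordinates applies over the complex numbers.\<close>

lemma summable_letter_sum_minus_eigenvalue:
  assumes \<pi>: "\<pi> permutes {..<q}" and q: "q > 0"
    and jordan: "similar_mat_wit (subst_matrix q \<pi>) (jordan_matrix blocks) U Uinv"
    and weights: "\<forall>j<alphabet_size q. norm (jordan_matrix blocks $$ (j, j)) \<ge> 1 \<and>
          jordan_matrix blocks $$ (j, j) \<noteq> complex_of_real lc \<longrightarrow>
          weight q (Matrix.row Uinv j) = 0"
    and mult: "Polynomial.order (complex_of_real lc) (char_poly (subst_matrix q \<pi>)) =
          kernel_dim (char_matrix (subst_matrix q \<pi>) (complex_of_real lc))"
    and a: "a < alphabet_size q"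
  shows "summable (\<lambda>k. \<bar>real_of_int (letter_sum q \<pi> (Suc k) a) - lc * real_of_int (letter_sum q \<pi> k a)\<bar>)"
proof -
  let ?A = "alphabet_size q" and ?M = "subst_matrix q \<pi>"
  define x where "x k = Matrix.vec ?A (\<lambda>a. of_int (letter_sum q \<pi> k a) :: complex)" for k
  have M: "?M \<in> carrier_mat ?A ?A" unfolding subst_matrix_def by simp
  have xc: "x k \<in> carrier_vec ?A" for k unfolding x_def by simp
  have xS: "x (Suc k) = ?M *\<^sub>v x k" for k
  proof (rule eq_vecI)
    fix b assume "b < dim_vec (?M *\<^sub>v x k)"
    then have b: "b < ?A" using M by simp
    have sub: "set (doubled_subst q \<pi> b) \<subseteq> {..<?A}"
      using doubled_subst_itinerary(2)[OF \<pi> q b] by (auto simp: in_set_conv_nth)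
    have "x (Suc k) $ b = (\<Sum>c\<leftarrow>doubled_subst q \<pi> b. of_int (letter_sum q \<pi> k c))"
    proof -
      have "of_int (\<Sum>c\<leftarrow>xs. f c) = (\<Sum>c\<leftarrow>xs. of_int (f c) :: complex)" for xs and f :: "nat \<Rightarrow> int"
        by (induction xs) auto
      then show ?thesis using b unfolding x_def by simp
    qed
    also have "\<dots> = (\<Sum>c<?A. of_nat (count_list (doubled_subst q \<pi> b) c) * of_int (letter_sum q \<pi> k c))"
      by (rule sum_list_count_list[OF _ sub]) simp
    also have "\<dots> = (?M *\<^sub>v x k) $ b"
      using b M by (simp add: x_def subst_matrix_def scalar_prod_def atLeast0LessThan)
    finally show "x (Suc k) $ b = (?M *\<^sub>v x k) $ b" .
  qed (use M in \<open>auto simp: x_def\<close>)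
  have Ui: "Uinv \<in> carrier_mat ?A ?A" using jordan M unfolding similar_mat_wit_def by (auto simp: Let_def)
  \<comment> \<open>The initial vector lists the signs of the letters, so its Jordan coordinates are
    the weights of the rows of \<open>Uinv\<close>.\<close>
  have x0: "(Uinv *\<^sub>v x 0) $ j = weight q (Matrix.row Uinv j)" if "j < ?A" for j
    using that Ui by (simp add: weight_def x_def scalar_prod_def atLeast0LessThan)
  have "summable (\<lambda>k. norm (x (Suc k) $ a - complex_of_real lc * x k $ a))"
    using weights x0 by (intro summable_iterate_minus_eigenvalue[where x = x, OF jordan M xc xS _ mult a]) auto
  moreover have "norm (x (Suc k) $ a - complex_of_real lc * x k $ a)
      = \<bar>real_of_int (letter_sum q \<pi> (Suc k) a) - lc * real_of_int (letter_sum q \<pi> k a)\<bar>" for k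
  proof -
    have "x (Suc k) $ a - complex_of_real lc * x k $ a = complex_of_real
        (real_of_int (letter_sum q \<pi> (Suc k) a) - lc * real_of_int (letter_sum q \<pi> k a))"
      using a by (simp add: x_def)
    then show ?thesis by (simp only: norm_of_real)
  qed
  ultimately show ?thesis by simp
qed

section \<open>Characters of the integers\<close>

definition phase :: "real \<Rightarrow> int \<Rightarrow> complex" where
  "phase \<theta> n = cis (2 * pi * \<theta> * real_of_int n)"

lemma phase_add: "phase \<theta> (m + n) = phase \<theta> m * phase \<theta> n"
  unfolding phase_def by (simp add: cis_mult distrib_left)

lemma phase_0 [simp]: "phase \<theta> 0 = 1"
  unfolding phase_def by simp

lemma norm_phase [simp]: "norm (phase \<theta> n) = 1"
  unfolding phase_def by simp

text \<open>Phases are multiplicative and unimodular, so their distances to 1 add up.\<close>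

lemma norm_phase_sum_minus_1: "norm (phase \<theta> (\<Sum>j\<in>S. f j) - 1) \<le> (\<Sum>j\<in>S. norm (phase \<theta> (f j) - 1))"
proof (induction S rule: infinite_finite_induct)
  case (insert j S)
  have "phase \<theta> (\<Sum>j\<in>insert j S. f j) - 1
      = phase \<theta> (f j) * (phase \<theta> (\<Sum>j\<in>S. f j) - 1) + (phase \<theta> (f j) - 1)"
    using insert by (simp add: phase_add algebra_simps)
  then have "norm (phase \<theta> (\<Sum>j\<in>insert j S. f j) - 1)
      \<le> norm (phase \<theta> (\<Sum>j\<in>S. f j) - 1) + norm (phase \<theta> (f j) - 1)"
    by (metis mult_1 norm_mult norm_phase norm_triangle_ineq)
  then show ?case using insert by simp
qed simp_all

text \<open>An integer number of full turns may be removed; what remains is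
  \<open>\<bar>exp (\<i> t) - 1\<bar> \<le> \<bar>t\<bar>\<close>.\<close>

lemma norm_phase_minus_1_le: "norm (phase \<theta> n - 1) \<le> 2 * pi * \<bar>\<theta> * real_of_int n - real_of_int m\<bar>"
proof -
  let ?t = "2 * pi * (\<theta> * real_of_int n - real_of_int m)"
  have "2 * pi * \<theta> * real_of_int n = ?t + 2 * pi * real_of_int m" by (simp add: algebra_simps)
  then have "phase \<theta> n = cis ?t * cis (2 * pi * real_of_int m)"
    unfolding phase_def by (simp only: cis_mult)
  also have "cis (2 * pi * real_of_int m) = 1" by simp
  finally have "phase \<theta> n = exp (\<i> * complex_of_real ?t)" by (simp only: cis_conv_exp mult_1_right)
  then have "norm (phase \<theta> n - 1) \<le> \<bar>?t\<bar>"
    using iexp_approx1[of ?t 0] by (simp del: of_real_mult of_real_diff)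
  then show ?thesis by (simp add: abs_mult)
qed

text \<open>\<open>v (k + j) / l ^ j\<close> differs from the integer \<open>v k\<close> by a
  summable amount, so its phase is summably close to 1.\<close>

lemma summable_phase:
  fixes v :: "nat \<Rightarrow> int"
  assumes s: "summable (\<lambda>k. \<bar>real_of_int (v (Suc k)) - l * real_of_int (v k)\<bar>)" and l: "l > 0"
  shows "summable (\<lambda>k. norm (phase (1 / l ^ j) (v k) - 1))"
proof -
  \<comment> \<open>One more factor \<open>l\<close> multiplies the previous error by
    \<open>l\<close> and adds one term of \<open>s\<close>.\<close>
  have sj: "summable (\<lambda>k. \<bar>real_of_int (v (k + j)) - l ^ j * real_of_int (v k)\<bar>)"
  proof (induction j)
    case (Suc j)
    have "summable (\<lambda>k. \<bar>real_of_int (v (Suc (k + j))) - l * real_of_int (v (k + j))\<bar>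
        + l * \<bar>real_of_int (v (k + j)) - l ^ j * real_of_int (v k)\<bar>)"
      using summable_ignore_initial_segment[OF s, of j] Suc by (intro summable_add summable_mult) auto
    then show ?case
    proof (rule summable_comparison_test[rotated], intro exI allI impI)
      fix k
      have "real_of_int (v (k + Suc j)) - l ^ Suc j * real_of_int (v k)
        = (real_of_int (v (Suc (k + j))) - l * real_of_int (v (k + j)))
          + l * (real_of_int (v (k + j)) - l ^ j * real_of_int (v k))"
        by (simp add: algebra_simps)
      also have "\<bar>\<dots>\<bar> \<le> \<bar>real_of_int (v (Suc (k + j))) - l * real_of_int (v (k + j))\<bar>
        + l * \<bar>real_of_int (v (k + j)) - l ^ j * real_of_int (v k)\<bar>"
        using l by (intro order_trans[OF abs_triangle_ineq]) (simp add: abs_mult)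
      finally show "norm \<bar>real_of_int (v (k + Suc j)) - l ^ Suc j * real_of_int (v k)\<bar>
        \<le> \<bar>real_of_int (v (Suc (k + j))) - l * real_of_int (v (k + j))\<bar>
        + l * \<bar>real_of_int (v (k + j)) - l ^ j * real_of_int (v k)\<bar>" by simp
    qed
  qed simp
  have "summable (\<lambda>k. norm (phase (1 / l ^ j) (v (k + j)) - 1))"
  proof (rule summable_comparison_test, intro exI allI impI)
    show "summable (\<lambda>k. 2 * pi / l ^ j * \<bar>real_of_int (v (k + j)) - l ^ j * real_of_int (v k)\<bar>)"
      by (intro summable_mult sj)
    fix k
    have "1 / l ^ j * real_of_int (v (k + j)) - real_of_int (v k)
        = 1 / l ^ j * (real_of_int (v (k + j)) - l ^ j * real_of_int (v k))"
      using l by (simp add: field_simps)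
    then have "\<bar>1 / l ^ j * real_of_int (v (k + j)) - real_of_int (v k)\<bar>
        = 1 / l ^ j * \<bar>real_of_int (v (k + j)) - l ^ j * real_of_int (v k)\<bar>"
      using l by (simp add: abs_mult)
    then show "norm (norm (phase (1 / l ^ j) (v (k + j)) - 1))
        \<le> 2 * pi / l ^ j * \<bar>real_of_int (v (k + j)) - l ^ j * real_of_int (v k)\<bar>"
      using norm_phase_minus_1_le[of "1 / l ^ j" "v (k + j)" "v k"] by simp
  qed
  then show ?thesis by (subst (asm) summable_iff_shift)
qed

section \<open>Phases up to the first entry\<close>

definition entry_sum :: "nat \<Rightarrow> (nat \<Rightarrow> nat) \<Rightarrow> nat \<Rightarrow> real \<Rightarrow> int" where
  "entry_sum q \<pi> k x = birkhoff_sum (rot_odometer q \<pi>) skew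
    (entry_time (rot_odometer q \<pi>) (base_interval q k) x) x"

text \<open>The points for which \<open>entry_time\<close> is meaningful; elsewhere it is an
  unspecified \<open>LEAST\<close>.\<close>

definition recurrent_points :: "nat \<Rightarrow> (nat \<Rightarrow> nat) \<Rightarrow> nat \<Rightarrow> real set" where
  "recurrent_points q \<pi> k = {x \<in> {0..<1}. \<exists>n. (rot_odometer q \<pi> ^^ n) x \<in> base_interval q k}"

text \<open>A bound for all letters at once; being a finite sum, it inherits summability from the
  single letters.\<close>

definition phase_defect :: "nat \<Rightarrow> (nat \<Rightarrow> nat) \<Rightarrow> real \<Rightarrow> nat \<Rightarrow> real" where
  "phase_defect q \<pi> \<theta> k = (\<Sum>a<alphabet_size q. norm (phase \<theta> (letter_sum q \<pi> k a) - 1))"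

lemma return_phase_defect:
  assumes \<pi>: "\<pi> permutes {..<q}" and q: "q > 0" and st: "stationary q \<pi>"
    and k: "k \<ge> 1" and x: "x \<in> base_interval q k"
  shows "norm (phase \<theta> (birkhoff_sum (rot_odometer q \<pi>) skew
    (return_time (rot_odometer q \<pi>) (base_interval q k) x) x) - 1) \<le> phase_defect q \<pi> \<theta> k"
proof -
  obtain i where i: "i < q" "x \<in> sub_interval q k i" using x base_interval_eq_Union[OF q] by blast
  obtain a where a: "a < alphabet_size q" "orig_letter q a = i" using orig_letter_surj[OF i(1)] .
  show ?thesis
    using birkhoff_sum_first_return[OF \<pi> q st a(1), of x k] k i a
      member_le_sum[of a "{..<alphabet_size q}" "\<lambda>a. norm (phase \<theta> (letter_sum q \<pi> k a) - 1)"]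
    unfolding phase_defect_def by simp
qed

text \<open>After the first entry \<open>y\<close> into \<open>L\<^sub>k\<close>, at most
  \<open>q * 2 ^ expo q\<close> returns to \<open>L\<^sub>k\<close> lead to
  \<open>L\<^sub>k\<^sub>+\<^sub>1\<close>, and each changes the phase by at most
  \<open>phase_defect\<close>.\<close>

lemma entry_sum_step:
  assumes \<pi>: "\<pi> permutes {..<q}" and q: "q > 0" and st: "stationary q \<pi>"
    and k: "k \<ge> 1" and x: "x \<in> recurrent_points q \<pi> k" "x \<in> recurrent_points q \<pi> (Suc k)"
  shows "norm (phase \<theta> (entry_sum q \<pi> (Suc k) x) - phase \<theta> (entry_sum q \<pi> k x))
    \<le> real (q * 2 ^ expo q) * phase_defect q \<pi> \<theta> k"
proof -
  let ?F = "rot_odometer q \<pi>" and ?A = "base_interval q k" and ?B = "base_interval q (Suc k)"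
  let ?g = "induced_map q \<pi> k" and ?e = "entry_time ?F ?A x"
  obtain n0 where n0: "(?F ^^ n0) x \<in> ?A" using x(1) unfolding recurrent_points_def by blast
  obtain n where n: "(?F ^^ n) x \<in> ?B" using x(2) unfolding recurrent_points_def by blast
  note e = entry_time_props[of n0 ?F x ?A, OF n0]
  have BA: "?B \<subseteq> ?A" by (rule base_interval_Suc_subset)
  define y where "y = (?F ^^ ?e) x"
  have yA: "y \<in> ?A" unfolding y_def by (rule e(1))
  have "?e \<le> n" using entry_time_props(2)[of n ?F x ?A] n BA by blast
  then have "(?F ^^ (n - ?e)) y = (?F ^^ n) x"
    unfolding y_def by (metis comp_apply funpow_add le_add_diff_inverse2)
  then have yB: "(?F ^^ (n - ?e)) y \<in> ?B" using n by simp
  have shift: "entry_time ?F ?B x = ?e + entry_time ?F ?B y"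
    unfolding y_def
    by (rule entry_time_shift[of ?e ?F x ?B "n - ?e"]) (use e(3) BA yB in \<open>auto simp: y_def\<close>)
  have sum: "entry_sum q \<pi> (Suc k) x = entry_sum q \<pi> k x + entry_sum q \<pi> (Suc k) y"
    unfolding entry_sum_def shift birkhoff_sum_add y_def ..
  obtain r0 where r0: "(?g ^^ r0) y \<in> ?B"
    using hit_first_return[OF BA yA yB] unfolding induced_map_eq_return_map by blast
  let ?s = "2 ^ (k * expo q) :: real" and ?G = "rot_odometer q (level_perm q \<pi> k)"
  note it = scaled_iterate[OF level_perm_permutes[OF \<pi>] q induced_map_scaled(1)[OF \<pi> q] yA, simplified]
  have giff: "(?g ^^ m) y \<in> ?B \<longleftrightarrow> (?G ^^ m) (?s * y) \<in> base_interval q 1" for m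
    using base_interval_scale[of "(?g ^^ m) y" q k 1] it(1) by simp
  have gA: "(?g ^^ m) y \<in> ?A" for m
    using base_interval_scale[of "(?g ^^ m) y" q k 0] it[of m] by (simp add: base_interval_0)
  have "?s * y \<in> {0..<1}" using yA unfolding base_interval_iff by simp
  \<comment> \<open>After rescaling, the return map is a rotated odometer for
    \<open>level_perm\<close>, and the bound on the entry into \<open>L\<^sub>1\<close> holds for
    every permutation.\<close>
  then obtain r1 where r1: "r1 < q * 2 ^ expo q" "(?g ^^ r1) y \<in> ?B"
    using rot_odometer_entry_bound[OF level_perm_permutes[OF \<pi>] q] r0 unfolding giff by blast
  define r where "r = entry_time ?g ?B y"
  note r = entry_time_props[of r1 ?g y ?B, OF r1(2), folded r_def]
  have S: "entry_sum q \<pi> (Suc k) y =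
      (\<Sum>j<r. birkhoff_sum ?F skew (return_time ?F ?A ((?g ^^ j) y)) ((?g ^^ j) y))"
    unfolding entry_sum_def induced_map_eq_return_map
    by (rule entry_time_first_return(2)[OF _ BA yA])
      (use induced_map_scaled(2)[OF \<pi> q] r in \<open>auto simp: induced_map_eq_return_map\<close>)
  have "norm (phase \<theta> (entry_sum q \<pi> (Suc k) y) - 1) \<le> (\<Sum>j<r. phase_defect q \<pi> \<theta> k)"
    unfolding S by (intro order_trans[OF norm_phase_sum_minus_1] sum_mono return_phase_defect[OF \<pi> q st k] gA)
  also have "\<dots> \<le> real (q * 2 ^ expo q) * phase_defect q \<pi> \<theta> k"
  proof -
    have "0 \<le> phase_defect q \<pi> \<theta> k" unfolding phase_defect_def by (intro sum_nonneg) simp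
    moreover have "real r \<le> real (q * 2 ^ expo q)" using r(2) r1(1) unfolding of_nat_le_iff by simp
    ultimately show ?thesis using mult_right_mono by simp
  qed
  finally have "norm (phase \<theta> (entry_sum q \<pi> (Suc k) y) - 1) \<le> real (q * 2 ^ expo q) * phase_defect q \<pi> \<theta> k" .
  moreover have "phase \<theta> (entry_sum q \<pi> (Suc k) x) - phase \<theta> (entry_sum q \<pi> k x)
      = phase \<theta> (entry_sum q \<pi> k x) * (phase \<theta> (entry_sum q \<pi> (Suc k) y) - 1)"
    unfolding sum phase_add by (simp add: algebra_simps)
  ultimately show ?thesis by (simp add: norm_mult)
qed

text \<open>Off \<open>L\<^sub>k\<close> the two entry sums match exactly. On
  \<open>L\<^sub>k\<close> the entry sum of \<open>x\<close> is 0, while the other term is the sum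
  over a full return, whose phase is nearly 1.\<close>

lemma entry_sum_equivariant:
  assumes \<pi>: "\<pi> permutes {..<q}" and q: "q > 0" and st: "stationary q \<pi>"
    and k: "k \<ge> 1" and x: "x \<in> recurrent_points q \<pi> k"
  shows "norm (phase \<theta> (skew x + entry_sum q \<pi> k (rot_odometer q \<pi> x)) - phase \<theta> (entry_sum q \<pi> k x))
    \<le> phase_defect q \<pi> \<theta> k"
proof -
  let ?F = "rot_odometer q \<pi>" and ?A = "base_interval q k"
  have S1: "birkhoff_sum ?F skew (Suc n) x = skew x + birkhoff_sum ?F skew n (?F x)" for n
    using birkhoff_sum_add[of ?F skew 1 n x] by (simp add: birkhoff_sum_def)
  show ?thesis
  proof (cases "x \<in> ?A")
    case True
    then have "entry_time ?F ?A x = 0" by (intro entry_time_eqI) auto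
    then have e: "entry_sum q \<pi> k x = 0" unfolding entry_sum_def birkhoff_sum_def by simp
    obtain n where "n \<ge> 1" "(?F ^^ n) x \<in> ?A" using induced_map_scaled(2)[OF \<pi> q True] by blast
    then have "(?F ^^ (n - 1)) (?F x) \<in> ?A" by (cases n) (auto simp: funpow_swap1)
    from return_time_entry_time[OF this]
    have "birkhoff_sum ?F skew (return_time ?F ?A x) x = skew x + entry_sum q \<pi> k (?F x)"
      unfolding entry_sum_def by (simp add: S1)
    then show ?thesis using return_phase_defect[OF \<pi> q st k True, of \<theta>] by (simp add: e)
  next
    case False
    obtain n where n: "(?F ^^ n) x \<in> ?A" using x unfolding recurrent_points_def by blast
    then have "n \<noteq> 0" using False by (intro notI) simp
    then have "(?F ^^ (n - 1)) ((?F ^^ 1) x) \<in> ?A" using n by (cases n) (auto simp: funpow_swap1)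
    then have "entry_time ?F ?A x = 1 + entry_time ?F ?A ((?F ^^ 1) x)"
      by (intro entry_time_shift) (use False in auto)
    then have "entry_sum q \<pi> k x = skew x + entry_sum q \<pi> k (?F x)"
      unfolding entry_sum_def by (simp add: S1)
    then show ?thesis unfolding phase_defect_def by (simp add: sum_nonneg)
  qed
qed

lemma entry_phase_limit:
  assumes \<pi>: "\<pi> permutes {..<q}" and q: "q > 0" and st: "stationary q \<pi>"
    and sum: "summable (phase_defect q \<pi> \<theta>)"
    and x: "\<And>k. x \<in> recurrent_points q \<pi> k"
  shows "(\<lambda>k. phase \<theta> (entry_sum q \<pi> k x)) \<longlonglongrightarrow> lim (\<lambda>k. phase \<theta> (entry_sum q \<pi> k x))"
proof -
  let ?f = "\<lambda>k. phase \<theta> (entry_sum q \<pi> k x)"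
  have "summable (\<lambda>k. ?f (Suc k) - ?f k)"
  proof (rule summable_comparison_test, intro exI allI impI)
    show "summable (\<lambda>k. real (q * 2 ^ expo q) * phase_defect q \<pi> \<theta> k)" using sum by (rule summable_mult)
    fix k :: nat assume "k \<ge> 1"
    then show "norm (?f (Suc k) - ?f k) \<le> real (q * 2 ^ expo q) * phase_defect q \<pi> \<theta> k"
      using entry_sum_step[OF \<pi> q st _ x x] by simp
  qed
  then have "(\<lambda>n. \<Sum>k<n. ?f (Suc k) - ?f k) \<longlonglongrightarrow> (\<Sum>k. ?f (Suc k) - ?f k)"
    by (rule summable_LIMSEQ)
  then have "(\<lambda>n. (?f n - ?f 0) + ?f 0) \<longlonglongrightarrow> (\<Sum>k. ?f (Suc k) - ?f k) + ?f 0"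
    unfolding sum_lessThan_telescope[of ?f] by (intro tendsto_add tendsto_const)
  then have "convergent ?f" unfolding convergent_def by auto
  then show ?thesis by (simp add: convergent_LIMSEQ_iff)
qed

section \<open>Ergodic components of the extension\<close>

text \<open>An ergodic measure that charges one invariant set gives measure 0 to all sets disjoint
  from it. More disjoint sets than elements of \<open>C\<close> would thus need more members of
  \<open>C\<close> than there are. The families for different \<open>N\<close> may be
  unrelated.\<close>

lemma infinitely_many_componentsI:
  assumes dec: "ergodic_decomposition M T P \<kappa>"
    and inv: "\<And>N :: nat. \<exists>A :: nat \<Rightarrow> 'a set. disjoint_family_on A {..<N} \<and>
      (\<forall>i<N. A i \<in> sets M \<and> T -` A i \<inter> space M = A i \<and> emeasure M (A i) \<noteq> 0)"
  shows "infinitely_many_components P \<kappa>"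
  unfolding infinitely_many_components_def
proof (rule notI, elim exE conjE)
  fix C assume C: "finite C"
    and scaled: "AE y in P. \<exists>\<nu>\<in>C. \<exists>c. 0 < c \<and> c < \<infinity> \<and> \<kappa> y = scale_measure c \<nu>"
  have sets_\<kappa>: "\<forall>y\<in>space P. sets (\<kappa> y) = sets M"
    and erg: "AE y in P. ergodic_measure (\<kappa> y) T"
    and meas: "\<And>A. A \<in> sets M \<Longrightarrow> (\<lambda>y. emeasure (\<kappa> y) A) \<in> borel_measurable P"
    and int: "\<And>A. A \<in> sets M \<Longrightarrow> emeasure M A = (\<integral>\<^sup>+ y. emeasure (\<kappa> y) A \<partial>P)"
    using dec unfolding ergodic_decomposition_def by auto
  define N where "N = Suc (card C)"
  obtain A where disj: "disjoint_family_on A {..<N}"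
    and A: "\<And>i. i < N \<Longrightarrow> A i \<in> sets M" "\<And>i. i < N \<Longrightarrow> T -` A i \<inter> space M = A i"
      "\<And>i. i < N \<Longrightarrow> emeasure M (A i) \<noteq> 0"
    using inv[of N] by blast
  have "\<exists>\<nu>\<in>C. emeasure \<nu> (A i) \<noteq> 0 \<and> (\<forall>j<N. j \<noteq> i \<longrightarrow> emeasure \<nu> (A j) = 0)" if i: "i < N" for i
  proof -
    \<comment> \<open>The integral of \<open>emeasure (\<kappa> y) (A i)\<close> is nonzero, so some
      \<open>y\<close> charges \<open>A i\<close> and also has the properties that hold almost
      everywhere.\<close>
    have "\<not> (AE y in P. emeasure (\<kappa> y) (A i) = 0)"
      using A(3)[OF i] int[OF A(1)[OF i]] nn_integral_0_iff_AE[OF meas[OF A(1)[OF i]]] by simp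
    then have "\<exists>y\<in>space P. ergodic_measure (\<kappa> y) T \<and>
        (\<exists>\<nu>\<in>C. \<exists>c. 0 < c \<and> c < \<infinity> \<and> \<kappa> y = scale_measure c \<nu>) \<and> emeasure (\<kappa> y) (A i) \<noteq> 0"
    proof (rule contrapos_np)
      assume ne: "\<not> (\<exists>y\<in>space P. ergodic_measure (\<kappa> y) T \<and>
        (\<exists>\<nu>\<in>C. \<exists>c. 0 < c \<and> c < \<infinity> \<and> \<kappa> y = scale_measure c \<nu>) \<and> emeasure (\<kappa> y) (A i) \<noteq> 0)"
      show "AE y in P. emeasure (\<kappa> y) (A i) = 0"
        using erg scaled AE_space[of P] by eventually_elim (use ne in blast)
    qed
    then obtain y \<nu> c where y: "y \<in> space P" "ergodic_measure (\<kappa> y) T" "emeasure (\<kappa> y) (A i) \<noteq> 0"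
      and \<nu>: "\<nu> \<in> C" "0 < c" "\<kappa> y = scale_measure c \<nu>" by blast
    have s: "sets (\<kappa> y) = sets M" "space (\<kappa> y) = space M"
      using sets_\<kappa> y(1) sets_eq_imp_space_eq by blast+
    have null: "emeasure (\<kappa> y) (space M - A i) = 0"
      using y(2,3) A(1,2)[OF i] s unfolding ergodic_measure_def by auto
    have "emeasure (\<kappa> y) (A j) = 0" if "j < N" "j \<noteq> i" for j
    proof -
      have "A j \<subseteq> space M - A i"
        using disj sets.sets_into_space[OF A(1)[OF that(1)]] that i
        unfolding disjoint_family_on_def by blast
      moreover have "space M - A i \<in> sets (\<kappa> y)" using A(1)[OF i] s by auto
      ultimately have "emeasure (\<kappa> y) (A j) \<le> emeasure (\<kappa> y) (space M - A i)" by (rule emeasure_mono)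
      then show ?thesis using null by simp
    qed
    then show ?thesis using \<nu> y(3) by auto
  qed
  then obtain \<nu> where \<nu>: "\<And>i. i < N \<Longrightarrow> \<nu> i \<in> C" "\<And>i. i < N \<Longrightarrow> emeasure (\<nu> i) (A i) \<noteq> 0"
    "\<And>i j. i < N \<Longrightarrow> j < N \<Longrightarrow> j \<noteq> i \<Longrightarrow> emeasure (\<nu> i) (A j) = 0"
    by metis
  have "inj_on \<nu> {..<N}"
    by (rule inj_onI) (metis \<nu>(2,3) lessThan_iff)
  then have "card {..<N} \<le> card C" using \<nu>(1) C by (intro card_inj_on_le) auto
  then show False unfolding N_def by simp
qed

section \<open>Measurability and recurrence\<close>

lemma space_leb_I [simp]: "space leb_I = {0..<1}"
  unfolding leb_I_def by (simp add: space_restrict_space)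

lemma borel_measurable_leb_I: "f \<in> borel_measurable borel \<Longrightarrow> f \<in> borel_measurable leb_I"
  unfolding leb_I_def by (intro measurable_restrict_space1) simp

lemma sets_leb_I_Collect: "A \<in> sets borel \<Longrightarrow> A \<subseteq> {0..<1} \<Longrightarrow> A \<in> sets leb_I"
  unfolding leb_I_def by (auto simp: sets_restrict_space)

lemma emeasure_leb_I: "A \<in> sets leb_I \<Longrightarrow> emeasure leb_I A = emeasure lborel A"
  unfolding leb_I_def by (auto simp: emeasure_restrict_space sets_restrict_space)

lemma prob_space_leb_I: "prob_space leb_I"
proof
  show "emeasure leb_I (space leb_I) = 1" by (simp add: emeasure_leb_I sets_leb_I_Collect)
qed

lemma rotation_unit:
  assumes \<pi>: "\<pi> permutes {..<q}" and q: "q > 0" and x: "x \<in> {0..<1}"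
  shows "rotation q \<pi> x \<in> {0..<1}"
proof -
  define j where "j = nat \<lfloor>real q * x\<rfloor>"
  have "0 \<le> real q * x" using x by simp
  then have j: "real j \<le> real q * x" "real q * x < real j + 1" unfolding j_def by (auto simp: of_nat_nat)
  have "real q * x < real q * 1" using x q by (intro mult_strict_left_mono) auto
  then have "real j < real q" using j by linarith
  then have "\<pi> j < q" using permutes_in_image[OF \<pi>, of j] by simp
  then have "real (\<pi> j) + 1 \<le> real q" by simp
  moreover have "real q * rotation q \<pi> x = real q * x + real (\<pi> j) - real j"
    unfolding rotation_def j_def[symmetric] Let_def using q by (simp add: distrib_left)
  ultimately have "real q * 0 \<le> real q * rotation q \<pi> x" "real q * rotation q \<pi> x < real q * 1"
    using j by auto
  then show ?thesis
    using q by (simp only: mult_less_cancel_left_pos mult_le_cancel_left_pos of_nat_0_less_iff) simp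
qed

text \<open>Replaces the definite description by a \<open>LEAST\<close>, to which
  \<open>measurable_Least\<close> applies.\<close>

lemma vn_kakutani_Least:
  assumes "0 \<le> x" "x < 1"
  shows "vn_kakutani x = x - (1 - 3 / 2 ^ (LEAST n. x < 1 - 1 / 2 ^ n))"
proof -
  obtain n where n: "1 \<le> n" "1 - 2 / 2 ^ n \<le> x" "x < 1 - 1 / 2 ^ n"
    using vn_kakutani_block assms by blast
  have "(LEAST n. x < 1 - 1 / 2 ^ n) = n"
  proof (rule Least_equality)
    show "x < 1 - 1 / 2 ^ n" by (rule n(3))
    fix m assume "x < 1 - 1 / 2 ^ m"
    then show "n \<le> m" using two_div_power_le[of m n] n(2) by (cases "n \<le> m") auto
  qed
  then show ?thesis using vn_kakutani_eq[OF n] by simp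
qed

lemma measurable_rot_odometer:
  assumes \<pi>: "\<pi> permutes {..<q}" and q: "q > 0"
  shows "rot_odometer q \<pi> \<in> measurable leb_I leb_I"
proof -
  define v where "v x = x - (1 - 3 / 2 ^ (LEAST n. x < 1 - 1 / 2 ^ n))" for x :: real
  have [measurable]: "v \<in> borel_measurable borel"
  proof -
    have L: "(\<lambda>x::real. LEAST n. x < 1 - 1 / 2 ^ n) \<in> measurable borel (count_space UNIV)"
      by (rule measurable_Least) measurable
    have "(\<lambda>x. (3 :: real) / 2 ^ (LEAST n. x < 1 - 1 / 2 ^ n)) \<in> borel_measurable (borel :: real measure)"
      by (rule measurable_compose[OF L]) simp
    then show ?thesis unfolding v_def by measurable
  qed
  have [measurable]: "rotation q \<pi> \<in> borel_measurable borel"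
  proof -
    have "(\<lambda>x. \<lfloor>real q * x\<rfloor>) \<in> measurable borel (count_space UNIV)" by measurable
    from measurable_compose[OF this, of "\<lambda>i. (real (\<pi> (nat i)) - real (nat i)) / real q" borel]
    have "(\<lambda>x. (real (\<pi> (nat \<lfloor>real q * x\<rfloor>)) - real (nat \<lfloor>real q * x\<rfloor>)) / real q) \<in> borel_measurable borel"
      by simp
    then show ?thesis unfolding rotation_def Let_def by measurable
  qed
  have "(\<lambda>x. v (rotation q \<pi> x)) \<in> borel_measurable leb_I"
    by (rule borel_measurable_leb_I) measurable
  moreover have "rot_odometer q \<pi> x = v (rotation q \<pi> x)" if "x \<in> space leb_I" for x
    using rotation_unit[OF \<pi> q, of x] that unfolding rot_odometer_def v_def
    by (simp add: vn_kakutani_Least)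
  ultimately have "rot_odometer q \<pi> \<in> borel_measurable leb_I"
    by (subst measurable_cong[where g = "\<lambda>x. v (rotation q \<pi> x)"]) auto
  then have "rot_odometer q \<pi> \<in> measurable leb_I (restrict_space borel {0..<1})"
    using rot_odometer_unit[OF \<pi> q] by (intro measurable_restrict_space2) auto
  moreover have "sets (restrict_space borel {0..<1}) = sets leb_I"
    unfolding leb_I_def by (simp add: sets_restrict_space)
  ultimately show ?thesis using measurable_cong_sets by blast
qed

lemma measurable_rot_odometer_funpow:
  assumes "\<pi> permutes {..<q}" "q > 0"
  shows "rot_odometer q \<pi> ^^ n \<in> measurable leb_I leb_I"
  by (induction n) (use measurable_rot_odometer[OF assms] in \<open>auto intro: measurable_comp simp: id_def\<close>)

lemma pred_funpow_base_interval:
  assumes "\<pi> permutes {..<q}" "q > 0"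
  shows "Measurable.pred leb_I (\<lambda>x. (rot_odometer q \<pi> ^^ n) x \<in> base_interval q k)"
proof -
  have "(rot_odometer q \<pi> ^^ n) -` base_interval q k \<inter> space leb_I \<in> sets leb_I"
    using measurable_rot_odometer_funpow[OF assms]
  proof (rule measurable_sets)
    have "base_interval q k \<subseteq> {0..<1}"
      unfolding base_interval_def by (auto elim!: less_le_trans)
    then show "base_interval q k \<in> sets leb_I" by (intro sets_leb_I_Collect) (simp_all add: base_interval_def)
  qed
  then show ?thesis unfolding pred_def by (simp add: vimage_def Int_def conj_commute)
qed

lemma sets_recurrent_points:
  assumes "\<pi> permutes {..<q}" "q > 0"
  shows "recurrent_points q \<pi> k \<in> sets leb_I"
proof -
  note [measurable] = pred_funpow_base_interval[OF assms]
  have "{x \<in> space leb_I. \<exists>n. (rot_odometer q \<pi> ^^ n) x \<in> base_interval q k} \<in> sets leb_I"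
    by measurable
  then show ?thesis unfolding recurrent_points_def by simp
qed

text \<open>The entry time takes countably many values, and for each fixed number of steps the phase
  of the Birkhoff sum is measurable.\<close>

lemma measurable_entry_phase:
  assumes \<pi>: "\<pi> permutes {..<q}" and q: "q > 0"
  shows "(\<lambda>x. phase \<theta> (entry_sum q \<pi> k x)) \<in> borel_measurable leb_I"
proof -
  note [measurable] = pred_funpow_base_interval[OF assms]
  have entry: "(\<lambda>x. entry_time (rot_odometer q \<pi>) (base_interval q k) x) \<in> measurable leb_I (count_space UNIV)"
    unfolding entry_time_def by (rule measurable_Least) measurable
  have sk: "(\<lambda>x. real_of_int (skew x)) \<in> borel_measurable leb_I"
    by (rule borel_measurable_leb_I) (simp add: skew_def if_distrib)
  have "(\<lambda>x. phase \<theta> (birkhoff_sum (rot_odometer q \<pi>) skew n x)) \<in> borel_measurable leb_I" for n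
  proof -
    have "(\<lambda>x. \<Sum>j<n. real_of_int (skew ((rot_odometer q \<pi> ^^ j) x))) \<in> borel_measurable leb_I"
      by (intro borel_measurable_sum measurable_compose[OF measurable_rot_odometer_funpow[OF assms] sk])
    moreover have "(\<lambda>t. cis (2 * pi * \<theta> * t)) \<in> borel_measurable borel"
      by (intro borel_measurable_continuous_onI continuous_intros)
    ultimately have "(\<lambda>x. cis (2 * pi * \<theta> * (\<Sum>j<n. real_of_int (skew ((rot_odometer q \<pi> ^^ j) x)))))
        \<in> borel_measurable leb_I"
      by (rule measurable_compose)
    then show ?thesis unfolding phase_def birkhoff_sum_def by simp
  qed
  from measurable_compose_countable[OF this entry] show ?thesis unfolding entry_sum_def .
qed

text \<open>The orbit of the image omits time 0, so a point of \<open>L\<^sub>k\<close> needs a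
  later visit; recurrence to \<open>L\<^sub>k\<close> provides it.\<close>

lemma recurrent_points_invariant:
  assumes \<pi>: "\<pi> permutes {..<q}" and q: "q > 0" and x: "x \<in> {0..<1}"
  shows "rot_odometer q \<pi> x \<in> recurrent_points q \<pi> k \<longleftrightarrow> x \<in> recurrent_points q \<pi> k"
proof -
  let ?F = "rot_odometer q \<pi>"
  have "\<exists>n. (?F ^^ n) (?F x) \<in> base_interval q k" if "(?F ^^ n) x \<in> base_interval q k" for n
  proof -
    have "\<exists>n\<ge>1. (?F ^^ n) x \<in> base_interval q k"
      using that induced_map_scaled(2)[OF \<pi> q, of x k] by (cases n) auto
    then obtain n where "n \<ge> 1" "(?F ^^ n) x \<in> base_interval q k" by blast
    then have "(?F ^^ (n - 1)) (?F x) \<in> base_interval q k" by (cases n) (auto simp: funpow_swap1)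
    then show ?thesis by blast
  qed
  moreover have "\<exists>n. (?F ^^ n) x \<in> base_interval q k" if "(?F ^^ n) (?F x) \<in> base_interval q k" for n
    using that by (intro exI[of _ "Suc n"]) (simp add: funpow_swap1)
  ultimately show ?thesis
    using rot_odometer_unit[OF \<pi> q x] x unfolding recurrent_points_def by auto
qed

text \<open>The set is invariant and contains \<open>L\<^sub>k\<close>, which has positive measure,
  so ergodicity makes the complement null.\<close>

lemma recurrent_points_full:
  assumes \<pi>: "\<pi> permutes {..<q}" and q: "q > 0"
    and erg: "ergodic_measure leb_I (rot_odometer q \<pi>)"
  shows "{0..<1} - recurrent_points q \<pi> k \<in> null_sets leb_I"
proof -
  let ?R = "recurrent_points q \<pi> k"
  have R: "?R \<in> sets leb_I" by (rule sets_recurrent_points[OF \<pi> q])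
  have RI: "?R \<subseteq> {0..<1}" unfolding recurrent_points_def by blast
  have "rot_odometer q \<pi> -` ?R \<inter> space leb_I = ?R"
    using recurrent_points_invariant[OF \<pi> q] RI by auto
  then have "emeasure leb_I ?R = 0 \<or> emeasure leb_I (space leb_I - ?R) = 0"
    using erg R unfolding ergodic_measure_def by blast
  moreover have "emeasure leb_I ?R \<noteq> 0"
  proof -
    have sub: "base_interval q k \<subseteq> ?R"
    proof
      fix x assume x: "x \<in> base_interval q k"
      then have "0 \<le> x" "x < 1 / 2 ^ (k * expo q)" unfolding base_interval_def by auto
      moreover have "1 / 2 ^ (k * expo q) \<le> (1 :: real)" by simp
      ultimately have "x < 1" by linarith
      then have "x \<in> {0..<1}" using \<open>0 \<le> x\<close> by simp
      moreover have "(rot_odometer q \<pi> ^^ 0) x \<in> base_interval q k" using x by simp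
      ultimately show "x \<in> ?R" unfolding recurrent_points_def by blast
    qed
    have "base_interval q k \<in> sets leb_I"
      using sub RI by (intro sets_leb_I_Collect) (auto simp: base_interval_def)
    then have "emeasure leb_I (base_interval q k) = ennreal (1 / 2 ^ (k * expo q))"
      by (simp add: emeasure_leb_I base_interval_def)
    moreover have "ennreal (1 / 2 ^ (k * expo q)) > 0" by simp
    ultimately show ?thesis using emeasure_mono[OF sub R] by (metis not_le)
  qed
  ultimately show ?thesis using sets.compl_sets[OF R] by (simp add: null_sets_def)
qed

section \<open>Disjoint invariant sets\<close>

lemma phase_neq_1:
  assumes "0 < \<theta> * real_of_int d" "\<theta> * real_of_int d < 1"
  shows "phase \<theta> d \<noteq> 1"
proof
  assume "phase \<theta> d = 1"
  then have "cos (2 * pi * \<theta> * real_of_int d) = 1"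
    unfolding phase_def by (metis Re_complex_of_real cis.sel(1) of_real_1)
  then obtain n :: int where "2 * pi * \<theta> * real_of_int d = real_of_int n * 2 * pi"
    unfolding cos_one_2pi_int by blast
  then have "2 * pi * (\<theta> * real_of_int d) = 2 * pi * real_of_int n" by (simp add: ac_simps)
  then have "\<theta> * real_of_int d = real_of_int n" by simp
  then have "0 < n" "n < 1" using assms by simp_all
  then show False by simp
qed

lemma sets_ball_preimage:
  fixes f :: "'a \<Rightarrow> complex"
  assumes [measurable]: "f \<in> borel_measurable M" and G: "G \<in> sets M"
  shows "{x \<in> G. norm (f x - z) < \<epsilon>} \<in> sets M"
proof -
  have "{x \<in> space M. norm (f x - z) < \<epsilon>} \<in> sets M" by measurable
  then have "G \<inter> {x \<in> space M. norm (f x - z) < \<epsilon>} \<in> sets M" using G by blast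
  moreover have "G \<inter> {x \<in> space M. norm (f x - z) < \<epsilon>} = {x \<in> G. norm (f x - z) < \<epsilon>}"
    using sets.sets_into_space[OF G] by blast
  ultimately show ?thesis by simp
qed

text \<open>Countably many balls of radius \<open>\<epsilon>\<close>, centred at a dense set, cover
  the plane; not all of their preimages can be null.\<close>

lemma ex_ball_preimage_nonnull:
  fixes f :: "'a \<Rightarrow> complex"
  assumes f: "f \<in> borel_measurable M" and G: "G \<in> sets M" "emeasure M G \<noteq> 0" and e: "\<epsilon> > 0"
  obtains z where "emeasure M {x \<in> G. norm (f x - z) < \<epsilon>} \<noteq> 0"
proof (rule ccontr)
  assume "\<not> thesis"
  then have null: "emeasure M {x \<in> G. norm (f x - z) < \<epsilon>} = 0" for z using that by blast
  obtain D :: "complex set" where D: "countable D" "\<And>X. open X \<Longrightarrow> X \<noteq> {} \<Longrightarrow> \<exists>d\<in>D. d \<in> X"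
    using countable_dense_setE by blast
  have "(\<Union>z\<in>D. {x \<in> G. norm (f x - z) < \<epsilon>}) \<in> null_sets M"
    using D(1) null sets_ball_preimage[OF f G(1)] by (intro null_sets_UN') auto
  moreover have "G \<subseteq> (\<Union>z\<in>D. {x \<in> G. norm (f x - z) < \<epsilon>})"
  proof
    fix x assume "x \<in> G"
    moreover have "\<exists>d\<in>D. d \<in> ball (f x) \<epsilon>" using D(2)[of "ball (f x) \<epsilon>"] e by auto
    ultimately show "x \<in> (\<Union>z\<in>D. {x \<in> G. norm (f x - z) < \<epsilon>})" by (auto simp: dist_norm)
  qed
  ultimately have "G \<in> null_sets M" using G(1) null_sets_subset by blast
  then show False using G(2) by auto
qed

text \<open>The function \<open>E x * phase \<theta> n\<close> is invariant, and \<open>A i\<close>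
  consists of the points where, turned back by \<open>i\<close> steps of the rotation, it is close
  to a fixed \<open>z\<close>. The angles \<open>\<theta> * i\<close> with \<open>i < N\<close> fit
  into less than one full turn, so these conditions exclude each other.\<close>

lemma disjoint_invariant_sets:
  fixes N :: nat
  assumes \<pi>: "\<pi> permutes {..<q}" and q: "q > 0"
    and G: "G \<in> sets leb_I" "emeasure leb_I G \<noteq> 0"
      "\<And>x. x \<in> {0..<1} \<Longrightarrow> rot_odometer q \<pi> x \<in> G \<longleftrightarrow> x \<in> G"
    and E: "E \<in> borel_measurable leb_I" "\<And>x. x \<in> G \<Longrightarrow> norm (E x) = 1"
      "\<And>x. x \<in> G \<Longrightarrow> phase \<theta> (skew x) * E (rot_odometer q \<pi> x) = E x"
    and \<theta>: "\<theta> > 0" "\<theta> * N < 1"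
  defines "M \<equiv> leb_I \<Otimes>\<^sub>M count_space (UNIV :: int set)"
  shows "\<exists>A. disjoint_family_on A {..<N} \<and> (\<forall>i<N. A i \<in> sets M \<and>
    Z_extension q \<pi> -` A i \<inter> space M = A i \<and> emeasure M (A i) \<noteq> 0)"
proof -
  \<comment> \<open>The least distance from 1 of the relevant phases. Inserting 1 covers the case
    where there is no \<open>d\<close> to consider.\<close>
  define \<delta> where "\<delta> = Min (insert 1 ((\<lambda>d. norm (phase \<theta> (int d) - 1)) ` {1..<N}))"
  have \<delta>_le: "\<delta> \<le> norm (phase \<theta> (int d) - 1)" if "1 \<le> d" "d < N" for d
    unfolding \<delta>_def using that by (intro Min_le) auto
  have "\<delta> > 0"
  proof -
    have "phase \<theta> (int d) \<noteq> 1" if d: "d \<in> {1..<N}" for d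
    proof (rule phase_neq_1)
      show "0 < \<theta> * real_of_int (int d)" using d \<theta>(1) by simp
      have "\<theta> * real d \<le> \<theta> * real N" using d \<theta>(1) by (intro mult_left_mono) auto
      then show "\<theta> * real_of_int (int d) < 1" using \<theta>(2) by simp
    qed
    then show ?thesis unfolding \<delta>_def by auto
  qed
  then obtain z where z: "emeasure leb_I {x \<in> G. norm (E x - z) < \<delta> / 2} \<noteq> 0"
    using ex_ball_preimage_nonnull[OF E(1) G(1,2), of "\<delta> / 2"] by auto
  define A where "A i = {p \<in> space M. fst p \<in> G \<and>
    norm (E (fst p) * phase \<theta> (snd p - int i) - z) < \<delta> / 2}" for i :: nat
  have GI: "G \<subseteq> {0..<1}" using sets.sets_into_space[OF G(1)] by simp
  have space_M: "space M = {0..<1} \<times> UNIV" unfolding M_def by (simp add: space_pair_measure)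
  have meas: "A i \<in> sets M" for i
  proof -
    have [measurable]: "(\<lambda>p. E (fst p)) \<in> borel_measurable M"
      unfolding M_def by (rule measurable_compose[OF measurable_fst E(1)])
    have [measurable]: "(\<lambda>p. phase \<theta> (snd p - int i)) \<in> borel_measurable M"
      unfolding M_def by (rule measurable_compose[OF measurable_snd]) simp
    have G': "fst -` G \<inter> space M \<in> sets M"
      unfolding M_def by (rule measurable_sets[OF measurable_fst G(1)])
    have "(\<lambda>p. E (fst p) * phase \<theta> (snd p - int i)) \<in> borel_measurable M" by measurable
    from sets_ball_preimage[OF this G']
    have "{p \<in> fst -` G \<inter> space M. norm (E (fst p) * phase \<theta> (snd p - int i) - z) < \<delta> / 2} \<in> sets M" .
    then show ?thesis unfolding A_def by (simp add: conj_commute conj_left_commute)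
  qed
  have inv: "Z_extension q \<pi> -` A i \<inter> space M = A i" for i
  proof -
    have "Z_extension q \<pi> p \<in> A i \<longleftrightarrow> p \<in> A i" if "p \<in> space M" for p
    proof -
      obtain x n where p: "p = (x, n)" by (cases p)
      have x: "x \<in> {0..<1}" using that unfolding p space_M by simp
      have "E (rot_odometer q \<pi> x) * phase \<theta> (n + skew x - int i) = E x * phase \<theta> (n - int i)" if "x \<in> G"
      proof -
        have "n + skew x - int i = skew x + (n - int i)" by simp
        then have "phase \<theta> (n + skew x - int i) = phase \<theta> (skew x) * phase \<theta> (n - int i)"
          by (simp only: phase_add)
        then show ?thesis using E(3)[OF that] by (simp add: ac_simps)
      qed
      then show ?thesis
        using G(3)[OF x] rot_odometer_unit[OF \<pi> q x] x
        unfolding A_def p Z_extension_def space_M by auto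
    qed
    moreover have "A i \<subseteq> space M" unfolding A_def by blast
    ultimately show ?thesis by blast
  qed
  have pos: "emeasure M (A i) \<noteq> 0" for i
  proof -
    let ?S = "{x \<in> G. norm (E x - z) < \<delta> / 2}"
    interpret C: sigma_finite_measure "count_space (UNIV :: int set)"
      by (rule sigma_finite_measure_count_space)
    have S: "?S \<in> sets leb_I" by (rule sets_ball_preimage[OF E(1) G(1)])
    have "emeasure M (?S \<times> {int i}) = emeasure leb_I ?S * emeasure (count_space UNIV) {int i}"
      unfolding M_def using S by (intro C.emeasure_pair_measure_Times) auto
    then have "emeasure M (?S \<times> {int i}) \<noteq> 0" using z by simp
    \<comment> \<open>On the fibre over \<open>i\<close> the factor
      \<open>phase \<theta> (n - int i)\<close> is 1.\<close>
    moreover have "?S \<times> {int i} \<subseteq> A i" unfolding A_def space_M using GI by auto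
    ultimately show ?thesis using emeasure_mono[OF _ meas[of i]] by (metis le_zero_eq)
  qed
  have disj: "A i \<inter> A j = {}" if "i < j" "j < N" for i j
  proof (rule ccontr)
    assume "A i \<inter> A j \<noteq> {}"
    then obtain x n where x: "x \<in> G" "norm (E x * phase \<theta> (n - int i) - z) < \<delta> / 2"
      "norm (E x * phase \<theta> (n - int j) - z) < \<delta> / 2"
      unfolding A_def by auto
    have "n - int i = (n - int j) + int (j - i)" using that by simp
    then have "phase \<theta> (n - int i) = phase \<theta> (n - int j) * phase \<theta> (int (j - i))"
      by (simp only: phase_add)
    then have "(E x * phase \<theta> (n - int i) - z) - (E x * phase \<theta> (n - int j) - z)
        = E x * phase \<theta> (n - int j) * (phase \<theta> (int (j - i)) - 1)"
      by (simp add: algebra_simps)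
    then have "norm (phase \<theta> (int (j - i)) - 1)
        = norm ((E x * phase \<theta> (n - int i) - z) - (E x * phase \<theta> (n - int j) - z))"
      using E(2)[OF x(1)] by (simp add: norm_mult)
    also have "\<dots> < \<delta>" using norm_triangle_ineq4 x(2,3) by (smt (verit) field_sum_of_halves)
    finally have "norm (phase \<theta> (int (j - i)) - 1) < \<delta>" .
    moreover have "1 \<le> j - i" "j - i < N" using that by simp_all
    ultimately show False using \<delta>_le[of "j - i"] by linarith
  qed
  have "disjoint_family_on A {..<N}"
    unfolding disjoint_family_on_def
  proof (intro ballI impI)
    fix i j assume "i \<in> {..<N}" "j \<in> {..<N}" "i \<noteq> j"
    then show "A i \<inter> A j = {}" using disj[of i j] disj[of j i] by (cases "i < j") auto
  qed
  then show ?thesis using meas inv pos by blast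
qed

theorem theorem1p10:
  fixes q :: nat and \<pi> :: "nat \<Rightarrow> nat" and lc :: real
    and U Uinv :: "complex mat" and blocks :: "(nat \<times> complex) list"
  assumes q_pos: "q > 0"
    and q_not_pow2: "\<not> (\<exists>n::nat. q = 2 ^ n)"
    and perm: "\<pi> permutes {..<q}"
    and stat: "stationary q \<pi>"
    and erg: "ergodic_measure leb_I (rot_odometer q \<pi>)"
    and jordan: "similar_mat_wit (subst_matrix q \<pi>) (jordan_matrix blocks) U Uinv"
    and weights: "\<forall>j<alphabet_size q. norm (jordan_matrix blocks $$ (j, j)) \<ge> 1 \<and>
          jordan_matrix blocks $$ (j, j) \<noteq> complex_of_real lc \<longrightarrow>
          weight q (Matrix.row Uinv j) = 0"
    and exceptional: "\<exists>j<alphabet_size q. jordan_matrix blocks $$ (j, j) = complex_of_real lc \<and>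
          weight q (Matrix.row Uinv j) \<noteq> 0"
    and gt1: "lc > 1"
    and pisot: "pisot lc"
    and mult: "Polynomial.order (complex_of_real lc) (char_poly (subst_matrix q \<pi>)) =
          kernel_dim (char_matrix (subst_matrix q \<pi>) (complex_of_real lc))"
  shows "\<forall>(P :: 'y measure) \<kappa>.
          ergodic_decomposition (leb_I \<Otimes>\<^sub>M count_space UNIV) (Z_extension q \<pi>) P \<kappa> \<longrightarrow>
          infinitely_many_components P \<kappa>"
proof (intro allI impI, rule infinitely_many_componentsI, assumption)
  fix N :: nat
  \<comment> \<open>This choice makes \<open>\<theta> * N < 1\<close>, which separates
    \<open>N\<close> rotated copies of one set.\<close>
  obtain j where j: "real N < lc ^ j" using real_arch_pow[OF gt1] by blast
  define \<theta> where "\<theta> = 1 / lc ^ j"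
  have \<theta>: "\<theta> > 0" "\<theta> * N < 1" using j gt1 unfolding \<theta>_def by simp_all
  have sum: "summable (phase_defect q \<pi> \<theta>)"
    unfolding phase_defect_def[abs_def] \<theta>_def
    using summable_letter_sum_minus_eigenvalue[OF perm q_pos jordan weights mult] gt1
    by (intro summable_sum summable_phase) auto
  define G where "G = (\<Inter>k. recurrent_points q \<pi> k)"
  have Gsets: "G \<in> sets leb_I"
    unfolding G_def using sets_recurrent_points[OF perm q_pos] by (intro sets.countable_INT') auto
  have "(\<Union>k. {0..<1} - recurrent_points q \<pi> k) \<in> null_sets leb_I"
    using recurrent_points_full[OF perm q_pos erg] by (rule null_sets_UN)
  moreover have "{0..<1} - G = (\<Union>k. {0..<1} - recurrent_points q \<pi> k)" unfolding G_def by auto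
  ultimately have null: "{0..<1} - G \<in> null_sets leb_I" by simp
  have Gpos: "emeasure leb_I G \<noteq> 0"
  proof
    assume "emeasure leb_I G = 0"
    then have "G \<union> ({0..<1} - G) \<in> null_sets leb_I" using null Gsets by (intro null_sets.Un) auto
    moreover have "G \<subseteq> {0..<1}" unfolding G_def recurrent_points_def by auto
    ultimately have "space leb_I \<in> null_sets leb_I" by (simp add: Un_absorb1)
    then show False using prob_space.emeasure_space_1[OF prob_space_leb_I] by auto
  qed
  have Ginv: "rot_odometer q \<pi> x \<in> G \<longleftrightarrow> x \<in> G" if "x \<in> {0..<1}" for x
    unfolding G_def using recurrent_points_invariant[OF perm q_pos that] by auto
  \<comment> \<open>Defined by \<open>lim\<close> at every point, which yields measurability on the
    whole space; convergence is claimed only on \<open>G\<close>.\<close>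
  define E where "E x = lim (\<lambda>k. phase \<theta> (entry_sum q \<pi> k x))" for x
  have Emeas: "E \<in> borel_measurable leb_I"
    unfolding E_def by (intro borel_measurable_lim_metric measurable_entry_phase[OF perm q_pos])
  have Elim: "(\<lambda>k. phase \<theta> (entry_sum q \<pi> k x)) \<longlonglongrightarrow> E x" if "x \<in> G" for x
    unfolding E_def using that by (intro entry_phase_limit[OF perm q_pos stat sum]) (auto simp: G_def)
  have Enorm: "norm (E x) = 1" if "x \<in> G" for x
    using tendsto_norm[OF Elim[OF that]] by (simp add: LIMSEQ_const_iff)
  have Eeq: "phase \<theta> (skew x) * E (rot_odometer q \<pi> x) = E x" if x: "x \<in> G" for x
  proof -
    let ?F = "rot_odometer q \<pi>"
    have "x \<in> {0..<1}" using x unfolding G_def recurrent_points_def by auto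
    then have Fx: "?F x \<in> G" using Ginv x by blast
    have "(\<lambda>k. phase \<theta> (skew x) * phase \<theta> (entry_sum q \<pi> k (?F x)) - phase \<theta> (entry_sum q \<pi> k x))
        \<longlonglongrightarrow> phase \<theta> (skew x) * E (?F x) - E x"
      by (intro tendsto_intros Elim Fx x)
    moreover have "(\<lambda>k. phase \<theta> (skew x) * phase \<theta> (entry_sum q \<pi> k (?F x)) - phase \<theta> (entry_sum q \<pi> k x))
        \<longlonglongrightarrow> 0"
    proof (rule Lim_null_comparison)
      show "phase_defect q \<pi> \<theta> \<longlonglongrightarrow> 0" using sum by (rule summable_LIMSEQ_zero)
      show "\<forall>\<^sub>F k in sequentially. norm (phase \<theta> (skew x) * phase \<theta> (entry_sum q \<pi> k (?F x))
          - phase \<theta> (entry_sum q \<pi> k x)) \<le> phase_defect q \<pi> \<theta> k"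
        using eventually_ge_at_top[of 1]
      proof eventually_elim
        case (elim k)
        then show ?case
          using entry_sum_equivariant[OF perm q_pos stat elim, of x \<theta>] x
          unfolding G_def by (simp add: phase_add)
      qed
    qed
    ultimately have "phase \<theta> (skew x) * E (?F x) - E x = 0" by (rule LIMSEQ_unique)
    then show ?thesis by simp
  qed
  show "\<exists>A. disjoint_family_on A {..<N} \<and> (\<forall>i<N. A i \<in> sets (leb_I \<Otimes>\<^sub>M count_space UNIV) \<and>
      Z_extension q \<pi> -` A i \<inter> space (leb_I \<Otimes>\<^sub>M count_space UNIV) = A i \<and>
      emeasure (leb_I \<Otimes>\<^sub>M count_space UNIV) (A i) \<noteq> 0)"
    by (rule disjoint_invariant_sets[OF perm q_pos Gsets Gpos Ginv Emeas Enorm Eeq \<theta>])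
qed

end
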